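(* Let $Y$ be a real-valued polynomial jump-diffusion process with extended generator $\mathcal G$ and filtration $\{\mathcal F_t\}_{t\ge0}$. Let $p_0,p_1$ be real polynomials of degree at most $n_0,n_1$ respectively, let $n=\max\{n_0,n_1\}\ge1$, and let $\vec p_0,\vec p_1\in\mathbb R^{n+1}$ be their coefficient vectors, i.e. $p_k(x)=\vec p_k^{\top}H_n(x)$. Then for $0\le t<s_0<s_1$, $$\mathbb E\left[p_1(Y(s_0))\,p_0(Y(s_1))\,\middle|\,\mathcal F_t\right]=\vec p_1^{\top}\left\{vec^{-1}\circ D_{n+1}\,e^{G_{2n}(s_0-t)}\,E_{n+1}\circ vec\left(X_n(Y(t))\right)\right\}e^{G_n^{\top}(s_1-s_0)}\,\vec p_0 .$$
   Context: Polynomial process. Let $(\Omega,\mathcal F,\mathbb P)$ be a stochastic basis with filtration $\{\mathcal F_t\}_{t\ge0}$. Consider $$\mathcal G f(x)=b(x)f'(x)+\tfrac12\sigma^2(x)f''(x)+\int_{\mathbb R}\left(f(x+z)-f(x)-f'(x)z\right)\ell(x,dz),$$ with $b,\sigma:\mathbb R\to\mathbb R$ measurable and $\ell$ a transition kernel with $\ell(x,\{0\})=0$ and $\int_{\mathbb R}|z|\wedge|z|^2\,\ell(x,dz)<\infty$ for all $x$. $Y$ is a jump-diffusion with extended generator $\mathcal G$: for every bounded $C^2$ function $f$ and every $y\in\mathbb R$, $f(Y(t))-f(y)-\int_0^t\mathcal G f(Y(s))ds$ is an $(\mathcal F_t,\mathbb P_y)$-local martingale ($\mathbb P_y$: law with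 $Y(0)=y$). Let $\mathrm{Pol}_n(\mathbb R)$ be the real polynomials of degree at most $n$. $\mathcal G$ is well defined on polynomials if $\int|z|^n\ell(x,dz)<\infty$ for all $x$ and $n\ge2$, and $\mathcal G f=0$ for $f\equiv 0$; it is polynomial if moreover it maps $\mathrm{Pol}_n(\mathbb R)$ into itself for each $n\in\mathbb N$; then $Y$ is called a polynomial jump-diffusion process. Known standing fact: in this case, for every polynomial $p$ and $y\in\mathbb R$, $p(Y(t))-p(y)-\int_0^t\mathcal G p(Y(s))ds$ is an $(\mathcal F_t,\mathbb P_y)$-martingale. $H_n(x)=(1,x,\dots,x^n)^{\top}$, and $G_n\in\mathbb R^{(n+1)\times(n+1)}$ is the generator matrix, defined by $\mathcal G H_n(x)=G_nH_n(x)$ ($\mathcal G$ acting componentwise); $G_{2n}$ is the generator matrix of order $2n$. $X_n(x):=H_n(x)H_n(x)^{\top}\in\mathbb R^{(n+1)\times(n+1)}$. $vec$ stacks the columns of a matrix into one column vector, and $vec^{-1}$ is its inverse, here from $\mathbb R^{(n+1)^2}$ to $\mathbb R^{(n+1)\times(n+1)}$. $\otimes$ is the Kronecker product and $\vec e_{k,j}$ the $j$-th canonical basis (column) vector of $\mathbb R^k$. For $a,c\ge1$, $$E_{a,c}=\sum_{i=1}^{a}\vec e_{a+c-1,i}\otimes\vec e_{c,1}^{\top}\otimes\vec e_{a,i}^{\top}+\sum_{i=2}^{c}\vec e_{a+c-1,a+i-1}\otimes\vec e_{c,i}^{\top}\otimes\vec e_{a,a}^{\top},\qquad D_{a,c}=\sum_{i=1}^{a}\sum_{j=1}^{c}\vec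 e_{a+c-1,i+j-1}^{\top}\otimes\vec e_{c,j}\otimes\vec e_{a,i},$$ and $E_{n+1}:=E_{n+1,n+1}\in\mathbb R^{(2n+1)\times(n+1)^2}$, $D_{n+1}:=D_{n+1,n+1}\in\mathbb R^{(n+1)^2\times(2n+1)}$. *)

theory Defs
  imports "HOL-Probability.Probability" "HOL-Computational_Algebra.Polynomial"
    "Jordan_Normal_Form.Matrix"
begin

unbundle no vec_syntax
unbundle no inner_syntax

section \<open>Martingales in continuous time\<close>

text \<open>Time is \<^typ>\<open>real\<close>; only the times \<open>t \<ge> 0\<close> matter.\<close>

definition martingale ::
  "'a measure \<Rightarrow> (real \<Rightarrow> 'a measure) \<Rightarrow> (real \<Rightarrow> 'a \<Rightarrow> real) \<Rightarrow> bool" where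
  "martingale N F X \<longleftrightarrow>
     (\<forall>t\<ge>0. X t \<in> borel_measurable (F t) \<and> integrable N (X t)) \<and>
     (\<forall>s t. 0 \<le> s \<longrightarrow> s \<le> t \<longrightarrow> (AE \<omega> in N. real_cond_exp N (F s) (X t) \<omega> = X s \<omega>))"

text \<open>The localizing stopping times may take the value \<open>\<infinity>\<close>, whereas \<^const>\<open>stopping_time\<close>
  would force them to be finite (their values would have the index type of the filtration).\<close>

definition local_martingale ::
  "'a measure \<Rightarrow> (real \<Rightarrow> 'a measure) \<Rightarrow> (real \<Rightarrow> 'a \<Rightarrow> real) \<Rightarrow> bool" where
  "local_martingale N F X \<longleftrightarrow>
     (\<exists>\<tau> :: nat \<Rightarrow> 'a \<Rightarrow> ennreal.
        (\<forall>k. \<forall>t\<ge>0. Measurable.pred (F t) (\<lambda>\<omega>. \<tau> k \<omega> \<le> ennreal t)) \<and>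
        (AE \<omega> in N. incseq (\<lambda>k. \<tau> k \<omega>) \<and> (\<lambda>k. \<tau> k \<omega>) \<longlonglongrightarrow> \<infinity>) \<and>
        (\<forall>k. martingale N F (\<lambda>t \<omega>. X (enn2real (min (ennreal t) (\<tau> k \<omega>))) \<omega>)))"

section \<open>Polynomial jump-diffusions\<close>

definition bounded_C2 :: "(real \<Rightarrow> real) \<Rightarrow> bool" where
  "bounded_C2 f \<longleftrightarrow> bounded (range f) \<and> f differentiable_on UNIV \<and>
     deriv f differentiable_on UNIV \<and> continuous_on UNIV (deriv (deriv f))"

definition generator ::
  "(real \<Rightarrow> real) \<Rightarrow> (real \<Rightarrow> real) \<Rightarrow> (real \<Rightarrow> real measure) \<Rightarrow> (real \<Rightarrow> real) \<Rightarrow> real \<Rightarrow> real" where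
  "generator b \<sigma> \<nu> f x = b x * deriv f x + 1 / 2 * (\<sigma> x)\<^sup>2 * deriv (deriv f) x +
     (LINT z|\<nu> x. f (x + z) - f x - deriv f x * z)"

text \<open>The kernel need not be finite: \<open>\<nu> x\<close> may have infinite mass near \<open>0\<close>.\<close>

definition jump_kernel :: "(real \<Rightarrow> real measure) \<Rightarrow> bool" where
  "jump_kernel \<nu> \<longleftrightarrow>
     (\<forall>x. sets (\<nu> x) = sets borel) \<and>
     (\<forall>A\<in>sets borel. (\<lambda>x. emeasure (\<nu> x) A) \<in> borel_measurable borel) \<and>
     (\<forall>x. emeasure (\<nu> x) {0} = 0) \<and>
     (\<forall>x. (\<integral>\<^sup>+ z. ennreal (min \<bar>z\<bar> (\<bar>z\<bar>\<^sup>2)) \<partial>\<nu> x) < \<infinity>)"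

definition cadlag :: "(real \<Rightarrow> real) \<Rightarrow> bool" where
  "cadlag u \<longleftrightarrow> (\<forall>t\<ge>0. continuous (at_right t) u) \<and> (\<forall>t>0. \<exists>l. (u \<longlongrightarrow> l) (at_left t))"

text \<open>\<open>M\<close> carries the measurable space \<open>(\<Omega>, \<F>)\<close> and \<open>P y\<close> is the probability measure on it under
  which \<open>Y\<close> starts in \<open>y\<close>. The \<open>\<sigma>\<close>-algebras \<open>F t\<close> with \<open>t < 0\<close> play no role; a filtration
  indexed by \<open>t \<ge> 0\<close> is extended by \<open>F t = F 0\<close>. The time integral in \<open>extended_generator\<close> takes the
  default value \<open>0\<close> where it does not exist; for a polynomial generator and a bounded \<open>C\<^sup>2\<close>
  function it always exists, because the integrand is then locally bounded in \<open>s\<close>.\<close>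

locale jump_diffusion = filtration "space M" F
  for M :: "'a measure" and F :: "real \<Rightarrow> 'a measure" +
  fixes P :: "real \<Rightarrow> 'a measure"
    and Y :: "real \<Rightarrow> 'a \<Rightarrow> real"
    and b \<sigma> :: "real \<Rightarrow> real"
    and \<nu> :: "real \<Rightarrow> real measure"
  assumes sets_F_le: "\<And>t. sets (F t) \<subseteq> sets M"
    and prob_space_P: "\<And>y. prob_space (P y)"
    and sets_P: "\<And>y. sets (P y) = sets M"
    and b_measurable: "b \<in> borel_measurable borel"
    and \<sigma>_measurable: "\<sigma> \<in> borel_measurable borel"
    and jump_kernel: "jump_kernel \<nu>"
    and adapted: "\<And>t. t \<ge> 0 \<Longrightarrow> Y t \<in> borel_measurable (F t)"
    and cadlag_paths: "\<And>\<omega>. \<omega> \<in> space M \<Longrightarrow> cadlag (\<lambda>t. Y t \<omega>)"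
    and start: "\<And>y. AE \<omega> in P y. Y 0 \<omega> = y"
    and extended_generator:
      "\<And>f y. bounded_C2 f \<Longrightarrow> local_martingale (P y) F
         (\<lambda>t \<omega>. f (Y t \<omega>) - f y - (LBINT s:{0..t}. generator b \<sigma> \<nu> f (Y s \<omega>)))"

definition well_defined_on_polynomials ::
  "(real \<Rightarrow> real) \<Rightarrow> (real \<Rightarrow> real) \<Rightarrow> (real \<Rightarrow> real measure) \<Rightarrow> bool" where
  "well_defined_on_polynomials b \<sigma> \<nu> \<longleftrightarrow>
     (\<forall>x. \<forall>n\<ge>2. (\<integral>\<^sup>+ z. ennreal (\<bar>z\<bar> ^ n) \<partial>\<nu> x) < \<infinity>) \<and>
     generator b \<sigma> \<nu> (\<lambda>x. 0) = (\<lambda>x. 0)"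

definition polynomial_generator ::
  "(real \<Rightarrow> real) \<Rightarrow> (real \<Rightarrow> real) \<Rightarrow> (real \<Rightarrow> real measure) \<Rightarrow> bool" where
  "polynomial_generator b \<sigma> \<nu> \<longleftrightarrow> well_defined_on_polynomials b \<sigma> \<nu> \<and>
     (\<forall>n. \<forall>p :: real poly. degree p \<le> n \<longrightarrow>
        (\<exists>q. degree q \<le> n \<and> generator b \<sigma> \<nu> (poly p) = poly q))"

locale polynomial_jump_diffusion = jump_diffusion +
  assumes polynomial: "polynomial_generator b \<sigma> \<nu>"

section \<open>Matrices\<close>

text \<open>Vector and matrix indices start at \<open>0\<close>.\<close>

definition mono_vec :: "nat \<Rightarrow> real \<Rightarrow> real vec" where
  "mono_vec n x = Matrix.vec (n + 1) (\<lambda>i. x ^ i)"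

definition col_mat :: "'a vec \<Rightarrow> 'a mat" where
  "col_mat v = mat_of_cols (dim_vec v) [v]"

definition mono_mat :: "nat \<Rightarrow> real \<Rightarrow> real mat" where
  "mono_mat n x = col_mat (mono_vec n x) * transpose_mat (col_mat (mono_vec n x))"

definition generator_matrix :: "((real \<Rightarrow> real) \<Rightarrow> real \<Rightarrow> real) \<Rightarrow> nat \<Rightarrow> real mat" where
  "generator_matrix \<G> n = (THE A. A \<in> carrier_mat (n + 1) (n + 1) \<and>
     (\<forall>x. Matrix.vec (n + 1) (\<lambda>i. \<G> (\<lambda>u. mono_vec n u $ i) x) = A *\<^sub>v mono_vec n x))"

definition mat_exp :: "real mat \<Rightarrow> real mat" where
  "mat_exp A = Matrix.mat (dim_row A) (dim_row A) (\<lambda>ij. \<Sum>k. (A ^\<^sub>m k) $$ ij / fact k)"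

definition vectorize :: "'a mat \<Rightarrow> 'a vec" where
  "vectorize A = Matrix.vec (dim_row A * dim_col A) (\<lambda>k. A $$ (k mod dim_row A, k div dim_row A))"

definition unvectorize :: "nat \<Rightarrow> 'a vec \<Rightarrow> 'a mat" where
  "unvectorize m = inv_into (carrier_mat m m) vectorize"

definition kronecker :: "real mat \<Rightarrow> real mat \<Rightarrow> real mat" (infixl \<open>\<otimes>\<^sub>K\<close> 72) where
  "A \<otimes>\<^sub>K B = Matrix.mat (dim_row A * dim_row B) (dim_col A * dim_col B)
     (\<lambda>(i, j). A $$ (i div dim_row B, j div dim_col B) * B $$ (i mod dim_row B, j mod dim_col B))"

text \<open>The \<open>j\<close>-th canonical basis column of dimension \<open>k\<close>, counted from \<open>j = 1\<close>.\<close>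

definition basis_col :: "nat \<Rightarrow> nat \<Rightarrow> real mat" where
  "basis_col k j = col_mat (unit_vec k (j - 1))"

definition sum_mat :: "nat \<Rightarrow> nat \<Rightarrow> ('i \<Rightarrow> real mat) \<Rightarrow> 'i set \<Rightarrow> real mat" where
  "sum_mat r c f I = Matrix.mat r c (\<lambda>ij. \<Sum>k\<in>I. f k $$ ij)"

definition E_mat :: "nat \<Rightarrow> nat \<Rightarrow> real mat" where
  "E_mat a c =
     sum_mat (a + c - 1) (a * c)
       (\<lambda>i. basis_col (a + c - 1) i \<otimes>\<^sub>K transpose_mat (basis_col c 1) \<otimes>\<^sub>K transpose_mat (basis_col a i)) {1..a} +
     sum_mat (a + c - 1) (a * c)
       (\<lambda>i. basis_col (a + c - 1) (a + i - 1) \<otimes>\<^sub>K transpose_mat (basis_col c i) \<otimes>\<^sub>K transpose_mat (basis_col a a)) {2..c}"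

definition D_mat :: "nat \<Rightarrow> nat \<Rightarrow> real mat" where
  "D_mat a c = sum_mat (a * c) (a + c - 1)
     (\<lambda>(i, j). transpose_mat (basis_col (a + c - 1) (i + j - 1)) \<otimes>\<^sub>K basis_col c j \<otimes>\<^sub>K basis_col a i) ({1..a} \<times> {1..c})"

end

theory Submission
  imports Defs
begin

text \<open>
  The only martingales given are the local ones for bounded \<open>C\<^sup>2\<close> functions, so polynomials are
  approximated by \<open>g / (1 + \<epsilon> g)\<close> with \<open>g \<ge> 0\<close> a polynomial. Since \<open>u \<mapsto> u / (1 + \<epsilon> u)\<close> is concave,
  \<open>\<G> g \<le> C g\<close> yields \<open>\<G> f \<le> C f\<close> for \<open>f = g / (1 + \<epsilon> g)\<close>; Fatou's lemma along the localizing
  sequence, Gronwall's inequality and \<open>\<epsilon> \<rightarrow> 0\<close>, with \<open>g = (1 + x\<^sup>2)\<^sup>k\<close>, show that all moments of \<open>Y t\<close>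
  are finite, locally uniformly in \<open>t\<close>. These moments dominate everything that occurs in Dynkin's
  formula, which therefore passes to the limit: for polynomials \<open>p\<close> and \<open>A \<in> F s\<close>, the functions
  \<open>t \<mapsto> E[p(Y t); A]\<close> satisfy a linear integral equation whose matrix is the generator matrix, and
  Picard iteration identifies the solution with the matrix exponential. The correlator follows by
  conditioning first on \<open>F s0\<close> and then on \<open>F t\<close>: \<open>E\<close> extracts \<open>H\<^sub>2\<^sub>n\<close> from \<open>vec X\<^sub>n\<close>, and \<open>D\<close> rebuilds
  a Hankel matrix from the propagated moments.
\<close>

section \<open>Polynomial growth\<close>

text \<open>The estimate \<open>\<G> g \<le> C g\<close> is where preservation of the degree enters:
  for g = \<open>(1 + x\<^sup>2) ^ k\<close> the function \<G> g is again a polynomial of degree at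
  most 2k, and the weight g, being at least 1 and of full degree, dominates every such polynomial.
  Damping keeps this one-sided bound with the same C, and a one-sided bound is all that Fatou and
  Gronwall require. Two-sided control comes afterwards: Dynkin's formula needs a majorant of \<G> f
  that is uniform in \<epsilon>. Polynomial growth of the drift, of the squared diffusion
  coefficient and of the jump moments is not among the assumptions; it has to be read off from the
  action of \<G> on the monomials, one degree at a time. Expectations are restricted to a fixed
  event A in F s because a conditional expectation is determined only up to a null set that depends
  on t, whereas E[p(Y t); A] is a genuine function of t that can satisfy an integral
  equation.\<close>

definition poly_growth :: "(real \<Rightarrow> real) \<Rightarrow> bool" where
  "poly_growth g \<longleftrightarrow> (\<exists>C k. \<forall>x. \<bar>g x\<bar> \<le> C * (1 + x\<^sup>2) ^ k)"

lemma weight_ge_1: "1 \<le> (1 + (x::real)\<^sup>2) ^ k"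
  by (rule one_le_power) simp

lemma weight_pos: "0 < (1 + (x::real)\<^sup>2) ^ k"
  using weight_ge_1[of x k] by linarith

lemma abs_power_le_weight:
  fixes x :: real assumes "i \<le> 2 * k" shows "\<bar>x\<bar> ^ i \<le> (1 + x\<^sup>2) ^ k"
proof (cases "\<bar>x\<bar> \<le> 1")
  case True
  then show ?thesis using power_le_one[OF abs_ge_zero, of x i] weight_ge_1[of x k] by linarith
next
  case False
  then have "\<bar>x\<bar> ^ i \<le> \<bar>x\<bar> ^ (2 * k)" using assms by (intro power_increasing) auto
  also have "\<dots> = (x\<^sup>2) ^ k" by (simp add: power_mult)
  also have "\<dots> \<le> (1 + x\<^sup>2) ^ k" by (rule power_mono) auto
  finally show ?thesis .
qed

lemma poly_growthE:
  assumes "poly_growth g"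
  obtains C k where "C \<ge> 0" "\<And>x. \<bar>g x\<bar> \<le> C * (1 + x\<^sup>2) ^ k"
proof -
  obtain C k where *: "\<And>x. \<bar>g x\<bar> \<le> C * (1 + x\<^sup>2) ^ k" using assms by (auto simp: poly_growth_def)
  have "0 \<le> C" using *[of 0] by simp
  then show ?thesis using that * by blast
qed

lemma poly_growth_mono: "poly_growth g \<Longrightarrow> (\<And>x. \<bar>f x\<bar> \<le> \<bar>g x\<bar>) \<Longrightarrow> poly_growth f"
  unfolding poly_growth_def by (meson order_trans)

lemma poly_growth_const: "poly_growth (\<lambda>x. c)"
  unfolding poly_growth_def by (intro exI[of _ "\<bar>c\<bar>"] exI[of _ 0]) auto

lemma poly_growth_ident: "poly_growth (\<lambda>x. x)"
  unfolding poly_growth_def using abs_power_le_weight[of 1 1] by (intro exI[of _ 1] exI[of _ 1]) auto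

lemma poly_growth_mult:
  assumes "poly_growth f" "poly_growth g" shows "poly_growth (\<lambda>x. f x * g x)"
proof -
  obtain C k where f: "C \<ge> 0" "\<And>x. \<bar>f x\<bar> \<le> C * (1 + x\<^sup>2) ^ k" using poly_growthE[OF assms(1)] by blast
  obtain D l where g: "D \<ge> 0" "\<And>x. \<bar>g x\<bar> \<le> D * (1 + x\<^sup>2) ^ l" using poly_growthE[OF assms(2)] by blast
  have "\<bar>f x * g x\<bar> \<le> (C * D) * (1 + x\<^sup>2) ^ (k + l)" for x
    using mult_mono[OF f(2)[of x] g(2)[of x]] f(1) by (simp add: abs_mult power_add mult_ac)
  then show ?thesis unfolding poly_growth_def by blast
qed

lemma poly_growth_add:
  assumes "poly_growth f" "poly_growth g" shows "poly_growth (\<lambda>x. f x + g x)"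
proof -
  obtain C k where f: "C \<ge> 0" "\<And>x. \<bar>f x\<bar> \<le> C * (1 + x\<^sup>2) ^ k" using poly_growthE[OF assms(1)] by blast
  obtain D l where g: "D \<ge> 0" "\<And>x. \<bar>g x\<bar> \<le> D * (1 + x\<^sup>2) ^ l" using poly_growthE[OF assms(2)] by blast
  have "\<bar>f x + g x\<bar> \<le> (C + D) * (1 + x\<^sup>2) ^ (k + l)" for x
  proof -
    have "C * (1 + x\<^sup>2) ^ k \<le> C * (1 + x\<^sup>2) ^ (k + l)" "D * (1 + x\<^sup>2) ^ l \<le> D * (1 + x\<^sup>2) ^ (k + l)"
      using f(1) g(1) by (auto intro!: mult_left_mono power_increasing)
    then show ?thesis using f(2)[of x] g(2)[of x] by (simp add: distrib_right)
  qed
  then show ?thesis unfolding poly_growth_def by blast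
qed

lemma poly_growth_uminus: "poly_growth f \<Longrightarrow> poly_growth (\<lambda>x. - f x)"
  by (simp add: poly_growth_def)

lemma poly_growth_diff: "poly_growth f \<Longrightarrow> poly_growth g \<Longrightarrow> poly_growth (\<lambda>x. f x - g x)"
  using poly_growth_add[OF _ poly_growth_uminus, of f g] by simp

lemma poly_growth_power: "poly_growth f \<Longrightarrow> poly_growth (\<lambda>x. f x ^ n)"
  by (induction n) (auto intro: poly_growth_mult poly_growth_const)

lemma poly_growth_sum: "(\<And>i. i \<in> I \<Longrightarrow> poly_growth (f i)) \<Longrightarrow> poly_growth (\<lambda>x. \<Sum>i\<in>I. f i x)"
  by (induction I rule: infinite_finite_induct) (auto intro: poly_growth_add poly_growth_const)

lemma poly_growth_abs: "poly_growth f \<Longrightarrow> poly_growth (\<lambda>x. \<bar>f x\<bar>)"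
  by (simp add: poly_growth_def)

lemma poly_growth_poly: "poly_growth (poly p)"
  unfolding poly_altdef by (intro poly_growth_sum poly_growth_mult poly_growth_const poly_growth_power poly_growth_ident)

text \<open>Unlike \<open>poly_growth_poly\<close>, this controls the exponent of the weight by the
  degree. That precision is what bounds the generator of a weight by a multiple of the same
  weight.\<close>

lemma poly_le_weight:
  assumes "degree p \<le> 2 * k"
  obtains C :: real where "C \<ge> 0" "\<And>x. \<bar>poly p x\<bar> \<le> C * (1 + x\<^sup>2) ^ k"
proof
  show "(\<Sum>i\<le>degree p. \<bar>coeff p i\<bar>) \<ge> 0" by (simp add: sum_nonneg)
  fix x :: real
  have "\<bar>poly p x\<bar> \<le> (\<Sum>i\<le>degree p. \<bar>coeff p i * x ^ i\<bar>)"
    unfolding poly_altdef by (rule sum_abs)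
  also have "\<dots> \<le> (\<Sum>i\<le>degree p. \<bar>coeff p i\<bar> * (1 + x\<^sup>2) ^ k)"
    using assms by (intro sum_mono) (auto simp: abs_mult power_abs intro!: mult_left_mono abs_power_le_weight)
  finally show "\<bar>poly p x\<bar> \<le> (\<Sum>i\<le>degree p. \<bar>coeff p i\<bar>) * (1 + x\<^sup>2) ^ k"
    by (simp add: sum_distrib_right)
qed

lemmas poly_growth_intros = poly_growth_mult poly_growth_add poly_growth_diff poly_growth_power
  poly_growth_sum poly_growth_abs poly_growth_const poly_growth_ident poly_growth_poly

section \<open>The generator on functions of polynomial growth\<close>

text \<open>The derivatives are carried as explicit functions, so that growth bounds can be stated
  for their closed formulas rather than for \<open>deriv\<close>.\<close>

definition C2_derivs :: "(real \<Rightarrow> real) \<Rightarrow> (real \<Rightarrow> real) \<Rightarrow> (real \<Rightarrow> real) \<Rightarrow> bool" where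
  "C2_derivs f f' f'' \<longleftrightarrow> (\<forall>x. (f has_real_derivative f' x) (at x)) \<and>
     (\<forall>x. (f' has_real_derivative f'' x) (at x)) \<and> continuous_on UNIV f''"

lemma C2_derivs_deriv:
  assumes "C2_derivs f f' f''" shows "deriv f = f'" "deriv f' = f''"
  using assms by (auto simp: C2_derivs_def intro!: DERIV_imp_deriv)

lemma C2_derivs_continuous:
  assumes "C2_derivs f f' f''"
  shows "continuous_on UNIV f" "continuous_on UNIV f'" "continuous_on UNIV f''"
  using assms by (auto simp: C2_derivs_def continuous_on_eq_continuous_at intro: DERIV_isCont)

lemma C2_derivs_measurable:
  assumes "C2_derivs f f' f''"
  shows "f \<in> borel_measurable borel" "f' \<in> borel_measurable borel" "f'' \<in> borel_measurable borel"
  using C2_derivs_continuous[OF assms] by (auto intro: borel_measurable_continuous_onI)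

lemma C2_derivs_poly: "C2_derivs (poly p) (poly (pderiv p)) (poly (pderiv (pderiv p)))"
  by (auto simp: C2_derivs_def poly_DERIV intro!: continuous_intros)

lemma C2_derivs_add:
  "C2_derivs f f' f'' \<Longrightarrow> C2_derivs g g' g'' \<Longrightarrow>
    C2_derivs (\<lambda>x. f x + g x) (\<lambda>x. f' x + g' x) (\<lambda>x. f'' x + g'' x)"
  by (auto simp: C2_derivs_def intro!: derivative_intros continuous_intros)

lemma bounded_C2I:
  assumes "C2_derivs f f' f''" "\<And>x. \<bar>f x\<bar> \<le> B"
  shows "bounded_C2 f"
  unfolding bounded_C2_def C2_derivs_deriv[OF assms(1)]
  using assms by (auto simp: C2_derivs_def bounded_iff differentiable_on_def real_differentiable_def)

lemma generator_C2:
  "C2_derivs f f' f'' \<Longrightarrow> generator b \<sigma> \<nu> f x = b x * f' x + 1 / 2 * (\<sigma> x)\<^sup>2 * f'' x +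
     (LINT z|\<nu> x. f (x + z) - f x - f' x * z)"
  by (simp add: generator_def C2_derivs_deriv)

lemma Taylor_remainder:
  assumes "C2_derivs f f' f''"
  obtains t where "\<bar>t\<bar> \<le> \<bar>z\<bar>" "f (x + z) - f x - f' x * z = f'' (x + t) / 2 * z\<^sup>2"
proof -
  \<comment> \<open>Maclaurin's theorem expects one family indexed by the order of the derivative;
    only the orders 0, 1 and 2 are ever consulted.\<close>
  define diff where "diff = (\<lambda>m::nat. if m = 0 then (\<lambda>u. f (x + u)) else if m = 1 then (\<lambda>u. f' (x + u)) else (\<lambda>u. f'' (x + u)))"
  have D: "((\<lambda>u. f (x + u)) has_real_derivative f' (x + t)) (at t)"
    "((\<lambda>u. f' (x + u)) has_real_derivative f'' (x + t)) (at t)" for t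
    using assms by (auto simp: C2_derivs_def DERIV_shift add.commute[of x] simp flip: DERIV_shift)
  have "\<exists>t. \<bar>t\<bar> \<le> \<bar>z\<bar> \<and> f (x + z) = (\<Sum>m<2. diff m 0 / fact m * z ^ m) + diff 2 t / fact 2 * z ^ 2"
    using D by (intro Maclaurin_bi_le[where f = "\<lambda>u. f (x + u)"]) (auto simp: diff_def less_2_cases_iff)
  then show ?thesis using that by (auto simp: diff_def numeral_2_eq_2)
qed

text \<open>Since |t| \<le> |z| in the Lagrange remainder, \<open>1 + (x + t)\<^sup>2 \<le> 2 * (1 +
  x\<^sup>2) * (1 + z\<^sup>2)\<close> separates the two variables. The factor in z contains only
  powers of order at least 2, exactly those that the kernel integrates. One \<open>2 ^ k\<close>
  comes from this separation, the other from
  \<open>1 + z\<^sup>2 \<le> 2 * max 1 (z\<^sup>2)\<close>.\<close>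

lemma Taylor_remainder_bound:
  assumes "C2_derivs f f' f''" "\<And>x. \<bar>f'' x\<bar> \<le> C * (1 + x\<^sup>2) ^ k"
  shows "\<bar>f (x + z) - f x - f' x * z\<bar> \<le> C * (4 ^ k * (1 + x\<^sup>2) ^ k) * (z\<^sup>2 + z ^ (2 * k + 2))"
proof -
  obtain t where t: "\<bar>t\<bar> \<le> \<bar>z\<bar>" "f (x + z) - f x - f' x * z = f'' (x + t) / 2 * z\<^sup>2"
    using Taylor_remainder[OF assms(1)] by blast
  have C: "0 \<le> C" using assms(2)[of 0] by simp
  have zk: "(1 + z\<^sup>2) ^ k \<le> 2 ^ k * (1 + z ^ (2 * k))"
  proof -
    have "(1 + z\<^sup>2) ^ k \<le> (2 * max 1 (z\<^sup>2)) ^ k" by (intro power_mono) auto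
    also have "\<dots> = 2 ^ k * max 1 (z\<^sup>2) ^ k" by (simp add: power_mult_distrib)
    also have "max 1 (z\<^sup>2) ^ k \<le> 1 + z ^ (2 * k)"
      by (auto simp: max_def power_mult)
    finally show ?thesis by simp
  qed
  have "1 + (x + t)\<^sup>2 \<le> 2 * (1 + x\<^sup>2) * (1 + z\<^sup>2)"
  proof -
    have "t\<^sup>2 \<le> z\<^sup>2" using t(1) by (simp add: abs_le_square_iff)
    moreover have "2 * x * t \<le> x\<^sup>2 + t\<^sup>2" by (rule sum_squares_bound)
    moreover have "0 \<le> x\<^sup>2 * z\<^sup>2" by simp
    moreover have "2 * (1 + x\<^sup>2) * (1 + z\<^sup>2) = 2 + 2 * x\<^sup>2 + 2 * z\<^sup>2 + 2 * (x\<^sup>2 * z\<^sup>2)" by (simp add: algebra_simps)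
    moreover have "0 \<le> x\<^sup>2" by simp
    ultimately show ?thesis unfolding power2_sum by linarith
  qed
  then have "(1 + (x + t)\<^sup>2) ^ k \<le> (2 * (1 + x\<^sup>2) * (1 + z\<^sup>2)) ^ k" by (intro power_mono) auto
  also have "\<dots> = 2 ^ k * (1 + x\<^sup>2) ^ k * (1 + z\<^sup>2) ^ k" by (simp only: power_mult_distrib)
  also have "\<dots> \<le> 2 ^ k * (1 + x\<^sup>2) ^ k * (2 ^ k * (1 + z ^ (2 * k)))"
    using zk by (intro mult_left_mono) auto
  also have "\<dots> = 4 ^ k * (1 + x\<^sup>2) ^ k * (1 + z ^ (2 * k))"
    by (simp add: power_mult_distrib[symmetric] flip: mult.assoc)
  finally have "\<bar>f'' (x + t)\<bar> \<le> C * (4 ^ k * (1 + x\<^sup>2) ^ k * (1 + z ^ (2 * k)))"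
    using assms(2)[of "x + t"] C by (meson mult_left_mono order_trans)
  then have "\<bar>f'' (x + t)\<bar> * z\<^sup>2 \<le> C * (4 ^ k * (1 + x\<^sup>2) ^ k * (1 + z ^ (2 * k))) * z\<^sup>2"
    by (intro mult_right_mono) auto
  moreover have "\<bar>f'' (x + t) / 2 * z\<^sup>2\<bar> \<le> \<bar>f'' (x + t)\<bar> * z\<^sup>2"
    by (simp add: abs_mult field_simps)
  moreover have "C * (4 ^ k * (1 + x\<^sup>2) ^ k * (1 + z ^ (2 * k))) * z\<^sup>2 = C * (4 ^ k * (1 + x\<^sup>2) ^ k) * (z\<^sup>2 + z ^ (2 * k + 2))"
    by (simp add: algebra_simps power_add power2_eq_square)
  ultimately show ?thesis using t(2) by linarith
qed

context polynomial_jump_diffusion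
begin

lemma sets_\<nu> [measurable_cong, simp]: "sets (\<nu> x) = sets borel"
  using jump_kernel by (simp add: jump_kernel_def)

lemma space_\<nu> [simp]: "space (\<nu> x) = UNIV"
  using sets_eq_imp_space_eq[OF sets_\<nu>] by simp

lemma integrable_jump_power: "n \<ge> 2 \<Longrightarrow> integrable (\<nu> x) (\<lambda>z. z ^ n)"
  using polynomial by (intro integrableI_bounded)
    (auto simp: polynomial_generator_def well_defined_on_polynomials_def power_abs)

definition jump_moment :: "nat \<Rightarrow> real \<Rightarrow> real" where
  "jump_moment n x = (LINT z|\<nu> x. z ^ n)"

lemma generator_poly: "\<exists>q. degree q \<le> n \<and> generator b \<sigma> \<nu> (poly p) = poly q" if "degree p \<le> n"
  using polynomial that by (auto simp: polynomial_generator_def)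

text \<open>The compensator removes exactly the terms of order 0 and 1 in z, so every remaining
  power is integrable against the kernel.\<close>

lemma binomial_remainder:
  assumes "i \<ge> 2"
  shows "(x + z) ^ i - x ^ i - real i * x ^ (i - 1) * z = (\<Sum>j\<in>{2..i}. real (i choose j) * x ^ (i - j) * z ^ j)"
proof -
  have "(x + z) ^ i = (\<Sum>j\<le>i. real (i choose j) * x ^ (i - j) * z ^ j)"
    using binomial_ring[of z x i] by (simp add: add.commute mult_ac)
  also have "{..i} = insert 0 (insert 1 {2..i})" using assms by auto
  finally show ?thesis by (simp add: mult_ac)
qed

text \<open>Because i(i - 1)/2 is the binomial coefficient of i over 2, the diffusion term has the
  same shape as the term of the second jump moment; the two appear only through their sum.\<close>

lemma generator_power:
  assumes "i \<ge> 2"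
  shows "generator b \<sigma> \<nu> (\<lambda>u. u ^ i) x = real i * b x * x ^ (i - 1) +
    (\<Sum>j\<in>{2..i}. real (i choose j) * x ^ (i - j) * (jump_moment j x + (if j = 2 then (\<sigma> x)\<^sup>2 else 0)))"
proof -
  have C2: "C2_derivs (\<lambda>u. u ^ i) (\<lambda>u. real i * u ^ (i - 1)) (\<lambda>u. real i * (real (i - 1) * u ^ (i - 2)))"
    using assms by (auto simp: C2_derivs_def numeral_2_eq_2 intro!: derivative_eq_intros continuous_intros)
  have I: "(LINT z|\<nu> x. (x + z) ^ i - x ^ i - real i * x ^ (i - 1) * z) =
      (\<Sum>j\<in>{2..i}. real (i choose j) * x ^ (i - j) * jump_moment j x)"
    unfolding binomial_remainder[OF assms] jump_moment_def
    by (subst Bochner_Integration.integral_sum) (auto intro!: integrable_mult_right integrable_jump_power)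
  have ch: "real (i choose 2) = real i * real (i - 1) / 2"
    using assms choose_two[of i] by (simp add: real_of_nat_div)
  have "(\<Sum>j\<in>{2..i}. real (i choose j) * x ^ (i - j) * (if j = 2 then (\<sigma> x)\<^sup>2 else 0)) =
      real (i choose 2) * x ^ (i - 2) * (\<sigma> x)\<^sup>2"
    using assms by (subst sum.remove[of _ 2]) (auto intro!: sum.neutral)
  then show ?thesis unfolding generator_C2[OF C2] I ch by (simp add: algebra_simps sum.distrib)
qed

lemma power_eq_poly: "(\<lambda>u::real. u ^ i) = poly (monom 1 i)"
  by (simp add: fun_eq_iff Polynomial.poly_monom)

lemma generator_power_growth: "poly_growth (generator b \<sigma> \<nu> (\<lambda>u. u ^ i))"
  unfolding power_eq_poly using generator_poly[OF order_refl, of "monom 1 i"] poly_growth_poly by metis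

text \<open>On the identity function the second derivative and the compensated jump both vanish, so
  the generator returns the drift itself.\<close>

lemma b_growth: "poly_growth b"
proof -
  have C2: "C2_derivs (\<lambda>u. u ^ 1) (\<lambda>u. 1) (\<lambda>u. 0)"
    by (auto simp: C2_derivs_def intro!: derivative_eq_intros)
  have "generator b \<sigma> \<nu> (\<lambda>u. u ^ 1) = b" unfolding generator_C2[OF C2] by simp
  then show ?thesis using generator_power_growth[of 1] by simp
qed

text \<open>The second jump moment and the squared diffusion coefficient are polynomials only jointly.\<close>

lemma jump_moment_growth_aux:
  "i \<ge> 2 \<Longrightarrow> poly_growth (\<lambda>x. jump_moment i x + (if i = 2 then (\<sigma> x)\<^sup>2 else 0))"
proof (induction i rule: less_induct)
  case (less i)
  \<comment> \<open>This is \<open>generator_power\<close> solved for its top term j = i, whose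
    coefficient is 1; all other terms have lower order and fall under the induction
    hypothesis.\<close>
  have "jump_moment i x + (if i = 2 then (\<sigma> x)\<^sup>2 else 0) = generator b \<sigma> \<nu> (\<lambda>u. u ^ i) x - real i * b x * x ^ (i - 1) -
    (\<Sum>j\<in>{2..<i}. real (i choose j) * x ^ (i - j) * (jump_moment j x + (if j = 2 then (\<sigma> x)\<^sup>2 else 0)))" for x
  proof -
    have "{2..i} = insert i {2..<i}" using less.prems by auto
    then show ?thesis unfolding generator_power[OF less.prems] by simp
  qed
  then show ?case
    by (simp only:) (intro poly_growth_diff poly_growth_sum poly_growth_mult poly_growth_const poly_growth_power
      poly_growth_ident generator_power_growth b_growth less.IH; simp)
qed

lemma jump_moment_2_nonneg: "0 \<le> jump_moment 2 x"
  unfolding jump_moment_def by (rule Bochner_Integration.integral_nonneg) simp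

text \<open>For i = 2 both summands of the joint expression are nonnegative, so each of them is
  dominated by the sum; for larger i the second summand is 0.\<close>

lemma jump_moment_growth: "i \<ge> 2 \<Longrightarrow> poly_growth (jump_moment i)"
proof (cases "i = 2")
  case True
  then show ?thesis using jump_moment_growth_aux[of 2] jump_moment_2_nonneg
    by (auto elim!: poly_growth_mono)
qed (use jump_moment_growth_aux[of i] in auto)

lemma \<sigma>_growth: "poly_growth (\<lambda>x. (\<sigma> x)\<^sup>2)"
  using jump_moment_growth_aux[of 2] jump_moment_2_nonneg
  by (auto elim!: poly_growth_mono)

lemma integrable_Taylor_remainder:
  assumes "C2_derivs f f' f''" "poly_growth f''"
  shows "integrable (\<nu> x) (\<lambda>z. f (x + z) - f x - f' x * z)"
proof -
  obtain C k where C: "\<And>x. \<bar>f'' x\<bar> \<le> C * (1 + x\<^sup>2) ^ k" using assms(2) by (auto simp: poly_growth_def)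
  note [measurable] = C2_derivs_measurable[OF assms(1)]
  show ?thesis
  proof (rule Bochner_Integration.integrable_bound)
    show "integrable (\<nu> x) (\<lambda>z. C * (4 ^ k * (1 + x\<^sup>2) ^ k) * (z\<^sup>2 + z ^ (2 * k + 2)))"
      by (intro integrable_mult_right Bochner_Integration.integrable_add integrable_jump_power) auto
    show "AE z in \<nu> x. norm (f (x + z) - f x - f' x * z) \<le> norm (C * (4 ^ k * (1 + x\<^sup>2) ^ k) * (z\<^sup>2 + z ^ (2 * k + 2)))"
      using Taylor_remainder_bound[OF assms(1) C] by (auto intro: order_trans[OF _ abs_ge_self])
  qed measurable
qed

text \<open>\<open>K\<close> and \<open>j\<close> depend on \<open>k\<close> alone, and the constant
  \<open>C\<close> of the derivatives enters linearly. A whole family of functions with common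
  derivative bounds thus receives one common majorant, as dominated convergence demands
  later.\<close>

lemma generator_bound:
  obtains K j where "K \<ge> 0" "\<And>f f' f'' C x. C2_derivs f f' f'' \<Longrightarrow> (\<And>x. \<bar>f' x\<bar> \<le> C * (1 + x\<^sup>2) ^ k) \<Longrightarrow>
    (\<And>x. \<bar>f'' x\<bar> \<le> C * (1 + x\<^sup>2) ^ k) \<Longrightarrow> \<bar>generator b \<sigma> \<nu> f x\<bar> \<le> C * (K * (1 + x\<^sup>2) ^ j)"
proof -
  define B where "B = (\<lambda>x. \<bar>b x\<bar> * (1 + x\<^sup>2) ^ k + (\<sigma> x)\<^sup>2 * (1 + x\<^sup>2) ^ k +
    (4 ^ k * (1 + x\<^sup>2) ^ k) * (jump_moment 2 x + jump_moment (2 * k + 2) x))"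
  have "poly_growth B"
    unfolding B_def by (intro poly_growth_intros b_growth \<sigma>_growth jump_moment_growth) auto
  then obtain K j where K: "K \<ge> 0" "\<And>x. \<bar>B x\<bar> \<le> K * (1 + x\<^sup>2) ^ j" using poly_growthE by blast
  show ?thesis
  proof (rule that[OF K(1)])
    fix f f' f'' C x
    assume C2: "C2_derivs f f' f''" and f1: "\<And>x. \<bar>f' x\<bar> \<le> C * (1 + x\<^sup>2) ^ k"
      and f2: "\<And>x. \<bar>f'' x\<bar> \<le> C * (1 + x\<^sup>2) ^ k"
    have C: "0 \<le> C" using f1[of 0] by simp
    have "\<bar>LINT z|\<nu> x. f (x + z) - f x - f' x * z\<bar> \<le> (LINT z|\<nu> x. C * (4 ^ k * (1 + x\<^sup>2) ^ k) * (z\<^sup>2 + z ^ (2 * k + 2)))"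
    proof (rule integral_abs_bound_integral)
      show "integrable (\<nu> x) (\<lambda>z. f (x + z) - f x - f' x * z)"
        using integrable_Taylor_remainder[OF C2] f2 by (auto simp: poly_growth_def)
      show "integrable (\<nu> x) (\<lambda>z. C * (4 ^ k * (1 + x\<^sup>2) ^ k) * (z\<^sup>2 + z ^ (2 * k + 2)))"
        by (intro integrable_mult_right Bochner_Integration.integrable_add integrable_jump_power) auto
    qed (use Taylor_remainder_bound[OF C2 f2] in auto)
    also have "\<dots> = C * (4 ^ k * (1 + x\<^sup>2) ^ k * (jump_moment 2 x + jump_moment (2 * k + 2) x))"
      using Bochner_Integration.integral_add[OF integrable_jump_power[of 2 x] integrable_jump_power[of "2 * k + 2" x]]
      by (simp add: jump_moment_def)
    finally have I: "\<bar>LINT z|\<nu> x. f (x + z) - f x - f' x * z\<bar> \<le> C * (4 ^ k * (1 + x\<^sup>2) ^ k * (jump_moment 2 x + jump_moment (2 * k + 2) x))" .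
    have 1: "\<bar>b x * f' x\<bar> \<le> C * (\<bar>b x\<bar> * (1 + x\<^sup>2) ^ k)"
      using mult_left_mono[OF f1[of x], of "\<bar>b x\<bar>"] by (simp add: abs_mult mult_ac)
    have "\<bar>1 / 2 * (\<sigma> x)\<^sup>2 * f'' x\<bar> \<le> (\<sigma> x)\<^sup>2 * \<bar>f'' x\<bar>" by (simp add: abs_mult)
    also have "\<dots> \<le> (\<sigma> x)\<^sup>2 * (C * (1 + x\<^sup>2) ^ k)"
      using f2[of x] by (intro mult_left_mono) auto
    finally have 2: "\<bar>1 / 2 * (\<sigma> x)\<^sup>2 * f'' x\<bar> \<le> C * ((\<sigma> x)\<^sup>2 * (1 + x\<^sup>2) ^ k)" by (simp add: mult_ac)
    have "\<bar>generator b \<sigma> \<nu> f x\<bar> \<le> C * B x"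
      unfolding generator_C2[OF C2] B_def distrib_left[of C] using I 1 2 by linarith
    also have "\<dots> \<le> C * (K * (1 + x\<^sup>2) ^ j)" using K(2)[of x] C by (intro mult_left_mono) auto
    finally show "\<bar>generator b \<sigma> \<nu> f x\<bar> \<le> C * (K * (1 + x\<^sup>2) ^ j)" .
  qed
qed

text \<open>Additivity is not automatic, because the integral of a non-integrable function has the
  default value 0. Polynomial growth of the second derivatives makes both jump integrands
  integrable.\<close>

lemma generator_add:
  assumes "C2_derivs f f' f''" "poly_growth f''" "C2_derivs g g' g''" "poly_growth g''"
  shows "generator b \<sigma> \<nu> (\<lambda>x. f x + g x) x = generator b \<sigma> \<nu> f x + generator b \<sigma> \<nu> g x"
proof -
  have "(LINT z|\<nu> x. (f (x + z) + g (x + z)) - (f x + g x) - (f' x + g' x) * z) =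
    (LINT z|\<nu> x. (f (x + z) - f x - f' x * z) + (g (x + z) - g x - g' x * z))"
    by (intro Bochner_Integration.integral_cong) (auto simp: algebra_simps)
  also have "\<dots> = (LINT z|\<nu> x. f (x + z) - f x - f' x * z) + (LINT z|\<nu> x. g (x + z) - g x - g' x * z)"
    by (intro Bochner_Integration.integral_add integrable_Taylor_remainder[OF assms(1,2)] integrable_Taylor_remainder[OF assms(3,4)])
  finally show ?thesis
    unfolding generator_C2[OF C2_derivs_add[OF assms(1,3)]] generator_C2[OF assms(1)] generator_C2[OF assms(3)]
    by (simp add: algebra_simps)
qed

section \<open>Measurability of the generator applied to a function\<close>

lemma measurable_jump_integral_const:
  assumes "h \<in> borel_measurable borel"
  shows "(\<lambda>x. \<integral>\<^sup>+ z. h z \<partial>\<nu> x) \<in> borel_measurable borel"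
  using assms
proof (induction h rule: borel_measurable_induct)
  case (cong f g)
  then show ?case using measurable_cong[of borel] by simp
next
  case (set A)
  then have "(\<lambda>x. \<integral>\<^sup>+ z. indicator A z \<partial>\<nu> x) = (\<lambda>x. emeasure (\<nu> x) A)" by (intro ext nn_integral_indicator) simp
  then show ?case using set jump_kernel by (simp add: jump_kernel_def)
next
  case (mult u c)
  then show ?case by (subst nn_integral_cmult) auto
next
  case (add u v)
  then show ?case by (subst nn_integral_add) auto
next
  case (seq U)
  have [measurable]: "(\<lambda>x. \<integral>\<^sup>+ z. U i z \<partial>\<nu> x) \<in> borel_measurable borel" for i
    by (rule seq)
  have "(\<lambda>x. \<integral>\<^sup>+ z. (SUP i. U i z) \<partial>\<nu> x) = (\<lambda>x. SUP i. \<integral>\<^sup>+ z. U i z \<partial>\<nu> x)"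
    using seq by (intro ext nn_integral_monotone_convergence_SUP) auto
  then show ?case by (simp add: image_comp)
qed

lemma jump_moment_2_measurable [measurable]: "jump_moment 2 \<in> borel_measurable borel"
proof -
  have "jump_moment 2 = (\<lambda>x. enn2real (\<integral>\<^sup>+ z. ennreal (z ^ 2) \<partial>\<nu> x))"
    unfolding jump_moment_def by (intro ext integral_eq_nn_integral) auto
  then show ?thesis using measurable_jump_integral_const[of "\<lambda>z. ennreal (z ^ 2)"] by simp
qed

text \<open>The kernel is not finite, but \<open>z\<^sup>2 \<nu>(x, dz)\<close> is; normalized by \<open>1 + \<integral> z\<^sup>2 \<nu>(x, dz)\<close> it is a
  sub-probability kernel, for which the library provides joint measurability.\<close>

lemma measurable_jump_integral:
  assumes [measurable]: "case_prod G \<in> borel_measurable (borel \<Otimes>\<^sub>M borel)" and G0: "\<And>x. G x 0 = 0"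
  shows "(\<lambda>x. \<integral>\<^sup>+ z. G x z \<partial>\<nu> x) \<in> borel_measurable borel"
proof -
  define d where "d x = 1 + jump_moment 2 x" for x
  have [measurable]: "d \<in> borel_measurable borel" unfolding d_def by simp
  have d: "d x \<ge> 1" for x using jump_moment_2_nonneg[of x] by (simp add: d_def)
  define \<kappa> where "\<kappa> x = density (\<nu> x) (\<lambda>z. ennreal (z\<^sup>2 / d x))" for x
  have em: "emeasure (\<kappa> x) A = ennreal (1 / d x) * (\<integral>\<^sup>+ z. ennreal (z\<^sup>2) * indicator A z \<partial>\<nu> x)"
    if "A \<in> sets borel" for x A
  proof -
    have "emeasure (\<kappa> x) A = (\<integral>\<^sup>+ z. ennreal (z\<^sup>2 / d x) * indicator A z \<partial>\<nu> x)"
      unfolding \<kappa>_def using that by (intro emeasure_density) auto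
    also have "\<dots> = (\<integral>\<^sup>+ z. ennreal (1 / d x) * (ennreal (z\<^sup>2) * indicator A z) \<partial>\<nu> x)"
      using d[of x] by (intro nn_integral_cong) (simp add: ennreal_mult'[symmetric] mult.assoc[symmetric])
    finally show ?thesis using that by (simp add: nn_integral_cmult)
  qed
  have \<kappa>: "\<kappa> \<in> borel \<rightarrow>\<^sub>M subprob_algebra borel"
  proof (rule measurable_subprob_algebra)
    fix x :: real
    have "(\<integral>\<^sup>+ z. ennreal (z\<^sup>2) \<partial>\<nu> x) = ennreal (jump_moment 2 x)"
      unfolding jump_moment_def using integrable_jump_power[of 2 x] by (intro nn_integral_eq_integral) auto
    then have "emeasure (\<kappa> x) UNIV = ennreal (1 / d x * jump_moment 2 x)"
      using d[of x] jump_moment_2_nonneg[of x] by (simp add: em flip: ennreal_mult)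
    also have "\<dots> \<le> 1" using d[of x] by (simp add: d_def)
    finally show "subprob_space (\<kappa> x)" by (intro subprob_spaceI) (auto simp: \<kappa>_def)
    show "sets (\<kappa> x) = sets borel" by (simp add: \<kappa>_def)
  next
    fix A :: "real set" assume "A \<in> sets borel"
    then show "(\<lambda>x. emeasure (\<kappa> x) A) \<in> borel_measurable borel"
      using measurable_jump_integral_const[of "\<lambda>z. ennreal (z\<^sup>2) * indicator A z"] by (simp add: em)
  qed
  \<comment> \<open>The density of \<kappa> vanishes at z = 0, so nothing at that point can be
    recovered from \<kappa>; \<open>G0\<close> makes both sides agree there.\<close>
  have "(\<integral>\<^sup>+ z. G x z \<partial>\<nu> x) = (\<integral>\<^sup>+ z. ennreal (d x / z\<^sup>2) * G x z \<partial>\<kappa> x)" for x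
  proof -
    have "(\<integral>\<^sup>+ z. ennreal (d x / z\<^sup>2) * G x z \<partial>\<kappa> x) = (\<integral>\<^sup>+ z. ennreal (z\<^sup>2 / d x) * (ennreal (d x / z\<^sup>2) * G x z) \<partial>\<nu> x)"
      unfolding \<kappa>_def by (intro nn_integral_density) measurable
    also have "\<dots> = (\<integral>\<^sup>+ z. G x z \<partial>\<nu> x)"
    proof (rule nn_integral_cong)
      fix z
      show "ennreal (z\<^sup>2 / d x) * (ennreal (d x / z\<^sup>2) * G x z) = G x z"
        using d[of x] G0[of x] by (cases "z = 0") (auto simp flip: mult.assoc ennreal_mult')
    qed
    finally show ?thesis ..
  qed
  moreover have "(\<lambda>x. \<integral>\<^sup>+ z. ennreal (d x / z\<^sup>2) * G x z \<partial>\<kappa> x) \<in> borel_measurable borel"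
    by (rule nn_integral_measurable_subprob_algebra2[OF _ \<kappa>]) measurable
  ultimately show ?thesis by simp
qed

text \<open>The real jump integral is split into its positive and negative parts, each a nonnegative
  integral that vanishes at z = 0 and so falls under
  \<open>measurable_jump_integral\<close>.\<close>

lemma generator_measurable:
  assumes "C2_derivs f f' f''" "poly_growth f''"
  shows "generator b \<sigma> \<nu> f \<in> borel_measurable borel"
proof -
  note [measurable] = C2_derivs_measurable[OF assms(1)] b_measurable \<sigma>_measurable
  have [measurable]: "(\<lambda>x. \<integral>\<^sup>+ z. ennreal (f (x + z) - f x - f' x * z) \<partial>\<nu> x) \<in> borel_measurable borel"
    "(\<lambda>x. \<integral>\<^sup>+ z. ennreal (- (f (x + z) - f x - f' x * z)) \<partial>\<nu> x) \<in> borel_measurable borel"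
    by (rule measurable_jump_integral; simp)+
  have "generator b \<sigma> \<nu> f = (\<lambda>x. b x * f' x + 1 / 2 * (\<sigma> x)\<^sup>2 * f'' x +
     (enn2real (\<integral>\<^sup>+ z. ennreal (f (x + z) - f x - f' x * z) \<partial>\<nu> x) -
      enn2real (\<integral>\<^sup>+ z. ennreal (- (f (x + z) - f x - f' x * z)) \<partial>\<nu> x)))"
    unfolding generator_C2[OF assms(1), THEN ext] real_lebesgue_integral_def[OF integrable_Taylor_remainder[OF assms]] ..
  then show ?thesis by (simp only:) measurable
qed

section \<open>Measurability of the paths, jointly in time and outcome\<close>

lemma F_subalgebra: "subalgebra (P y) (F t)"
  using sets_F_le space_F sets_P[of y] sets_eq_imp_space_eq[OF sets_P[of y]] by (simp add: subalgebra_def)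

lemma space_P: "space (P y) = space M"
  using sets_eq_imp_space_eq[OF sets_P] .

lemma Y_measurable [measurable]: "t \<ge> 0 \<Longrightarrow> Y t \<in> borel_measurable (P y)"
  using measurable_from_subalg[OF F_subalgebra adapted] .

text \<open>\<open>Y r\<close> is unconstrained for \<open>r < 0\<close>, hence \<open>max 0 r\<close>.\<close>

lemma Y_measurable_pair [measurable]:
  "(\<lambda>(r, \<omega>). Y (max 0 r) \<omega>) \<in> borel_measurable (borel \<Otimes>\<^sub>M P y)"
proof (rule borel_measurable_LIMSEQ_metric)
  \<comment> \<open>\<open>T n (u n r)\<close> is the first point of the grid of width 1/(n + 1)
    that lies strictly to the right of \<open>max 0 r\<close>. Approaching strictly from the right
    lets right-continuity of the paths give the limit, and the integer index makes each
    approximation a countable case distinction.\<close>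
  define u :: "nat \<Rightarrow> real \<Rightarrow> int" where "u n r = \<lfloor>real (Suc n) * max 0 r\<rfloor>" for n r
  define T :: "nat \<Rightarrow> int \<Rightarrow> real" where "T n i = max 0 ((real_of_int i + 1) / real (Suc n))" for n i
  show "(\<lambda>p. Y (T n (u n (fst p))) (snd p)) \<in> borel_measurable (borel \<Otimes>\<^sub>M P y)" for n
  proof (rule measurable_compose_countable[where f = "\<lambda>i p. Y (T n i) (snd p)"])
    show "(\<lambda>p. Y (T n i) (snd p)) \<in> borel_measurable (borel \<Otimes>\<^sub>M P y)" for i
      unfolding T_def by (intro measurable_compose[OF measurable_snd] Y_measurable) simp
    show "(\<lambda>p. u n (fst p)) \<in> borel \<Otimes>\<^sub>M P y \<rightarrow>\<^sub>M count_space UNIV"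
      unfolding u_def by measurable
  qed
  fix p :: "real \<times> 'a" assume "p \<in> space (borel \<Otimes>\<^sub>M P y)"
  then obtain \<omega> r where p: "p = (r, \<omega>)" "\<omega> \<in> space M" by (auto simp: space_pair_measure space_P)
  define s where "s = max 0 r"
  have s: "s \<ge> 0" by (simp add: s_def)
  have T: "T n (u n r) = (real_of_int \<lfloor>real (Suc n) * s\<rfloor> + 1) / real (Suc n)" for n
    using s by (simp add: T_def u_def s_def[symmetric])
  have gt: "s < T n (u n r)" for n unfolding T by (simp add: field_simps) linarith
  have le: "T n (u n r) \<le> s + 1 / real (Suc n)" for n
  proof -
    have "real_of_int \<lfloor>real (Suc n) * s\<rfloor> / real (Suc n) \<le> s"
      by (metis of_int_floor_le mult.commute of_nat_0_less_iff pos_divide_le_eq zero_less_Suc)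
    then show ?thesis unfolding T add_divide_distrib by simp
  qed
  have "(\<lambda>n. T n (u n r)) \<longlonglongrightarrow> s"
  proof (rule real_tendsto_sandwich)
    show "\<forall>\<^sub>F n in sequentially. s \<le> T n (u n r)"
      using less_imp_le[OF gt] by (intro always_eventually allI)
    show "\<forall>\<^sub>F n in sequentially. T n (u n r) \<le> s + inverse (real (Suc n))"
      using le by (intro always_eventually allI) (simp only: inverse_eq_divide)
    show "(\<lambda>n. s + inverse (real (Suc n))) \<longlonglongrightarrow> s" by (rule LIMSEQ_inverse_real_of_nat_add)
  qed (rule tendsto_const)
  then have "filterlim (\<lambda>n. T n (u n r)) (at_right s) sequentially"
    using gt by (simp add: filterlim_at less_imp_neq[THEN not_sym])
  moreover have "((\<lambda>t. Y t \<omega>) \<longlongrightarrow> Y s \<omega>) (at_right s)"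
    using cadlag_paths[OF p(2)] s by (auto simp: cadlag_def continuous_within)
  ultimately have "(\<lambda>n. Y (T n (u n r)) \<omega>) \<longlonglongrightarrow> Y s \<omega>" by (rule filterlim_compose[rotated])
  then show "(\<lambda>n. Y (T n (u n (fst p))) (snd p)) \<longlonglongrightarrow> (case p of (r, \<omega>) \<Rightarrow> Y (max 0 r) \<omega>)"
    by (simp add: p s_def)
qed

end

section \<open>Moment bounds\<close>

text \<open>A weighted supremum argument: \<open>S\<close> is the supremum of
  \<open>m t * exp (- (2 * C * t))\<close>. The rate 2C is twice the constant of the inequality, so
  the integral term contributes at most S/2, whence S \<le> A + S/2. The bound \<open>B\<close>
  serves only to make \<open>S\<close> finite and is absent from the conclusion; this matters
  because it will be 1/\<epsilon>.\<close>

lemma Gronwall_integral: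
  fixes m :: "real \<Rightarrow> real"
  assumes [measurable]: "m \<in> borel_measurable borel" and m0: "\<And>t. 0 \<le> m t" and mB: "\<And>t. m t \<le> B"
    and C: "C > 0" and A: "A \<ge> 0" and le: "\<And>t. t \<ge> 0 \<Longrightarrow> m t \<le> A + C * (LBINT r:{0..t}. m r)" and t: "t \<ge> 0"
  shows "m t \<le> 2 * A * exp (2 * C * t)"
proof -
  define S where "S = (SUP t\<in>{0..}. m t * exp (- (2 * C * t)))"
  have bdd: "bdd_above ((\<lambda>t. m t * exp (- (2 * C * t))) ` {0..})"
  proof (rule bdd_aboveI2)
    fix t :: real assume "t \<in> {0..}"
    then have "exp (- (2 * C * t)) \<le> 1" using C by simp
    then have "m t * exp (- (2 * C * t)) \<le> m t" using m0[of t] by (simp add: mult_left_le)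
    then show "m t * exp (- (2 * C * t)) \<le> B" using mB[of t] by simp
  qed
  have upper: "m t \<le> S * exp (2 * C * t)" if "t \<ge> 0" for t
  proof -
    have "m t * exp (- (2 * C * t)) \<le> S" unfolding S_def using that by (intro cSUP_upper bdd) auto
    then have "m t * exp (- (2 * C * t)) * exp (2 * C * t) \<le> S * exp (2 * C * t)" by (rule mult_right_mono) simp
    then show ?thesis unfolding mult.assoc exp_add[symmetric] by simp
  qed
  have "S \<ge> 0" using upper[of 0] m0[of 0] by simp
  have "S \<le> A + S / 2" unfolding S_def
  proof (rule cSUP_least)
    fix t :: real assume "t \<in> {0..}"
    then have t: "t \<ge> 0" by simp
    have "has_bochner_integral lborel (\<lambda>r. (S * exp (2 * C * r)) * indicator {0..t} r)
        (S / (2 * C) * exp (2 * C * t) - S / (2 * C) * exp (2 * C * 0))"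
      using C t by (intro has_bochner_integral_FTC_Icc_real) (auto intro!: derivative_eq_intros)
    then have FTC: "has_bochner_integral lborel (\<lambda>r. indicator {0..t} r *\<^sub>R (S * exp (2 * C * r)))
        (S / (2 * C) * exp (2 * C * t) - S / (2 * C))"
      by (simp only: real_scaleR_def mult.commute[of "indicator {0..t} _"]) simp
    have "(LBINT r:{0..t}. m r) \<le> (LBINT r:{0..t}. S * exp (2 * C * r))"
      unfolding set_lebesgue_integral_def
    proof (rule integral_mono)
      have "integrable lborel (\<lambda>r. indicator {0..t} r *\<^sub>R B)"
        by (intro integrable_scaleR_left integrable_real_indicator) (auto simp: emeasure_lborel_Icc_eq)
      then show "integrable lborel (\<lambda>r. indicator {0..t} r *\<^sub>R m r)"
        by (rule Bochner_Integration.integrable_bound)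
          (use m0 mB in \<open>auto simp: indicator_def intro!: AE_I2 order_trans[OF _ abs_ge_self]\<close>)
      show "integrable lborel (\<lambda>r. indicator {0..t} r *\<^sub>R (S * exp (2 * C * r)))"
        by (rule integrable.intros[OF FTC])
    qed (use upper in \<open>auto simp: indicator_def\<close>)
    also have "\<dots> = S / (2 * C) * exp (2 * C * t) - S / (2 * C)"
      unfolding set_lebesgue_integral_def by (rule has_bochner_integral_integral_eq[OF FTC])
    also have "\<dots> \<le> S / (2 * C) * exp (2 * C * t)" using C \<open>S \<ge> 0\<close> by simp
    finally have "C * (LBINT r:{0..t}. m r) \<le> C * (S / (2 * C) * exp (2 * C * t))"
      using C by (intro mult_left_mono) auto
    also have "\<dots> = S / 2 * exp (2 * C * t)" using C by simp
    finally have "m t \<le> A + S / 2 * exp (2 * C * t)" using le[OF t] by simp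
    also have "A \<le> A * exp (2 * C * t)" using A C t by (simp add: mult_le_cancel_left1)
    finally have "m t \<le> (A + S / 2) * exp (2 * C * t)" by (simp add: distrib_right)
    then have "m t * exp (- (2 * C * t)) \<le> (A + S / 2) * exp (2 * C * t) * exp (- (2 * C * t))"
      by (rule mult_right_mono) simp
    then show "m t * exp (- (2 * C * t)) \<le> A + (SUP t\<in>{0..}. m t * exp (- (2 * C * t))) / 2"
      unfolding S_def[symmetric] unfolding mult.assoc exp_add[symmetric] by simp
  qed simp
  then have "S \<le> 2 * A" by simp
  then show ?thesis using upper[OF t] by (meson exp_ge_zero mult_right_mono order_trans)
qed

section \<open>Bounded approximations of a nonnegative function\<close>

definition damped :: "real \<Rightarrow> (real \<Rightarrow> real) \<Rightarrow> real \<Rightarrow> real" where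
  "damped \<epsilon> f x = f x / (1 + \<epsilon> * f x)"

text \<open>Chain rule for h(u) = u/(1 + \<epsilon> u), with h'(u) = 1/(1 + \<epsilon> u)^2 and
  h''(u) = -2 \<epsilon>/(1 + \<epsilon> u)^3.\<close>

lemma C2_derivs_damped:
  assumes "C2_derivs f f' f''" "\<And>x. f x \<ge> 0" "\<epsilon> \<ge> 0"
  shows "C2_derivs (damped \<epsilon> f) (\<lambda>x. f' x / (1 + \<epsilon> * f x)\<^sup>2)
    (\<lambda>x. f'' x / (1 + \<epsilon> * f x)\<^sup>2 - 2 * \<epsilon> * (f' x)\<^sup>2 / (1 + \<epsilon> * f x) ^ 3)"
proof -
  have pos: "1 + \<epsilon> * f x > 0" for x using assms(2)[of x] assms(3) by (simp add: add_pos_nonneg)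
  then have nz: "1 + \<epsilon> * f x \<noteq> 0" for x by (metis less_irrefl)
  have f: "(f has_real_derivative f' x) (at x)" "(f' has_real_derivative f'' x) (at x)" for x
    using assms(1) by (auto simp: C2_derivs_def)
  have 1: "(damped \<epsilon> f has_real_derivative f' x / (1 + \<epsilon> * f x)\<^sup>2) (at x)" for x
    unfolding damped_def[abs_def]
    using nz[of x] by (auto intro!: derivative_eq_intros f simp: field_simps power2_eq_square)
  have 2: "((\<lambda>x. f' x / (1 + \<epsilon> * f x)\<^sup>2) has_real_derivative
      f'' x / (1 + \<epsilon> * f x)\<^sup>2 - 2 * \<epsilon> * (f' x)\<^sup>2 / (1 + \<epsilon> * f x) ^ 3) (at x)" for x
  proof -
    define u where "u = 1 + \<epsilon> * f x"
    have u: "u \<noteq> 0" using nz by (simp add: u_def)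
    have "((\<lambda>x. f' x / (1 + \<epsilon> * f x)\<^sup>2) has_real_derivative
      (f'' x * u\<^sup>2 - f' x * (2 * u * (\<epsilon> * f' x))) / (u\<^sup>2 * u\<^sup>2)) (at x)"
      using nz[of x] by (auto intro!: derivative_eq_intros f simp: u_def)
    also have "(f'' x * u\<^sup>2 - f' x * (2 * u * (\<epsilon> * f' x))) / (u\<^sup>2 * u\<^sup>2) = f'' x / u\<^sup>2 - 2 * \<epsilon> * (f' x)\<^sup>2 / u ^ 3"
      using u by (simp add: field_simps power2_eq_square power3_eq_cube)
    finally show ?thesis by (simp add: u_def)
  qed
  show ?thesis
    unfolding C2_derivs_def using 1 2 nz C2_derivs_continuous[OF assms(1)]
    by (auto intro!: continuous_intros)
qed

lemma damped_bounds:
  assumes "\<And>x. f x \<ge> 0" "\<epsilon> > 0"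
  shows "0 \<le> damped \<epsilon> f x" "damped \<epsilon> f x \<le> f x" "damped \<epsilon> f x \<le> 1 / \<epsilon>"
proof -
  have u: "1 + \<epsilon> * f x \<ge> 1" using assms(1)[of x] assms(2) by simp
  show "0 \<le> damped \<epsilon> f x" using assms(1)[of x] u by (simp add: damped_def)
  show "damped \<epsilon> f x \<le> f x" using assms(1)[of x] u by (simp add: damped_def divide_le_eq mult_le_cancel_left1)
  show "damped \<epsilon> f x \<le> 1 / \<epsilon>" using u assms(2) by (simp add: damped_def field_simps)
qed

text \<open>The right-hand sides do not involve \<epsilon>: the denominators are at least 1, and the
  factor \<epsilon> from the second derivative is at most 1. Growth bounds therefore stay uniform as
  \<epsilon> tends to 0.\<close>

lemma damped_deriv_bounds:
  fixes f' f'' :: "real \<Rightarrow> real"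
  assumes "f x \<ge> 0" "0 \<le> \<epsilon>" "\<epsilon> \<le> 1"
  shows "\<bar>f' x / (1 + \<epsilon> * f x)\<^sup>2\<bar> \<le> \<bar>f' x\<bar>"
    "\<bar>f'' x / (1 + \<epsilon> * f x)\<^sup>2 - 2 * \<epsilon> * (f' x)\<^sup>2 / (1 + \<epsilon> * f x) ^ 3\<bar> \<le> \<bar>f'' x\<bar> + 2 * (f' x)\<^sup>2"
proof -
  define u where "u = 1 + \<epsilon> * f x"
  have u: "u \<ge> 1" using assms by (simp add: u_def)
  have div: "\<bar>a / u ^ n\<bar> \<le> \<bar>a\<bar>" for a n
    using one_le_power[OF u, of n] u by (simp add: abs_divide divide_le_eq mult_le_cancel_left1)
  show "\<bar>f' x / (1 + \<epsilon> * f x)\<^sup>2\<bar> \<le> \<bar>f' x\<bar>" using div[of "f' x" 2] by (simp add: u_def)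
  have "2 * \<epsilon> * (f' x)\<^sup>2 \<le> 2 * (f' x)\<^sup>2" using assms by (simp add: mult_left_le_one_le)
  then have "\<bar>2 * \<epsilon> * (f' x)\<^sup>2 / u ^ 3\<bar> \<le> 2 * (f' x)\<^sup>2" using div[of "2 * \<epsilon> * (f' x)\<^sup>2" 3] assms by simp
  then show "\<bar>f'' x / (1 + \<epsilon> * f x)\<^sup>2 - 2 * \<epsilon> * (f' x)\<^sup>2 / (1 + \<epsilon> * f x) ^ 3\<bar> \<le> \<bar>f'' x\<bar> + 2 * (f' x)\<^sup>2"
    using div[of "f'' x" 2] unfolding u_def[symmetric] by linarith
qed

lemma bounded_C2_damped:
  assumes "C2_derivs f f' f''" "\<And>x. f x \<ge> 0" "\<epsilon> > 0"
  shows "bounded_C2 (damped \<epsilon> f)"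
  using damped_bounds[of f \<epsilon>] assms(2,3)
  by (intro bounded_C2I[OF C2_derivs_damped[OF assms(1,2) less_imp_le[OF assms(3)]], of "1 / \<epsilon>"]) auto

text \<open>Concavity of \<open>u \<mapsto> u / (1 + \<epsilon> u)\<close>.\<close>

lemma damped_tangent:
  fixes u v \<epsilon> :: real
  assumes "u \<ge> 0" "v \<ge> 0" "\<epsilon> \<ge> 0"
  shows "v / (1 + \<epsilon> * v) - u / (1 + \<epsilon> * u) \<le> (v - u) / (1 + \<epsilon> * u)\<^sup>2"
proof -
  define p q where "p = 1 + \<epsilon> * u" and "q = 1 + \<epsilon> * v"
  have pos: "p > 0" "q > 0" using assms by (simp_all add: p_def q_def add_pos_nonneg)
  have "v / q - u / p = (v * p - u * q) / (p * q)" using pos by (simp add: field_simps)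
  also have "v * p - u * q = v - u" by (simp add: p_def q_def algebra_simps)
  \<comment> \<open>The sign of v - u also decides the order of p and q, so replacing q by p can
    only increase the quotient in either case.\<close>
  also have "(v - u) / (p * q) \<le> (v - u) / p\<^sup>2"
  proof (cases "u \<le> v")
    case True
    then have "p \<le> q" using assms by (simp add: p_def q_def mult_left_mono)
    then show ?thesis using True pos by (intro divide_left_mono) (auto simp: power2_eq_square)
  next
    case False
    then have "q \<le> p" using assms by (simp add: p_def q_def mult_left_mono)
    then show ?thesis using False pos by (intro divide_left_mono_neg) (auto simp: power2_eq_square)
  qed
  finally show ?thesis by (simp add: p_def q_def)
qed

context polynomial_jump_diffusion
begin

text \<open>The drift parts agree, the diffusion part only gains the nonpositive term with the
  factor -2 \<epsilon>, and the jump integrands are compared pointwise by the tangent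
  inequality.\<close>

lemma generator_damped_le:
  assumes C2: "C2_derivs f f' f''" and f0: "\<And>x. f x \<ge> 0" and \<epsilon>: "0 < \<epsilon>" "\<epsilon> \<le> 1"
    and pg: "poly_growth f'" "poly_growth f''"
  shows "generator b \<sigma> \<nu> (damped \<epsilon> f) x \<le> generator b \<sigma> \<nu> f x / (1 + \<epsilon> * f x)\<^sup>2"
proof -
  define u where "u = 1 + \<epsilon> * f x"
  have u: "u > 0" using f0[of x] \<epsilon> by (simp add: u_def add_pos_nonneg)
  note C2d = C2_derivs_damped[OF C2 f0 less_imp_le[OF \<epsilon>(1)]]
  have pgd: "poly_growth (\<lambda>x. f'' x / (1 + \<epsilon> * f x)\<^sup>2 - 2 * \<epsilon> * (f' x)\<^sup>2 / (1 + \<epsilon> * f x) ^ 3)"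
    by (rule poly_growth_mono[of "\<lambda>x. \<bar>f'' x\<bar> + 2 * (f' x)\<^sup>2"])
      (use damped_deriv_bounds(2)[where f = f and \<epsilon> = \<epsilon>, OF f0] \<epsilon> pg in \<open>auto intro!: poly_growth_intros\<close>)
  have "(LINT z|\<nu> x. damped \<epsilon> f (x + z) - damped \<epsilon> f x - f' x / u\<^sup>2 * z) \<le> (LINT z|\<nu> x. (f (x + z) - f x - f' x * z) / u\<^sup>2)"
  proof (rule integral_mono)
    show "integrable (\<nu> x) (\<lambda>z. damped \<epsilon> f (x + z) - damped \<epsilon> f x - f' x / u\<^sup>2 * z)"
      using integrable_Taylor_remainder[OF C2d pgd, of x] by (simp add: u_def)
    show "integrable (\<nu> x) (\<lambda>z. (f (x + z) - f x - f' x * z) / u\<^sup>2)"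
      using integrable_Taylor_remainder[OF C2 pg(2), of x] by simp
    show "damped \<epsilon> f (x + z) - damped \<epsilon> f x - f' x / u\<^sup>2 * z \<le> (f (x + z) - f x - f' x * z) / u\<^sup>2" for z
      using damped_tangent[OF f0[of x] f0[of "x + z"], of \<epsilon>] \<epsilon> by (simp add: damped_def u_def diff_divide_distrib)
  qed
  moreover have "1 / 2 * (\<sigma> x)\<^sup>2 * (f'' x / u\<^sup>2 - 2 * \<epsilon> * (f' x)\<^sup>2 / u ^ 3) \<le> 1 / 2 * (\<sigma> x)\<^sup>2 * (f'' x / u\<^sup>2)"
    using u \<epsilon> by (intro mult_left_mono) auto
  ultimately have "generator b \<sigma> \<nu> (damped \<epsilon> f) x \<le> b x * (f' x / u\<^sup>2) + 1 / 2 * (\<sigma> x)\<^sup>2 * (f'' x / u\<^sup>2) +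
      (LINT z|\<nu> x. (f (x + z) - f x - f' x * z) / u\<^sup>2)"
    unfolding generator_C2[OF C2d] u_def[symmetric] by linarith
  also have "\<dots> = generator b \<sigma> \<nu> f x / u\<^sup>2"
    unfolding generator_C2[OF C2] by (simp add: add_divide_distrib)
  finally show ?thesis by (simp add: u_def)
qed

section \<open>Localization and the moment estimate\<close>

definition compensated :: "(real \<Rightarrow> real) \<Rightarrow> real \<Rightarrow> real \<Rightarrow> 'a \<Rightarrow> real" where
  "compensated f y t \<omega> = f (Y t \<omega>) - f y - (LBINT s:{0..t}. generator b \<sigma> \<nu> f (Y s \<omega>))"

text \<open>\<open>T k t\<close> is the minimum of t and the k-th localizing time. It is finite, so
  its conversion to a real loses nothing, and it equals t for large k because the localizing times
  tend to infinity. The martingale property is restated through integrals over events of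
  \<open>F s\<close>, the form to which limit theorems apply.\<close>

lemma localized:
  assumes "bounded_C2 f"
  obtains T :: "nat \<Rightarrow> real \<Rightarrow> 'a \<Rightarrow> real" where
    "\<And>k t \<omega>. t \<ge> 0 \<Longrightarrow> 0 \<le> T k t \<omega> \<and> T k t \<omega> \<le> t"
    "AE \<omega> in P y. \<forall>t\<ge>0. eventually (\<lambda>k. T k t \<omega> = t) sequentially"
    "\<And>k t. t \<ge> 0 \<Longrightarrow> integrable (P y) (\<lambda>\<omega>. compensated f y (T k t \<omega>) \<omega>)"
    "\<And>k s t A. 0 \<le> s \<Longrightarrow> s \<le> t \<Longrightarrow> A \<in> sets (F s) \<Longrightarrow>
      (\<integral>\<omega>\<in>A. compensated f y (T k t \<omega>) \<omega> \<partial>(P y)) = (\<integral>\<omega>\<in>A. compensated f y (T k s \<omega>) \<omega> \<partial>(P y))"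
proof -
  interpret prob_space "P y" by (rule prob_space_P)
  obtain \<tau> :: "nat \<Rightarrow> 'a \<Rightarrow> ennreal" where
    \<tau>: "AE \<omega> in P y. incseq (\<lambda>k. \<tau> k \<omega>) \<and> (\<lambda>k. \<tau> k \<omega>) \<longlonglongrightarrow> \<infinity>"
    and m: "\<And>k. martingale (P y) F (\<lambda>t \<omega>. compensated f y (enn2real (min (ennreal t) (\<tau> k \<omega>))) \<omega>)"
    using extended_generator[OF assms, of y] by (auto simp: local_martingale_def compensated_def)
  define T where "T k t \<omega> = enn2real (min (ennreal t) (\<tau> k \<omega>))" for k t \<omega>
  show ?thesis
  proof (rule that)
    show "0 \<le> T k t \<omega> \<and> T k t \<omega> \<le> t" if "t \<ge> 0" for k t \<omega>
      using that enn2real_mono[of "min (ennreal t) (\<tau> k \<omega>)" "ennreal t"] by (auto simp: T_def)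
    show "AE \<omega> in P y. \<forall>t\<ge>0. eventually (\<lambda>k. T k t \<omega> = t) sequentially"
      using \<tau>
    proof eventually_elim
      case (elim \<omega>)
      show ?case
      proof (intro allI impI)
        fix t :: real assume "t \<ge> 0"
        have "eventually (\<lambda>k. \<tau> k \<omega> > ennreal t) sequentially"
          using elim by (intro order_tendstoD) auto
        then show "eventually (\<lambda>k. T k t \<omega> = t) sequentially"
          by eventually_elim (use \<open>t \<ge> 0\<close> in \<open>auto simp: T_def min_absorb1\<close>)
      qed
    qed
    show int: "integrable (P y) (\<lambda>\<omega>. compensated f y (T k t \<omega>) \<omega>)" if "t \<ge> 0" for k t
      using m[of k] that by (auto simp: martingale_def T_def)
    show "(\<integral>\<omega>\<in>A. compensated f y (T k t \<omega>) \<omega> \<partial>(P y)) = (\<integral>\<omega>\<in>A. compensated f y (T k s \<omega>) \<omega> \<partial>(P y))"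
      if st: "0 \<le> s" "s \<le> t" and A: "A \<in> sets (F s)" for k s t A
    proof -
      interpret finite_measure_subalgebra "P y" "F s"
        by unfold_locales (rule F_subalgebra)
      have AM: "A \<in> sets (P y)" using A F_subalgebra by (auto simp: subalgebra_def)
      have "(\<integral>\<omega>\<in>A. compensated f y (T k t \<omega>) \<omega> \<partial>(P y)) = (\<integral>\<omega>\<in>A. real_cond_exp (P y) (F s) (\<lambda>\<omega>. compensated f y (T k t \<omega>) \<omega>) \<omega> \<partial>(P y))"
        using st A by (intro real_cond_exp_intA int) auto
      also have "\<dots> = (\<integral>\<omega>\<in>A. compensated f y (T k s \<omega>) \<omega> \<partial>(P y))"
        unfolding set_lebesgue_integral_def
      proof (rule integral_cong_AE)
        show "AE \<omega> in P y. indicator A \<omega> *\<^sub>R real_cond_exp (P y) (F s) (\<lambda>\<omega>. compensated f y (T k t \<omega>) \<omega>) \<omega> =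
           indicator A \<omega> *\<^sub>R compensated f y (T k s \<omega>) \<omega>"
        proof -
          have "AE \<omega> in P y. real_cond_exp (P y) (F s) (\<lambda>\<omega>. compensated f y (T k t \<omega>) \<omega>) \<omega> = compensated f y (T k s \<omega>) \<omega>"
            using m[of k] st by (auto simp: martingale_def T_def)
          then show ?thesis by eventually_elim simp
        qed
        show "(\<lambda>\<omega>. indicator A \<omega> *\<^sub>R real_cond_exp (P y) (F s) (\<lambda>\<omega>. compensated f y (T k t \<omega>) \<omega>) \<omega>) \<in> borel_measurable (P y)"
          using AM by measurable
        show "(\<lambda>\<omega>. indicator A \<omega> *\<^sub>R compensated f y (T k s \<omega>) \<omega>) \<in> borel_measurable (P y)"
          by (intro borel_measurable_scaleR borel_measurable_indicator AM borel_measurable_integrable[OF int] st(1))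
      qed
      finally show ?thesis .
    qed
  qed
qed

lemma integrable_time_space:
  assumes [measurable]: "g \<in> borel_measurable borel" and "0 \<le> s"
    and K: "\<And>r. s \<le> r \<Longrightarrow> r \<le> t \<Longrightarrow> (\<integral>\<^sup>+\<omega>. ennreal \<bar>g (Y r \<omega>)\<bar> \<partial>P y) \<le> ennreal K"
  shows "integrable (lborel \<Otimes>\<^sub>M P y) (\<lambda>(r, \<omega>). indicator {s..t} r * g (Y (max 0 r) \<omega>))"
proof -
  interpret prob_space "P y" by (rule prob_space_P)
  have Ym [measurable]: "(\<lambda>(r, \<omega>). Y (max 0 r) \<omega>) \<in> borel_measurable (lborel \<Otimes>\<^sub>M P y)"
    using Y_measurable_pair by (simp cong: measurable_cong_sets sets_pair_measure_cong)
  show ?thesis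
  proof (rule integrableI_bounded)
    have "(\<integral>\<^sup>+ p. norm (case p of (r, \<omega>) \<Rightarrow> indicator {s..t} r * g (Y (max 0 r) \<omega>)) \<partial>(lborel \<Otimes>\<^sub>M P y)) =
      (\<integral>\<^sup>+ r. \<integral>\<^sup>+ \<omega>. norm (indicator {s..t} r * g (Y (max 0 r) \<omega>)) \<partial>P y \<partial>lborel)"
      by (subst nn_integral_fst[symmetric]) auto
    also have "\<dots> \<le> (\<integral>\<^sup>+ r. ennreal K * indicator {s..t} r \<partial>lborel)"
    proof (rule nn_integral_mono)
      fix r :: real
      show "(\<integral>\<^sup>+ \<omega>. norm (indicator {s..t} r * g (Y (max 0 r) \<omega>)) \<partial>P y) \<le> ennreal K * indicator {s..t} r"
        using K[of r] \<open>0 \<le> s\<close> by (cases "r \<in> {s..t}") (auto simp: max_absorb2)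
    qed
    also have "\<dots> < \<infinity>"
      by (subst nn_integral_cmult) (auto simp: ennreal_mult_less_top emeasure_lborel_Icc_eq)
    finally show "(\<integral>\<^sup>+ p. norm (case p of (r, \<omega>) \<Rightarrow> indicator {s..t} r * g (Y (max 0 r) \<omega>)) \<partial>(lborel \<Otimes>\<^sub>M P y)) < \<infinity>" .
  qed measurable
qed

text \<open>The correcting integral runs up to t and not up to u. As the integrand is nonnegative
  this only weakens the bound, and it makes the correction independent of u, which will be a random
  time.\<close>

lemma compensated_lower_bound:
  assumes f: "\<And>x. 0 \<le> f x" "\<And>x. f x \<le> B" "f \<in> borel_measurable borel"
    and le: "\<And>x. generator b \<sigma> \<nu> f x \<le> C * f x" and C: "C \<ge> 0"
    and \<omega>: "\<omega> \<in> space M" and u: "0 \<le> u" "u \<le> t"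
  shows "f (Y u \<omega>) - f y - C * (LBINT r. indicator {0..t} r * f (Y (max 0 r) \<omega>)) \<le> compensated f y u \<omega>"
proof -
  note [measurable] = f(3)
  have [measurable]: "(\<lambda>r. Y (max 0 r) \<omega>) \<in> borel_measurable borel"
    using measurable_compose[OF measurable_Pair2'[of \<omega> "P y" borel] Y_measurable_pair] \<omega> by (simp add: space_P)
  have J: "integrable lborel (\<lambda>r. indicator {0..t} r * f (Y (max 0 r) \<omega>))"
  proof (rule Bochner_Integration.integrable_bound)
    show "integrable lborel (\<lambda>r. indicator {0..t} r *\<^sub>R B)"
      by (intro integrable_scaleR_left integrable_real_indicator) (auto simp: emeasure_lborel_Icc_eq)
  qed (use f in \<open>auto simp: indicator_def intro!: AE_I2 order_trans[OF _ abs_ge_self]\<close>)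
  have "(LBINT s. indicator {0..u} s *\<^sub>R generator b \<sigma> \<nu> f (Y s \<omega>)) \<le> (LBINT r. C * (indicator {0..t} r * f (Y (max 0 r) \<omega>)))"
  proof (cases "integrable lborel (\<lambda>s. indicator {0..u} s *\<^sub>R generator b \<sigma> \<nu> f (Y s \<omega>))")
    case True
    show ?thesis
    proof (rule integral_mono[OF True])
      show "integrable lborel (\<lambda>r. C * (indicator {0..t} r * f (Y (max 0 r) \<omega>)))" using J by simp
      show "indicator {0..u} s *\<^sub>R generator b \<sigma> \<nu> f (Y s \<omega>) \<le> C * (indicator {0..t} s * f (Y (max 0 s) \<omega>))" for s
        using le u f(1) C by (auto simp: indicator_def max_absorb2)
    qed
  next
    \<comment> \<open>A time integral that does not exist has the value 0, which is still below the
      nonnegative right-hand side.\<close>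
    case False
    then have "(LBINT s. indicator {0..u} s *\<^sub>R generator b \<sigma> \<nu> f (Y s \<omega>)) = 0" by (rule not_integrable_integral_eq)
    also have "\<dots> \<le> (LBINT r. C * (indicator {0..t} r * f (Y (max 0 r) \<omega>)))"
      using C f(1) by (intro Bochner_Integration.integral_nonneg) auto
    finally show ?thesis .
  qed
  then show ?thesis by (simp add: compensated_def set_lebesgue_integral_def)
qed

lemma compensated_0: "AE \<omega> in P y. compensated f y 0 \<omega> = 0"
proof -
  have "(LBINT s:{0..0}. generator b \<sigma> \<nu> f (Y s \<omega>)) = 0" for \<omega>
    unfolding set_lebesgue_integral_def using AE_lborel_singleton[of 0]
    by (intro integral_eq_zero_AE) (auto elim!: eventually_mono)
  then show ?thesis using start[of y] by (auto simp: compensated_def)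
qed

text \<open>Only an upper bound on the generator is available, so the limit along the localizing
  sequence is taken with Fatou's lemma. The resulting bound does not contain \<open>B\<close> and
  hence survives the removal of the damping.\<close>

lemma bounded_function_moment:
  assumes f: "\<And>x. 0 \<le> f x" "\<And>x. f x \<le> B" "f \<in> borel_measurable borel" "bounded_C2 f"
    and le: "\<And>x. generator b \<sigma> \<nu> f x \<le> C * f x" and C: "C > 0" and t: "t \<ge> 0"
  shows "(\<integral>\<omega>. f (Y t \<omega>) \<partial>P y) \<le> 2 * f y * exp (2 * C * t)"
proof -
  interpret prob_space "P y" by (rule prob_space_P)
  note [measurable] = f(3)
  have B: "B \<ge> 0" using f(1,2) order_trans by blast
  define m where "m r = (\<integral>\<omega>. f (Y (max 0 r) \<omega>) \<partial>P y)" for r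
  have [measurable]: "m \<in> borel_measurable borel"
    unfolding m_def using measurable_compose[OF Y_measurable_pair f(3)]
    by (intro borel_measurable_lebesgue_integral) (simp add: split_beta')
  have fint: "integrable (P y) (\<lambda>\<omega>. f (Y r \<omega>))" if "r \<ge> 0" for r
    using f(1,2) that by (intro integrable_const_bound[of _ B]) auto
  have "m t \<le> f y + C * (LBINT r:{0..t}. m r)" if t: "t \<ge> 0" for t
  proof -
    obtain T :: "nat \<Rightarrow> real \<Rightarrow> 'a \<Rightarrow> real" where
      T: "\<And>k t \<omega>. t \<ge> 0 \<Longrightarrow> 0 \<le> T k t \<omega> \<and> T k t \<omega> \<le> t"
        "AE \<omega> in P y. \<forall>t\<ge>0. eventually (\<lambda>k. T k t \<omega> = t) sequentially"
        "\<And>k t. t \<ge> 0 \<Longrightarrow> integrable (P y) (\<lambda>\<omega>. compensated f y (T k t \<omega>) \<omega>)"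
        "\<And>k s t A. 0 \<le> s \<Longrightarrow> s \<le> t \<Longrightarrow> A \<in> sets (F s) \<Longrightarrow>
          (\<integral>\<omega>\<in>A. compensated f y (T k t \<omega>) \<omega> \<partial>(P y)) = (\<integral>\<omega>\<in>A. compensated f y (T k s \<omega>) \<omega> \<partial>(P y))"
      by (erule localized[OF f(4), of y])
    define I where "I \<omega> = (LBINT r. indicator {0..t} r * f (Y (max 0 r) \<omega>))" for \<omega>
    have prod_int: "integrable (lborel \<Otimes>\<^sub>M P y) (\<lambda>(r, \<omega>). indicator {0..t} r * f (Y (max 0 r) \<omega>))"
    proof (rule integrable_time_space[where K = B])
      fix r :: real assume "0 \<le> r"
      have "(\<integral>\<^sup>+\<omega>. ennreal \<bar>f (Y r \<omega>)\<bar> \<partial>P y) \<le> (\<integral>\<^sup>+\<omega>. ennreal B \<partial>P y)"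
        using f(1,2) by (intro nn_integral_mono ennreal_leI) auto
      then show "(\<integral>\<^sup>+\<omega>. ennreal \<bar>f (Y r \<omega>)\<bar> \<partial>P y) \<le> ennreal B" by (simp add: emeasure_space_1)
    qed auto
    interpret pair: pair_sigma_finite lborel "P y" ..
    have I: "integrable (P y) I" unfolding I_def
      using pair.integrable_snd[OF prod_int] by simp
    have EI: "(\<integral>\<omega>. I \<omega> \<partial>P y) = (LBINT r:{0..t}. m r)"
    proof -
      have "(\<integral>\<omega>. I \<omega> \<partial>P y) = (LBINT r. \<integral>\<omega>. indicator {0..t} r * f (Y (max 0 r) \<omega>) \<partial>P y)"
        unfolding I_def by (rule pair.Fubini_integral[OF prod_int])
      also have "\<dots> = (LBINT r:{0..t}. m r)"
        by (simp add: set_lebesgue_integral_def m_def)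
      finally show ?thesis .
    qed
    \<comment> \<open>Adding back the correction of \<open>compensated_lower_bound\<close> turns the
      stopped compensated process into a nonnegative variable that dominates f at the stopped time
      and whose expectation is the same for all k.\<close>
    define W where "W k \<omega> = compensated f y (T k t \<omega>) \<omega> + f y + C * I \<omega>" for k \<omega>
    have W: "f (Y (T k t \<omega>) \<omega>) \<le> W k \<omega>" if "\<omega> \<in> space M" for k \<omega>
      using compensated_lower_bound[OF f(1-3) le less_imp_le[OF C] that, of "T k t \<omega>" t y] T(1)[OF t, of k \<omega>]
      by (simp add: W_def I_def)
    have Wint: "integrable (P y) (W k)" for k
      unfolding W_def using T(3)[OF t] I by auto
    have "(\<integral>\<omega>. compensated f y (T k t \<omega>) \<omega> \<partial>P y) = 0" for k
    proof -
      have sp: "space M \<in> sets (F 0)" using sets.top[of "F 0"] by (simp add: space_F)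
      have "(\<integral>\<omega>. compensated f y (T k t \<omega>) \<omega> \<partial>P y) = (\<integral>\<omega>\<in>space M. compensated f y (T k t \<omega>) \<omega> \<partial>(P y))"
        unfolding set_lebesgue_integral_def by (intro Bochner_Integration.integral_cong) (auto simp: space_P)
      also have "\<dots> = (\<integral>\<omega>\<in>space M. compensated f y (T k 0 \<omega>) \<omega> \<partial>(P y))"
        by (rule T(4)[OF order_refl t sp])
      also have "\<dots> = (\<integral>\<omega>. indicator (space M) \<omega> *\<^sub>R compensated f y 0 \<omega> \<partial>P y)"
        unfolding set_lebesgue_integral_def using T(1)[of 0 k] by (metis order_antisym order_refl)
      also have "\<dots> = 0"
        using compensated_0[where y = y and f = f] by (intro integral_eq_zero_AE) (auto elim!: eventually_mono)
      finally show ?thesis .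
    qed
    then have EW: "(\<integral>\<omega>. W k \<omega> \<partial>P y) = f y + C * (LBINT r:{0..t}. m r)" for k
      unfolding W_def using T(3)[OF t] I by (simp add: EI prob_space)
    have "ennreal (m t) = (\<integral>\<^sup>+\<omega>. ennreal (f (Y t \<omega>)) \<partial>P y)"
      using t f(1) by (simp add: m_def max_absorb2 nn_integral_eq_integral[OF fint[OF t]])
    also have "\<dots> \<le> (\<integral>\<^sup>+\<omega>. liminf (\<lambda>k. ennreal (W k \<omega>)) \<partial>P y)"
    proof (rule nn_integral_mono_AE)
      show "AE \<omega> in P y. ennreal (f (Y t \<omega>)) \<le> liminf (\<lambda>k. ennreal (W k \<omega>))"
        using T(2) AE_space
      proof eventually_elim
        case (elim \<omega>)
        then have "eventually (\<lambda>k. T k t \<omega> = t) sequentially" using t by auto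
        then have "eventually (\<lambda>k. ennreal (f (Y t \<omega>)) \<le> ennreal (W k \<omega>)) sequentially"
          by eventually_elim (use W[of \<omega>] elim in \<open>auto simp: space_P intro!: ennreal_leI; metis\<close>)
        then show ?case by (rule Liminf_bounded)
      qed
    qed
    also have "\<dots> \<le> liminf (\<lambda>k. \<integral>\<^sup>+\<omega>. ennreal (W k \<omega>) \<partial>P y)"
      using Wint by (intro nn_integral_liminf) auto
    also have "\<dots> = ennreal (f y + C * (LBINT r:{0..t}. m r))"
    proof -
      have "(\<integral>\<^sup>+\<omega>. ennreal (W k \<omega>) \<partial>P y) = ennreal (f y + C * (LBINT r:{0..t}. m r))" for k
        unfolding EW[of k, symmetric]
        using order_trans[OF f(1) W] by (intro nn_integral_eq_integral Wint AE_I2) (simp add: space_P)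
      then show ?thesis by (simp add: Liminf_const)
    qed
    finally have "ennreal (m t) \<le> ennreal (f y + C * (LBINT r:{0..t}. m r))" .
    moreover have "0 \<le> f y + C * (LBINT r:{0..t}. m r)"
      using f(1) C unfolding EI[symmetric] I_def by (intro add_nonneg_nonneg mult_nonneg_nonneg Bochner_Integration.integral_nonneg) auto
    ultimately show ?thesis by simp
  qed
  moreover have "0 \<le> m r" "m r \<le> B" for r
    unfolding m_def using f(1,2) fint[of "max 0 r"] B
    by (auto intro!: Bochner_Integration.integral_nonneg integral_le_const AE_I2)
  ultimately have "m t \<le> 2 * f y * exp (2 * C * t)"
    using C f(1) t by (intro Gronwall_integral[of m B C "f y" t]) auto
  then show ?thesis using t by (simp add: m_def max_absorb2)
qed

lemma damped_tendsto: "(\<lambda>n. damped (inverse (real (Suc n))) f x) \<longlonglongrightarrow> f x"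
proof -
  have "(\<lambda>n. f x / (1 + inverse (real (Suc n)) * f x)) \<longlonglongrightarrow> f x / (1 + 0 * f x)"
    by (intro tendsto_intros LIMSEQ_inverse_real_of_nat) simp
  then show ?thesis by (simp add: damped_def)
qed

text \<open>\<open>C\<close> is fixed before t and y and depends on k alone: it bounds the
  polynomial obtained by applying the generator to the weight of degree 2k. Fatou's lemma is used a
  second time, now for \<epsilon> = 1/(n + 1) tending to 0.\<close>

lemma moment_bound:
  obtains C where "\<And>t y. t \<ge> 0 \<Longrightarrow>
    (\<integral>\<^sup>+\<omega>. ennreal ((1 + (Y t \<omega>)\<^sup>2) ^ k) \<partial>P y) \<le> ennreal (2 * (1 + y\<^sup>2) ^ k * exp (2 * C * t))"
proof -
  define p :: "real poly" where "p = [:1, 0, 1:] ^ k"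
  have h: "poly p x = (1 + x\<^sup>2) ^ k" for x by (simp add: p_def power2_eq_square)
  have "degree p \<le> 2 * k" using degree_power_le[of "[:1, 0, 1::real:]" k] by (simp add: p_def)
  then obtain q where q: "degree q \<le> 2 * k" "generator b \<sigma> \<nu> (poly p) = poly q" using generator_poly by blast
  obtain C0 where C0: "C0 \<ge> 0" "\<And>x. \<bar>poly q x\<bar> \<le> C0 * (1 + x\<^sup>2) ^ k" using poly_le_weight[OF q(1)] by metis
  \<comment> \<open>\<open>C0\<close> may be 0, whereas Gronwall's inequality divides by the
    constant.\<close>
  define C where "C = C0 + 1"
  have C: "C > 0" using C0 by (simp add: C_def)
  have h0: "0 \<le> poly p x" for x using weight_pos[of x k] by (simp add: h)
  have Gh: "generator b \<sigma> \<nu> (poly p) x \<le> C * poly p x" for x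
    using C0(2)[of x] h0[of x] unfolding q(2) C_def h distrib_right by linarith
  define f where "f n = damped (inverse (real (Suc n))) (poly p)" for n
  have eps: "0 < inverse (real (Suc n))" "inverse (real (Suc n)) \<le> 1" for n by (auto simp: inverse_le_1_iff)
  note bounds = damped_bounds[of "poly p", OF h0 eps(1)]
  have Gf: "generator b \<sigma> \<nu> (f n) x \<le> C * f n x" for n x
  proof -
    define u where "u = 1 + inverse (real (Suc n)) * poly p x"
    have u: "u \<ge> 1" using h0[of x] by (simp add: u_def)
    have "generator b \<sigma> \<nu> (f n) x \<le> generator b \<sigma> \<nu> (poly p) x / u\<^sup>2"
      unfolding f_def u_def by (rule generator_damped_le[OF C2_derivs_poly h0 eps]) (rule poly_growth_poly)+
    also have "\<dots> \<le> C * poly p x / u\<^sup>2" using Gh[of x] by (simp add: divide_right_mono)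
    \<comment> \<open>One of the two factors u \<ge> 1 is given up, since p/u is exactly the damped
      function; the direction is right because \<open>C * poly p x\<close> is nonnegative.\<close>
    also have "\<dots> \<le> C * poly p x / u"
      using u C h0[of x] by (intro divide_left_mono) (auto simp: power2_eq_square)
    finally show ?thesis by (simp add: f_def damped_def u_def)
  qed
  have fm [measurable]: "f n \<in> borel_measurable borel" for n
    unfolding f_def damped_def by (intro borel_measurable_divide borel_measurable_add borel_measurable_times)
      (auto intro: C2_derivs_measurable[OF C2_derivs_poly])
  show ?thesis
  proof (rule that)
    fix t y :: real assume t: "t \<ge> 0"
    interpret prob_space "P y" by (rule prob_space_P)
    have b: "(\<integral>\<^sup>+\<omega>. ennreal (f n (Y t \<omega>)) \<partial>P y) \<le> ennreal (2 * (1 + y\<^sup>2) ^ k * exp (2 * C * t))" for n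
    proof -
      have "f n (Y t \<omega>) \<le> 1 / inverse (real (Suc n))" "0 \<le> f n (Y t \<omega>)" for \<omega>
        unfolding f_def by (rule bounds)+
      then have "integrable (P y) (\<lambda>\<omega>. f n (Y t \<omega>))"
        using t by (intro integrable_const_bound[of _ "1 / inverse (real (Suc n))"] AE_I2) (simp_all only: real_norm_def abs_of_nonneg, measurable)
      then have "(\<integral>\<^sup>+\<omega>. ennreal (f n (Y t \<omega>)) \<partial>P y) = ennreal (\<integral>\<omega>. f n (Y t \<omega>) \<partial>P y)"
        using bounds(1) by (intro nn_integral_eq_integral) (auto simp: f_def)
      also have "(\<integral>\<omega>. f n (Y t \<omega>) \<partial>P y) \<le> 2 * f n y * exp (2 * C * t)"
        using bounds bounded_C2_damped[OF C2_derivs_poly h0 eps(1)] fm[of n] Gf[of n] unfolding f_def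
        by (intro bounded_function_moment[where B = "1 / inverse (real (Suc n))"] C t) blast+
      also have "\<dots> \<le> 2 * (1 + y\<^sup>2) ^ k * exp (2 * C * t)"
        using bounds(2)[where x = y] by (intro mult_right_mono mult_left_mono) (auto simp: f_def h)
      finally show ?thesis by (simp add: ennreal_leI)
    qed
    have "(\<integral>\<^sup>+\<omega>. ennreal ((1 + (Y t \<omega>)\<^sup>2) ^ k) \<partial>P y) = (\<integral>\<^sup>+\<omega>. liminf (\<lambda>n. ennreal (f n (Y t \<omega>))) \<partial>P y)"
    proof (intro nn_integral_cong)
      fix \<omega>
      have "(\<lambda>n. ennreal (f n (Y t \<omega>))) \<longlonglongrightarrow> ennreal ((1 + (Y t \<omega>)\<^sup>2) ^ k)"
        using damped_tendsto[of "poly p" "Y t \<omega>"] by (intro tendsto_ennrealI) (simp add: f_def h)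
      then show "ennreal ((1 + (Y t \<omega>)\<^sup>2) ^ k) = liminf (\<lambda>n. ennreal (f n (Y t \<omega>)))"
        by (intro lim_imp_Liminf[symmetric]) auto
    qed
    also have "\<dots> \<le> liminf (\<lambda>n. \<integral>\<^sup>+\<omega>. ennreal (f n (Y t \<omega>)) \<partial>P y)"
      using t by (intro nn_integral_liminf) auto
    also have "\<dots> \<le> ennreal (2 * (1 + y\<^sup>2) ^ k * exp (2 * C * t))"
      by (intro Liminf_le always_eventually allI b) simp
    finally show "(\<integral>\<^sup>+\<omega>. ennreal ((1 + (Y t \<omega>)\<^sup>2) ^ k) \<partial>P y) \<le> ennreal (2 * (1 + y\<^sup>2) ^ k * exp (2 * C * t))" .
  qed
qed

lemma poly_growth_moment_bound:
  assumes "poly_growth g"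
  obtains K where "\<And>r. 0 \<le> r \<Longrightarrow> r \<le> t \<Longrightarrow> (\<integral>\<^sup>+\<omega>. ennreal \<bar>g (Y r \<omega>)\<bar> \<partial>P y) \<le> ennreal K"
proof -
  obtain D k where D: "D \<ge> 0" "\<And>x. \<bar>g x\<bar> \<le> D * (1 + x\<^sup>2) ^ k" using poly_growthE[OF assms] by blast
  obtain C where C: "\<And>t y. t \<ge> 0 \<Longrightarrow>
    (\<integral>\<^sup>+\<omega>. ennreal ((1 + (Y t \<omega>)\<^sup>2) ^ k) \<partial>P y) \<le> ennreal (2 * (1 + y\<^sup>2) ^ k * exp (2 * C * t))"
    using moment_bound[of k] by metis
  show ?thesis
  proof (rule that)
    fix r :: real assume r: "0 \<le> r" "r \<le> t"
    have "(\<integral>\<^sup>+\<omega>. ennreal \<bar>g (Y r \<omega>)\<bar> \<partial>P y) \<le> (\<integral>\<^sup>+\<omega>. ennreal D * ennreal ((1 + (Y r \<omega>)\<^sup>2) ^ k) \<partial>P y)"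
      using D by (intro nn_integral_mono) (auto simp flip: ennreal_mult intro!: ennreal_leI)
    also have "\<dots> = ennreal D * (\<integral>\<^sup>+\<omega>. ennreal ((1 + (Y r \<omega>)\<^sup>2) ^ k) \<partial>P y)"
      using r by (intro nn_integral_cmult) measurable
    also have "\<dots> \<le> ennreal D * ennreal (2 * (1 + y\<^sup>2) ^ k * exp (2 * C * r))"
      by (intro mult_left_mono C r) simp
    \<comment> \<open>No sign of \<open>C\<close> is known here; the absolute value makes the bound
      monotone in r and thus uniform on [0, t].\<close>
    also have "\<dots> \<le> ennreal D * ennreal (2 * (1 + y\<^sup>2) ^ k * exp (2 * \<bar>C\<bar> * t))"
    proof -
      have "C * r \<le> \<bar>C\<bar> * t" using r by (intro mult_mono) auto
      then show ?thesis by (intro mult_left_mono ennreal_leI) auto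
    qed
    also have "\<dots> = ennreal (D * (2 * (1 + y\<^sup>2) ^ k * exp (2 * \<bar>C\<bar> * t)))"
      using D(1) by (simp add: ennreal_mult)
    finally show "(\<integral>\<^sup>+\<omega>. ennreal \<bar>g (Y r \<omega>)\<bar> \<partial>P y) \<le> ennreal (D * (2 * (1 + y\<^sup>2) ^ k * exp (2 * \<bar>C\<bar> * t)))" .
  qed
qed

lemma integrable_poly_growth:
  assumes "poly_growth g" and [measurable]: "g \<in> borel_measurable borel" and t: "t \<ge> 0"
  shows "integrable (P y) (\<lambda>\<omega>. g (Y t \<omega>))"
proof -
  obtain K where "\<And>r. 0 \<le> r \<Longrightarrow> r \<le> t \<Longrightarrow> (\<integral>\<^sup>+\<omega>. ennreal \<bar>g (Y r \<omega>)\<bar> \<partial>P y) \<le> ennreal K"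
    using poly_growth_moment_bound[OF assms(1)] by metis
  from this[OF t order_refl] show ?thesis
    using t by (intro integrableI_bounded) (auto intro: le_less_trans ennreal_less_top)
qed

lemma integrable_time_space_poly_growth:
  assumes "poly_growth g" "g \<in> borel_measurable borel" "0 \<le> s"
  shows "integrable (lborel \<Otimes>\<^sub>M P y) (\<lambda>(r, \<omega>). indicator {s..t} r * g (Y (max 0 r) \<omega>))"
proof -
  obtain K where "\<And>r. 0 \<le> r \<Longrightarrow> r \<le> t \<Longrightarrow> (\<integral>\<^sup>+\<omega>. ennreal \<bar>g (Y r \<omega>)\<bar> \<partial>P y) \<le> ennreal K"
    using poly_growth_moment_bound[OF assms(1)] by metis
  then show ?thesis using assms(3) by (intro integrable_time_space[OF assms(2,3), of t y K]) auto
qed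

section \<open>Dynkin's formula for polynomials\<close>

text \<open>The usual notation is E[g(Y r); A]. The truncation \<open>max 0 r\<close> makes it a
  measurable function on the whole line, as integration over time requires.\<close>

definition local_expectation :: "real \<Rightarrow> 'a set \<Rightarrow> (real \<Rightarrow> real) \<Rightarrow> real \<Rightarrow> real" where
  "local_expectation y A g r = (\<integral>\<omega>. indicator A \<omega> * g (Y (max 0 r) \<omega>) \<partial>P y)"

lemma time_space_Fubini:
  assumes g: "poly_growth g" "g \<in> borel_measurable borel" and A: "A \<in> sets (P y)"
  shows "AE \<omega> in P y. integrable lborel (\<lambda>r. indicator {0..t} r * g (Y (max 0 r) \<omega>))"
    "integrable (P y) (\<lambda>\<omega>. LBINT r. indicator {0..t} r * g (Y (max 0 r) \<omega>))"
    "integrable lborel (\<lambda>r. indicator {0..t} r * local_expectation y A g r)"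
    "(\<integral>\<omega>. indicator A \<omega> * (LBINT r. indicator {0..t} r * g (Y (max 0 r) \<omega>)) \<partial>P y) =
      (LBINT r. indicator {0..t} r * local_expectation y A g r)"
proof -
  interpret prob_space "P y" by (rule prob_space_P)
  interpret pair: pair_sigma_finite lborel "P y" ..
  have i: "integrable (lborel \<Otimes>\<^sub>M P y) (\<lambda>(r, \<omega>). indicator {0..t} r * g (Y (max 0 r) \<omega>))"
    using g by (intro integrable_time_space_poly_growth) auto
  show "AE \<omega> in P y. integrable lborel (\<lambda>r. indicator {0..t} r * g (Y (max 0 r) \<omega>))"
    using pair.AE_integrable_snd[OF i] .
  show "integrable (P y) (\<lambda>\<omega>. LBINT r. indicator {0..t} r * g (Y (max 0 r) \<omega>))"
    using pair.integrable_snd[OF i] .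
  have [measurable]: "(\<lambda>p. indicator A (snd p) :: real) \<in> borel_measurable (lborel \<Otimes>\<^sub>M P y)"
    using A by measurable
  have iA: "integrable (lborel \<Otimes>\<^sub>M P y) (\<lambda>(r, \<omega>). indicator A \<omega> * (indicator {0..t} r * g (Y (max 0 r) \<omega>)))"
  proof (rule Bochner_Integration.integrable_bound[OF i])
    show "(\<lambda>(r, \<omega>). indicator A \<omega> * (indicator {0..t} r * g (Y (max 0 r) \<omega>))) \<in> borel_measurable (lborel \<Otimes>\<^sub>M P y)"
      using borel_measurable_integrable[OF i] by (simp add: split_beta')
  qed (auto simp: indicator_def)
  have eq: "(\<integral>\<omega>. indicator A \<omega> * (indicator {0..t} r * g (Y (max 0 r) \<omega>)) \<partial>P y) =
      indicator {0..t} r * local_expectation y A g r" for r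
    by (auto simp: local_expectation_def indicator_def)
  show "integrable lborel (\<lambda>r. indicator {0..t} r * local_expectation y A g r)"
    using pair.integrable_fst[OF iA] by (simp add: eq)
  have "(\<integral>\<omega>. indicator A \<omega> * (LBINT r. indicator {0..t} r * g (Y (max 0 r) \<omega>)) \<partial>P y) =
      (\<integral>\<omega>. (LBINT r. indicator A \<omega> * (indicator {0..t} r * g (Y (max 0 r) \<omega>))) \<partial>P y)"
    by simp
  also have "\<dots> = (LBINT r. indicator {0..t} r * local_expectation y A g r)"
    using pair.Fubini_integral[OF iA] by (simp add: eq)
  finally show "(\<integral>\<omega>. indicator A \<omega> * (LBINT r. indicator {0..t} r * g (Y (max 0 r) \<omega>)) \<partial>P y) =
      (LBINT r. indicator {0..t} r * local_expectation y A g r)" .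
qed

text \<open>The identity holds along the stopped times. Once f is bounded and its generator has
  polynomial growth, the moment bounds provide an integrable majorant, so dominated convergence
  removes the localization; the term \<open>f y * prob A\<close> then cancels.\<close>

lemma compensated_integral_eq:
  assumes f: "bounded_C2 f" "f \<in> borel_measurable borel" "\<And>x. \<bar>f x\<bar> \<le> B"
    and g: "poly_growth (generator b \<sigma> \<nu> f)" "generator b \<sigma> \<nu> f \<in> borel_measurable borel"
    and st: "0 \<le> s" "s \<le> t" and A: "A \<in> sets (F s)"
  shows "local_expectation y A f t - (LBINT r. indicator {0..t} r * local_expectation y A (generator b \<sigma> \<nu> f) r) =
    local_expectation y A f s - (LBINT r. indicator {0..s} r * local_expectation y A (generator b \<sigma> \<nu> f) r)"
proof -
  interpret prob_space "P y" by (rule prob_space_P)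
  note [measurable] = f(2) g(2)
  let ?g = "generator b \<sigma> \<nu> f"
  have AM [measurable]: "A \<in> sets (P y)" using A F_subalgebra by (auto simp: subalgebra_def)
  obtain T :: "nat \<Rightarrow> real \<Rightarrow> 'a \<Rightarrow> real" where
    T: "\<And>k t \<omega>. t \<ge> 0 \<Longrightarrow> 0 \<le> T k t \<omega> \<and> T k t \<omega> \<le> t"
      "AE \<omega> in P y. \<forall>t\<ge>0. eventually (\<lambda>k. T k t \<omega> = t) sequentially"
      "\<And>k t. t \<ge> 0 \<Longrightarrow> integrable (P y) (\<lambda>\<omega>. compensated f y (T k t \<omega>) \<omega>)"
      "\<And>k s t A. 0 \<le> s \<Longrightarrow> s \<le> t \<Longrightarrow> A \<in> sets (F s) \<Longrightarrow>
        (\<integral>\<omega>\<in>A. compensated f y (T k t \<omega>) \<omega> \<partial>(P y)) = (\<integral>\<omega>\<in>A. compensated f y (T k s \<omega>) \<omega> \<partial>(P y))"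
    by (erule localized[OF f(1), of y])
  define H where "H t \<omega> = (LBINT r. indicator {0..t} r * ?g (Y (max 0 r) \<omega>))" for t \<omega>
  have comp: "compensated f y t \<omega> = f (Y t \<omega>) - f y - H t \<omega>" for t \<omega>
    unfolding compensated_def H_def set_lebesgue_integral_def
    by (auto intro!: Bochner_Integration.integral_cong simp: indicator_def max_absorb2)
  \<comment> \<open>The integral of the absolute value dominates the compensator at all times up to
    t simultaneously, hence also at the random times \<open>T k t\<close>.\<close>
  define D where "D t \<omega> = (LBINT r. indicator {0..t} r * \<bar>?g (Y (max 0 r) \<omega>)\<bar>)" for t \<omega>
  have Dint: "integrable (P y) (D t)" for t
    unfolding D_def using time_space_Fubini(2)[OF poly_growth_abs[OF g(1)] _ AM, of t] by simp
  have Hint: "integrable (P y) (H t)" for t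
    unfolding H_def using time_space_Fubini(2)[OF g AM] by simp
  \<comment> \<open>The quantifier over u stands inside the almost-sure statement because u is later
    replaced by a time that depends on \<omega>.\<close>
  have HD: "AE \<omega> in P y. \<forall>u. 0 \<le> u \<and> u \<le> t \<longrightarrow> \<bar>H u \<omega>\<bar> \<le> D t \<omega>" for t
    using time_space_Fubini(1)[OF g AM, of t]
  proof eventually_elim
    case (elim \<omega>)
    have abs: "integrable lborel (\<lambda>r. indicator {0..t} r * \<bar>?g (Y (max 0 r) \<omega>)\<bar>)"
      using integrable_abs[OF elim] by (simp add: abs_mult)
    show ?case
    proof (intro allI impI)
      fix u assume u: "0 \<le> u \<and> u \<le> t"
      have meas: "(\<lambda>r. indicator {0..u} r * ?g (Y (max 0 r) \<omega>)) \<in> borel_measurable lborel"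
      proof -
        have "(\<lambda>r. indicator {0..u} r * (indicator {0..t} r * ?g (Y (max 0 r) \<omega>))) \<in> borel_measurable lborel"
          using borel_measurable_integrable[OF elim] by measurable
        also have "(\<lambda>r. indicator {0..u} r * (indicator {0..t} r * ?g (Y (max 0 r) \<omega>))) = (\<lambda>r. indicator {0..u} r * ?g (Y (max 0 r) \<omega>))"
          using u by (auto simp: indicator_def fun_eq_iff)
        finally show ?thesis .
      qed
      have "integrable lborel (\<lambda>r. indicator {0..u} r * ?g (Y (max 0 r) \<omega>))"
        by (rule Bochner_Integration.integrable_bound[OF abs meas]) (use u in \<open>auto simp: indicator_def\<close>)
      then show "\<bar>H u \<omega>\<bar> \<le> D t \<omega>" unfolding H_def D_def
        by (rule integral_abs_bound_integral[OF _ abs]) (use u in \<open>auto simp: indicator_def\<close>)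
    qed
  qed
  have lim: "(\<lambda>k. \<integral>\<omega>\<in>A. compensated f y (T k t \<omega>) \<omega> \<partial>(P y)) \<longlonglongrightarrow> (\<integral>\<omega>\<in>A. compensated f y t \<omega> \<partial>(P y))"
    if t: "t \<ge> 0" for t
    unfolding set_lebesgue_integral_def
  proof (rule integral_dominated_convergence)
    have [measurable]: "H t \<in> borel_measurable (P y)" using Hint by (rule borel_measurable_integrable)
    show "(\<lambda>\<omega>. indicator A \<omega> *\<^sub>R compensated f y t \<omega>) \<in> borel_measurable (P y)"
      unfolding comp using t by measurable
    have [measurable]: "(\<lambda>\<omega>. compensated f y (T k t \<omega>) \<omega>) \<in> borel_measurable (P y)" for k
      using T(3)[OF t] by (rule borel_measurable_integrable)
    show "(\<lambda>\<omega>. indicator A \<omega> *\<^sub>R compensated f y (T k t \<omega>) \<omega>) \<in> borel_measurable (P y)" for k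
      by measurable
    show "integrable (P y) (\<lambda>\<omega>. 2 * B + D t \<omega>)" using Dint by simp
    show "AE \<omega> in P y. (\<lambda>k. indicator A \<omega> *\<^sub>R compensated f y (T k t \<omega>) \<omega>) \<longlonglongrightarrow> indicator A \<omega> *\<^sub>R compensated f y t \<omega>"
      using T(2)
    proof eventually_elim
      case (elim \<omega>)
      then have "eventually (\<lambda>k. T k t \<omega> = t) sequentially" using t by auto
      then have "eventually (\<lambda>k. indicator A \<omega> *\<^sub>R compensated f y (T k t \<omega>) \<omega> = indicator A \<omega> *\<^sub>R compensated f y t \<omega>) sequentially"
        by eventually_elim simp
      then show ?case by (rule tendsto_eventually)
    qed
    show "AE \<omega> in P y. norm (indicator A \<omega> *\<^sub>R compensated f y (T k t \<omega>) \<omega>) \<le> 2 * B + D t \<omega>" for k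
      using HD[of t]
    proof eventually_elim
      case (elim \<omega>)
      have "\<bar>H (T k t \<omega>) \<omega>\<bar> \<le> D t \<omega>" using elim T(1)[OF t] by auto
      moreover have "\<bar>f (Y (T k t \<omega>) \<omega>)\<bar> \<le> B" "\<bar>f y\<bar> \<le> B" by (rule f(3))+
      ultimately have "\<bar>compensated f y (T k t \<omega>) \<omega>\<bar> \<le> 2 * B + D t \<omega>" unfolding comp by linarith
      then show ?case by (cases "\<omega> \<in> A") auto
    qed
  qed
  have "(\<integral>\<omega>\<in>A. compensated f y t \<omega> \<partial>(P y)) = (\<integral>\<omega>\<in>A. compensated f y s \<omega> \<partial>(P y))"
    using lim[of t] lim[OF st(1)] st unfolding T(4)[OF st A] by (intro LIMSEQ_unique) auto
  moreover have "(\<integral>\<omega>\<in>A. compensated f y t \<omega> \<partial>(P y)) = local_expectation y A f t - f y * prob A -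
      (LBINT r. indicator {0..t} r * local_expectation y A ?g r)" if t: "t \<ge> 0" for t
  proof -
    have fi: "integrable (P y) (\<lambda>\<omega>. indicator A \<omega> * f (Y t \<omega>))"
      using f(3) t order_trans[OF abs_ge_zero f(3)] by (intro integrable_const_bound[of _ B]) (auto simp: indicator_def)
    have Hi: "integrable (P y) (\<lambda>\<omega>. indicator A \<omega> * H t \<omega>)"
      using integrable_mult_indicator[OF AM Hint[of t]] by simp
    have "(\<integral>\<omega>\<in>A. compensated f y t \<omega> \<partial>(P y)) = (\<integral>\<omega>. indicator A \<omega> * f (Y t \<omega>) - indicator A \<omega> * f y - indicator A \<omega> * H t \<omega> \<partial>P y)"
      unfolding set_lebesgue_integral_def comp by (simp add: algebra_simps)
    also have "\<dots> = (\<integral>\<omega>. indicator A \<omega> * f (Y t \<omega>) \<partial>P y) - f y * prob A - (\<integral>\<omega>. indicator A \<omega> * H t \<omega> \<partial>P y)"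
    proof -
      have "integrable (P y) (\<lambda>\<omega>. indicator A \<omega> * f y)"
        by (intro integrable_mult_left) (simp add: integrable_indicator_iff less_top[symmetric])
      then show ?thesis using fi Hi by (subst Bochner_Integration.integral_diff; simp)+
    qed
    finally show ?thesis
      using t time_space_Fubini(4)[OF g AM, of t] by (simp add: local_expectation_def H_def max_absorb2)
  qed
  ultimately show ?thesis using st by auto
qed

text \<open>The damped polynomials satisfy the identity by \<open>compensated_integral_eq\<close>.
  Their limit is taken at three nested levels, each by dominated convergence: in the jump integral,
  in the expectation, and in the time integral.\<close>

lemma Dynkin_nonneg_poly:
  assumes p0: "\<And>x. 0 \<le> poly p x" and st: "0 \<le> s" "s \<le> t" and A: "A \<in> sets (F s)"
  shows "local_expectation y A (poly p) t - (LBINT r. indicator {0..t} r * local_expectation y A (generator b \<sigma> \<nu> (poly p)) r) =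
    local_expectation y A (poly p) s - (LBINT r. indicator {0..s} r * local_expectation y A (generator b \<sigma> \<nu> (poly p)) r)"
proof -
  interpret prob_space "P y" by (rule prob_space_P)
  have AM [measurable]: "A \<in> sets (P y)" using A F_subalgebra by (auto simp: subalgebra_def)
  let ?p' = "poly (pderiv p)" and ?p'' = "poly (pderiv (pderiv p))"
  note C2 = C2_derivs_poly[of p]
  note [measurable] = C2_derivs_measurable[OF C2]
  define \<epsilon> where "\<epsilon> n = inverse (real (Suc n))" for n
  have eps: "0 < \<epsilon> n" "\<epsilon> n \<le> 1" "0 \<le> \<epsilon> n" for n by (auto simp: \<epsilon>_def inverse_le_1_iff)
  define f f' f'' where "f n = damped (\<epsilon> n) (poly p)" and "f' n x = ?p' x / (1 + \<epsilon> n * poly p x)\<^sup>2"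
    and "f'' n x = ?p'' x / (1 + \<epsilon> n * poly p x)\<^sup>2 - 2 * \<epsilon> n * (?p' x)\<^sup>2 / (1 + \<epsilon> n * poly p x) ^ 3" for n x
  have C2f: "C2_derivs (f n) (f' n) (f'' n)" for n
    using C2_derivs_damped[OF C2 p0 eps(3)] unfolding f_def f'_def[abs_def] f''_def[abs_def] .
  note [measurable] = C2_derivs_measurable[OF C2f]
  \<comment> \<open>The sum majorizes the bounds of both damped derivatives for every n, because
    \<open>generator_bound\<close> expects the same \<open>C\<close> and \<open>k\<close> for the
    first and the second derivative.\<close>
  have "poly_growth (\<lambda>x. \<bar>?p' x\<bar> + (\<bar>?p'' x\<bar> + 2 * (?p' x)\<^sup>2))"
    by (intro poly_growth_intros)
  then obtain C k where C: "C \<ge> 0" "\<And>x. \<bar>\<bar>?p' x\<bar> + (\<bar>?p'' x\<bar> + 2 * (?p' x)\<^sup>2)\<bar> \<le> C * (1 + x\<^sup>2) ^ k"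
    using poly_growthE by blast
  have bound: "\<bar>f' n x\<bar> \<le> C * (1 + x\<^sup>2) ^ k" "\<bar>f'' n x\<bar> \<le> C * (1 + x\<^sup>2) ^ k" for n x
    using damped_deriv_bounds(1)[where f = "poly p" and f' = ?p' and x = x, OF p0 eps(3,2)]
      damped_deriv_bounds(2)[where f = "poly p" and f' = ?p' and f'' = ?p'' and x = x, OF p0 eps(3,2)] C(2)[of x]
    unfolding f'_def f''_def by (smt (verit) zero_le_power2)+
  obtain K j where K: "K \<ge> 0" "\<And>f f' f'' C x. C2_derivs f f' f'' \<Longrightarrow> (\<And>x. \<bar>f' x\<bar> \<le> C * (1 + x\<^sup>2) ^ k) \<Longrightarrow>
    (\<And>x. \<bar>f'' x\<bar> \<le> C * (1 + x\<^sup>2) ^ k) \<Longrightarrow> \<bar>generator b \<sigma> \<nu> f x\<bar> \<le> C * (K * (1 + x\<^sup>2) ^ j)"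
    by (erule generator_bound[of k])
  \<comment> \<open>A single majorant for the generators of all \<open>f n\<close>; it dominates
    under the expectation, and its own expectation dominates in the time integral.\<close>
  define w where "w x = C * (K * (1 + x\<^sup>2) ^ j)" for x :: real
  have w: "poly_growth w" "w \<in> borel_measurable borel" "\<And>x. 0 \<le> w x"
    unfolding w_def[abs_def] using C(1) K(1) by (auto intro!: poly_growth_intros)
  note [measurable] = w(2)
  have Gw: "\<bar>generator b \<sigma> \<nu> (f n) x\<bar> \<le> w x" for n x
    unfolding w_def by (rule K(2)[OF C2f bound])
  have pgf: "poly_growth (f'' n)" for n using bound(2) by (auto simp: poly_growth_def)
  have Gm [measurable]: "generator b \<sigma> \<nu> (f n) \<in> borel_measurable borel" for n
    by (rule generator_measurable[OF C2f pgf])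
  have Gpm [measurable]: "generator b \<sigma> \<nu> (poly p) \<in> borel_measurable borel"
    by (rule generator_measurable[OF C2 poly_growth_poly])
  have Gpg: "poly_growth (generator b \<sigma> \<nu> (f n))" for n
    by (rule poly_growth_mono[OF w(1)]) (use Gw[of n] in \<open>auto intro: order_trans[OF _ abs_ge_self]\<close>)
  have epsx: "(\<lambda>n. 1 + \<epsilon> n * c) \<longlonglongrightarrow> 1 + 0 * c" for c :: real
    unfolding \<epsilon>_def by (intro tendsto_intros LIMSEQ_inverse_real_of_nat)
  have fl: "(\<lambda>n. f n x) \<longlonglongrightarrow> poly p x" for x
    unfolding f_def \<epsilon>_def by (rule damped_tendsto)
  have f'l: "(\<lambda>n. f' n x) \<longlonglongrightarrow> ?p' x" for x
  proof -
    have "(\<lambda>n. ?p' x / (1 + \<epsilon> n * poly p x)\<^sup>2) \<longlonglongrightarrow> ?p' x / (1 + 0 * poly p x)\<^sup>2"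
      by (intro tendsto_divide tendsto_const tendsto_power epsx) simp
    then show ?thesis by (simp add: f'_def)
  qed
  have f''l: "(\<lambda>n. f'' n x) \<longlonglongrightarrow> ?p'' x" for x
  proof -
    have "(\<lambda>n. f'' n x) \<longlonglongrightarrow> ?p'' x / (1 + 0 * poly p x)\<^sup>2 - 2 * 0 * (?p' x)\<^sup>2 / (1 + 0 * poly p x) ^ 3"
      unfolding f''_def
      by (intro tendsto_diff tendsto_divide tendsto_mult tendsto_const tendsto_power epsx)
        (use LIMSEQ_inverse_real_of_nat in \<open>auto simp: \<epsilon>_def[abs_def]\<close>)
    then show ?thesis by simp
  qed
  have Gl: "(\<lambda>n. generator b \<sigma> \<nu> (f n) x) \<longlonglongrightarrow> generator b \<sigma> \<nu> (poly p) x" for x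
  proof -
    have "(\<lambda>n. LINT z|\<nu> x. f n (x + z) - f n x - f' n x * z) \<longlonglongrightarrow> (LINT z|\<nu> x. poly p (x + z) - poly p x - ?p' x * z)"
    proof (rule integral_dominated_convergence)
      show "integrable (\<nu> x) (\<lambda>z. C * (4 ^ k * (1 + x\<^sup>2) ^ k) * (z\<^sup>2 + z ^ (2 * k + 2)))"
        by (intro integrable_mult_right Bochner_Integration.integrable_add integrable_jump_power) auto
      show "AE z in \<nu> x. (\<lambda>n. f n (x + z) - f n x - f' n x * z) \<longlonglongrightarrow> poly p (x + z) - poly p x - ?p' x * z"
        by (intro AE_I2 tendsto_intros fl f'l)
      show "AE z in \<nu> x. norm (f n (x + z) - f n x - f' n x * z) \<le> C * (4 ^ k * (1 + x\<^sup>2) ^ k) * (z\<^sup>2 + z ^ (2 * k + 2))" for n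
        using Taylor_remainder_bound[OF C2f bound(2), of n] by simp
    qed measurable
    then show ?thesis unfolding generator_C2[OF C2f] generator_C2[OF C2]
      by (intro tendsto_intros f'l f''l)
  qed
  have wA: "integrable (P y) (\<lambda>\<omega>. w (Y (max 0 r) \<omega>))" for r
    using w by (intro integrable_poly_growth) auto
  have local_lim: "(\<lambda>n. local_expectation y A (generator b \<sigma> \<nu> (f n)) r) \<longlonglongrightarrow> local_expectation y A (generator b \<sigma> \<nu> (poly p)) r" for r
    unfolding local_expectation_def
  proof (rule integral_dominated_convergence[OF _ _ wA[of r]])
    show "AE \<omega> in P y. (\<lambda>n. indicator A \<omega> * generator b \<sigma> \<nu> (f n) (Y (max 0 r) \<omega>)) \<longlonglongrightarrow> indicator A \<omega> * generator b \<sigma> \<nu> (poly p) (Y (max 0 r) \<omega>)"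
      by (intro AE_I2 tendsto_intros Gl)
    show "AE \<omega> in P y. norm (indicator A \<omega> * generator b \<sigma> \<nu> (f n) (Y (max 0 r) \<omega>)) \<le> w (Y (max 0 r) \<omega>)" for n
      using Gw w(3) by (auto simp: indicator_def)
  qed measurable
  have local_bound: "\<bar>local_expectation y A (generator b \<sigma> \<nu> (f n)) r\<bar> \<le> local_expectation y (space M) w r" for n r
    unfolding local_expectation_def
  proof (rule order_trans[OF integral_abs_bound integral_mono])
    show "integrable (P y) (\<lambda>\<omega>. \<bar>indicator A \<omega> * generator b \<sigma> \<nu> (f n) (Y (max 0 r) \<omega>)\<bar>)"
      using integrable_mult_indicator[OF AM integrable_poly_growth[OF Gpg Gm], of "max 0 r" n] by simp
    have "space M \<in> sets (P y)" using sets.top[of "P y"] by (simp add: space_P)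
    from integrable_mult_indicator[OF this wA[of r]]
    show "integrable (P y) (\<lambda>\<omega>. indicator (space M) \<omega> * w (Y (max 0 r) \<omega>))" by simp
  qed (use Gw w(3) in \<open>auto simp: indicator_def space_P\<close>)
  have time_lim: "(\<lambda>n. LBINT r. indicator {0..t} r * local_expectation y A (generator b \<sigma> \<nu> (f n)) r) \<longlonglongrightarrow>
      (LBINT r. indicator {0..t} r * local_expectation y A (generator b \<sigma> \<nu> (poly p)) r)" for t
  proof (rule integral_dominated_convergence)
    have spM: "space M \<in> sets (P y)" using sets.top[of "P y"] by (simp add: space_P)
    show "integrable lborel (\<lambda>r. indicator {0..t} r * local_expectation y (space M) w r)"
      by (rule time_space_Fubini(3)[OF w(1,2) spM])
    show "(\<lambda>r. indicator {0..t} r * local_expectation y A (generator b \<sigma> \<nu> (f n)) r) \<in> borel_measurable lborel" for n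
      by (rule borel_measurable_integrable[OF time_space_Fubini(3)[OF Gpg Gm AM]])
    have "poly_growth (generator b \<sigma> \<nu> (poly p))"
      using generator_poly[OF order_refl, of p] poly_growth_poly by metis
    then show "(\<lambda>r. indicator {0..t} r * local_expectation y A (generator b \<sigma> \<nu> (poly p)) r) \<in> borel_measurable lborel"
      by (rule borel_measurable_integrable[OF time_space_Fubini(3)[OF _ Gpm AM]])
    show "AE r in lborel. (\<lambda>n. indicator {0..t} r * local_expectation y A (generator b \<sigma> \<nu> (f n)) r) \<longlonglongrightarrow>
        indicator {0..t} r * local_expectation y A (generator b \<sigma> \<nu> (poly p)) r"
      by (intro AE_I2 tendsto_intros local_lim)
    show "AE r in lborel. norm (indicator {0..t} r * local_expectation y A (generator b \<sigma> \<nu> (f n)) r) \<le>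
        indicator {0..t} r * local_expectation y (space M) w r" for n
      using local_bound by (auto simp: abs_mult intro!: AE_I2 mult_left_mono)
  qed
  have exp_lim: "(\<lambda>n. local_expectation y A (f n) r) \<longlonglongrightarrow> local_expectation y A (poly p) r" for r
    unfolding local_expectation_def
  proof (rule integral_dominated_convergence)
    show "integrable (P y) (\<lambda>\<omega>. poly p (Y (max 0 r) \<omega>))"
      by (intro integrable_poly_growth poly_growth_poly) auto
    show "AE \<omega> in P y. (\<lambda>n. indicator A \<omega> * f n (Y (max 0 r) \<omega>)) \<longlonglongrightarrow> indicator A \<omega> * poly p (Y (max 0 r) \<omega>)"
      by (intro AE_I2 tendsto_intros fl)
    show "AE \<omega> in P y. norm (indicator A \<omega> * f n (Y (max 0 r) \<omega>)) \<le> poly p (Y (max 0 r) \<omega>)" for n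
      using damped_bounds[of "poly p", OF p0 eps(1)] p0 by (auto simp: indicator_def f_def)
  qed measurable
  have "local_expectation y A (f n) t - (LBINT r. indicator {0..t} r * local_expectation y A (generator b \<sigma> \<nu> (f n)) r) =
    local_expectation y A (f n) s - (LBINT r. indicator {0..s} r * local_expectation y A (generator b \<sigma> \<nu> (f n)) r)" for n
  proof (rule compensated_integral_eq[OF _ _ _ Gpg Gm st A])
    show "bounded_C2 (f n)" unfolding f_def by (rule bounded_C2_damped[OF C2 p0 eps(1)])
    show "\<bar>f n x\<bar> \<le> 1 / \<epsilon> n" for x
      using damped_bounds[of "poly p", OF p0 eps(1)] by (simp add: f_def)
  qed simp
  then show ?thesis
    using tendsto_diff[OF exp_lim[of t] time_lim[of t]] tendsto_diff[OF exp_lim[of s] time_lim[of s]]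
    by (simp only:) (rule LIMSEQ_unique)
qed

lemma integrable_local_poly:
  assumes "A \<in> sets (P y)"
  shows "integrable (P y) (\<lambda>\<omega>. indicator A \<omega> * poly p (Y (max 0 r) \<omega>))"
proof -
  have "integrable (P y) (\<lambda>\<omega>. poly p (Y (max 0 r) \<omega>))"
    using C2_derivs_measurable[OF C2_derivs_poly] by (intro integrable_poly_growth poly_growth_poly) auto
  from integrable_mult_indicator[OF assms this] show ?thesis by simp
qed

lemma local_expectation_add_poly:
  assumes "A \<in> sets (P y)"
  shows "local_expectation y A (poly (p + q)) r = local_expectation y A (poly p) r + local_expectation y A (poly q) r"
  unfolding local_expectation_def using integrable_local_poly[OF assms]
  by (simp add: distrib_left)

text \<open>Damping requires a nonnegative function. Writing p = (p + p2) - p2 with p2 a multiple of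
  a weight that exceeds |p| reduces the general case to two nonnegative polynomials.\<close>

lemma Dynkin_poly:
  assumes st: "0 \<le> s" "s \<le> t" and A: "A \<in> sets (F s)" and q: "generator b \<sigma> \<nu> (poly p) = poly q"
  shows "local_expectation y A (poly p) t = local_expectation y A (poly p) s +
    (LBINT r. indicator {s..t} r * local_expectation y A (poly q) r)"
proof -
  have AM [measurable]: "A \<in> sets (P y)" using A F_subalgebra by (auto simp: subalgebra_def)
  obtain C where C: "C \<ge> 0" "\<And>x. \<bar>poly p x\<bar> \<le> C * (1 + x\<^sup>2) ^ degree p"
    using poly_le_weight[of p "degree p"] by auto
  define p2 where "p2 = Polynomial.smult C ([:1, 0, 1:] ^ degree p)"
  have p2: "poly p2 x = C * (1 + x\<^sup>2) ^ degree p" for x by (simp add: p2_def power2_eq_square)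
  have pos: "0 \<le> poly p2 x" "0 \<le> poly (p + p2) x" for x
    using C(2)[of x] abs_ge_zero[of "poly p x"] unfolding poly_add p2 by linarith+
  obtain q2 where q2: "generator b \<sigma> \<nu> (poly p2) = poly q2" using generator_poly[OF order_refl] by blast
  have "generator b \<sigma> \<nu> (\<lambda>x. poly p x + poly p2 x) = (\<lambda>x. generator b \<sigma> \<nu> (poly p) x + generator b \<sigma> \<nu> (poly p2) x)"
    by (intro ext generator_add[OF C2_derivs_poly poly_growth_poly C2_derivs_poly poly_growth_poly])
  then have q12: "generator b \<sigma> \<nu> (poly (p + p2)) = poly (q + q2)"
    by (simp add: q q2 fun_eq_iff poly_add[abs_def])
  have I: "integrable lborel (\<lambda>r. indicator {0..t} r * local_expectation y A (poly q) r)" for t and q :: "real poly"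
    using C2_derivs_measurable[OF C2_derivs_poly] by (intro time_space_Fubini(3) poly_growth_poly AM) auto
  have split: "(LBINT r. indicator {0..t} r * local_expectation y A (poly (q + q2)) r) =
      (LBINT r. indicator {0..t} r * local_expectation y A (poly q) r) + (LBINT r. indicator {0..t} r * local_expectation y A (poly q2) r)" for t
    using I[of t q] I[of t q2] by (simp add: local_expectation_add_poly distrib_left)
  have "local_expectation y A (poly p) t - (LBINT r. indicator {0..t} r * local_expectation y A (poly q) r) =
    local_expectation y A (poly p) s - (LBINT r. indicator {0..s} r * local_expectation y A (poly q) r)"
    using Dynkin_nonneg_poly[OF pos(1) st A, of y] Dynkin_nonneg_poly[OF pos(2) st A, of y]
    unfolding q2 q12 split unfolding local_expectation_add_poly[OF AM] by linarith
  moreover have "(LBINT r. indicator {0..t} r * local_expectation y A (poly q) r) - (LBINT r. indicator {0..s} r * local_expectation y A (poly q) r) =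
      (LBINT r. indicator {s..t} r * local_expectation y A (poly q) r)"
  proof -
    have "(LBINT r. indicator {0..t} r * local_expectation y A (poly q) r) - (LBINT r. indicator {0..s} r * local_expectation y A (poly q) r) =
      (LBINT r. indicator {0..t} r * local_expectation y A (poly q) r - indicator {0..s} r * local_expectation y A (poly q) r)"
      using I by simp
    \<comment> \<open>The difference of the indicators is that of the half-open interval from s to
      t, so the integrands differ only at the null set {s}.\<close>
    also have "\<dots> = (LBINT r. indicator {s..t} r * local_expectation y A (poly q) r)"
    proof (rule integral_cong_AE)
      show "(\<lambda>r. indicator {0..t} r * local_expectation y A (poly q) r - indicator {0..s} r * local_expectation y A (poly q) r) \<in> borel_measurable lborel"
        using I[of t q] I[of s q] by (intro borel_measurable_diff borel_measurable_integrable)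
      have "(\<lambda>r. indicator {s..t} r * (indicator {0..t} r * local_expectation y A (poly q) r)) \<in> borel_measurable lborel"
        using borel_measurable_integrable[OF I[of t q]] by measurable
      also have "(\<lambda>r. indicator {s..t} r * (indicator {0..t} r * local_expectation y A (poly q) r)) = (\<lambda>r. indicator {s..t} r * local_expectation y A (poly q) r)"
        using st by (auto simp: indicator_def fun_eq_iff)
      finally show "(\<lambda>r. indicator {s..t} r * local_expectation y A (poly q) r) \<in> borel_measurable lborel" .
      show "AE r in lborel. indicator {0..t} r * local_expectation y A (poly q) r - indicator {0..s} r * local_expectation y A (poly q) r =
          indicator {s..t} r * local_expectation y A (poly q) r"
        using AE_lborel_singleton[of s] by eventually_elim (use st in \<open>auto simp: indicator_def\<close>)
    qed
    finally show ?thesis .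
  qed
  ultimately show ?thesis by linarith
qed

end

section \<open>The matrix exponential and linear integral equations\<close>

text \<open>One integration turns a Taylor monomial into the next one; this drives both the series
  and the remainder estimate of the Picard iteration.\<close>

lemma has_bochner_integral_power_shift:
  fixes s t :: real
  assumes "s \<le> t"
  shows "has_bochner_integral lborel (\<lambda>u. indicator {s..t} u * ((u - s) ^ k / fact k)) ((t - s) ^ Suc k / fact (Suc k))"
proof -
  have "has_bochner_integral lborel (\<lambda>u. (u - s) ^ k / fact k * indicator {s..t} u)
      ((t - s) ^ Suc k / fact (Suc k) - (s - s) ^ Suc k / fact (Suc k))"
  proof (rule has_bochner_integral_FTC_Icc_real[OF assms])
    show "((\<lambda>u. (u - s) ^ Suc k / fact (Suc k)) has_real_derivative (u - s) ^ k / fact k) (at u)" for u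
      by (rule derivative_eq_intros refl | simp)+
  qed auto
  then show ?thesis by (simp add: mult.commute)
qed

lemma power_over_fact_tendsto_0: "(\<lambda>k. x ^ k / fact k) \<longlonglongrightarrow> (0::real)"
  using summable_LIMSEQ_zero[OF summable_exp[of x]] by (simp add: field_simps)

text \<open>Picard iteration of \<open>\<phi>(t) = \<phi>(s) + \<integral> A \<phi>(u) du\<close>; the \<open>k\<close>-th Taylor coefficient of \<open>\<phi>\<close> at \<open>s\<close>
  is \<open>v k = A^k \<phi>(s)\<close>.\<close>

lemma linear_integral_equation_sums:
  fixes \<phi> :: "nat \<Rightarrow> real \<Rightarrow> real" and v a :: "nat \<Rightarrow> nat \<Rightarrow> real"
  assumes eq: "\<And>i r. i \<le> m \<Longrightarrow> s \<le> r \<Longrightarrow> r \<le> T \<Longrightarrow>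
      \<phi> i r = \<phi> i s + (LBINT u. indicator {s..r} u * (\<Sum>j\<le>m. a i j * \<phi> j u))"
    and int: "\<And>j r. j \<le> m \<Longrightarrow> integrable lborel (\<lambda>u. indicator {s..r} u * \<phi> j u)"
    and B: "\<And>i r. i \<le> m \<Longrightarrow> s \<le> r \<Longrightarrow> r \<le> T \<Longrightarrow> \<bar>\<phi> i r\<bar> \<le> B"
    and v0: "\<And>i. i \<le> m \<Longrightarrow> v i 0 = \<phi> i s"
    and vS: "\<And>i k. i \<le> m \<Longrightarrow> v i (Suc k) = (\<Sum>j\<le>m. a i j * v j k)"
    and i: "i \<le> m" and sT: "s \<le> T"
  shows "(\<lambda>k. v i k * ((T - s) ^ k / fact k)) sums \<phi> i T"
proof -
  \<comment> \<open>The sum over all entries is a crude but uniform bound for every row sum.\<close>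
  define K where "K = (\<Sum>i\<le>m. \<Sum>j\<le>m. \<bar>a i j\<bar>)"
  have K: "K \<ge> 0" unfolding K_def by (intro sum_nonneg) auto
  have rowK: "(\<Sum>j\<le>m. \<bar>a i j\<bar>) \<le> K" if "i \<le> m" for i
    unfolding K_def using that by (intro member_le_sum[of i "{..m}" "\<lambda>i. \<Sum>j\<le>m. \<bar>a i j\<bar>"] sum_nonneg) auto
  have B0: "B \<ge> 0" using B[OF i sT order_refl] by linarith
  \<comment> \<open>The remainder after N Taylor terms. Its recursion is that of the equation
    itself: \<open>R (Suc N)\<close> is the time integral of the coefficient matrix applied to
    \<open>R N\<close>.\<close>
  define R where "R N i t = \<phi> i t - (\<Sum>k<N. v i k * ((t - s) ^ k / fact k))" for N i t
  \<comment> \<open>The induction covers all components and all times at once, since the recursion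
    mixes the components and integrates over earlier times.\<close>
  have "\<forall>i\<le>m. \<forall>t. s \<le> t \<and> t \<le> T \<longrightarrow> \<bar>R N i t\<bar> \<le> B * K ^ N * ((t - s) ^ N / fact N)" for N
  proof (induction N)
    case 0
    then show ?case using B by (simp add: R_def)
  next
    case (Suc N)
    show ?case
    proof (intro allI impI)
      fix i t assume i: "i \<le> m" and t: "s \<le> t \<and> t \<le> T"
      note P = has_bochner_integral_power_shift[of s t]
      have Pint: "integrable lborel (\<lambda>u. indicator {s..t} u * ((u - s) ^ k / fact k))"
        and Peq: "(LBINT u. indicator {s..t} u * ((u - s) ^ k / fact k)) = (t - s) ^ Suc k / fact (Suc k)" for k
        using P t by (auto simp: has_bochner_integral_iff)
      have Rint: "integrable lborel (\<lambda>u. indicator {s..t} u * R N j u)" if "j \<le> m" for j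
      proof -
        have "integrable lborel (\<lambda>u. indicator {s..t} u * \<phi> j u - (\<Sum>k<N. v j k * (indicator {s..t} u * ((u - s) ^ k / fact k))))"
          by (intro Bochner_Integration.integrable_diff Bochner_Integration.integrable_sum integrable_mult_right int that Pint)
        also have "(\<lambda>u. indicator {s..t} u * \<phi> j u - (\<Sum>k<N. v j k * (indicator {s..t} u * ((u - s) ^ k / fact k)))) = (\<lambda>u. indicator {s..t} u * R N j u)"
          by (auto simp: R_def indicator_def fun_eq_iff)
        finally show ?thesis .
      qed
      have Req: "(LBINT u. indicator {s..t} u * R N j u) = (LBINT u. indicator {s..t} u * \<phi> j u) -
          (\<Sum>k<N. v j k * ((t - s) ^ Suc k / fact (Suc k)))" if "j \<le> m" for j
      proof -
        have "(LBINT u. indicator {s..t} u * R N j u) =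
            (LBINT u. indicator {s..t} u * \<phi> j u - (\<Sum>k<N. v j k * (indicator {s..t} u * ((u - s) ^ k / fact k))))"
          by (intro Bochner_Integration.integral_cong) (auto simp: R_def indicator_def)
        also have "\<dots> = (LBINT u. indicator {s..t} u * \<phi> j u) - (LBINT u. \<Sum>k<N. v j k * (indicator {s..t} u * ((u - s) ^ k / fact k)))"
          by (intro Bochner_Integration.integral_diff Bochner_Integration.integrable_sum integrable_mult_right int that Pint)
        also have "(LBINT u. \<Sum>k<N. v j k * (indicator {s..t} u * ((u - s) ^ k / fact k))) =
            (\<Sum>k<N. v j k * ((t - s) ^ Suc k / fact (Suc k)))"
          by (subst Bochner_Integration.integral_sum) (auto intro!: integrable_mult_right Pint sum.cong simp only: integral_mult_right_zero Peq)
        finally show ?thesis .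
      qed
      \<comment> \<open>The term k = 0 of the shifted sum is the initial value and cancels against
        \<open>\<phi> i s\<close>.\<close>
      have "R (Suc N) i t = (LBINT u. indicator {s..t} u * (\<Sum>j\<le>m. a i j * \<phi> j u)) - (\<Sum>k<N. v i (Suc k) * ((t - s) ^ Suc k / fact (Suc k)))"
        unfolding R_def sum.lessThan_Suc_shift using eq[OF i, of t] t v0[OF i] by simp
      also have "(LBINT u. indicator {s..t} u * (\<Sum>j\<le>m. a i j * \<phi> j u)) = (LBINT u. \<Sum>j\<le>m. a i j * (indicator {s..t} u * \<phi> j u))"
        by (intro Bochner_Integration.integral_cong) (auto simp: sum_distrib_left mult_ac)
      also have "\<dots> = (\<Sum>j\<le>m. a i j * (LBINT u. indicator {s..t} u * \<phi> j u))"
        by (subst Bochner_Integration.integral_sum) (auto intro!: integrable_mult_right int)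
      also have "(\<Sum>k<N. v i (Suc k) * ((t - s) ^ Suc k / fact (Suc k))) = (\<Sum>j\<le>m. a i j * (\<Sum>k<N. v j k * ((t - s) ^ Suc k / fact (Suc k))))"
        unfolding vS[OF i] sum_distrib_left sum_distrib_right mult.assoc by (rule sum.swap)
      also have "(\<Sum>j\<le>m. a i j * (LBINT u. indicator {s..t} u * \<phi> j u)) - (\<Sum>j\<le>m. a i j * (\<Sum>k<N. v j k * ((t - s) ^ Suc k / fact (Suc k)))) =
          (\<Sum>j\<le>m. a i j * (LBINT u. indicator {s..t} u * R N j u))"
        unfolding sum_subtractf[symmetric] right_diff_distrib[symmetric] by (intro sum.cong) (simp_all add: Req del: fact_Suc power_Suc)
      finally have "\<bar>R (Suc N) i t\<bar> \<le> (\<Sum>j\<le>m. \<bar>a i j\<bar> * \<bar>LBINT u. indicator {s..t} u * R N j u\<bar>)"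
        by (simp add: order_trans[OF sum_abs] abs_mult)
      also have "\<dots> \<le> (\<Sum>j\<le>m. \<bar>a i j\<bar> * (B * K ^ N * ((t - s) ^ Suc N / fact (Suc N))))"
      proof (intro sum_mono mult_left_mono)
        fix j assume "j \<in> {..m}"
        then have j: "j \<le> m" by simp
        have "\<bar>LBINT u. indicator {s..t} u * R N j u\<bar> \<le> (LBINT u. B * K ^ N * (indicator {s..t} u * ((u - s) ^ N / fact N)))"
        proof (rule order_trans[OF integral_abs_bound integral_mono])
          show "integrable lborel (\<lambda>u. \<bar>indicator {s..t} u * R N j u\<bar>)" using Rint[OF j] by simp
          show "integrable lborel (\<lambda>u. B * K ^ N * (indicator {s..t} u * ((u - s) ^ N / fact N)))"
            by (intro integrable_mult_right Pint)
          show "\<bar>indicator {s..t} u * R N j u\<bar> \<le> B * K ^ N * (indicator {s..t} u * ((u - s) ^ N / fact N))" for u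
            using Suc.IH j t by (auto simp: indicator_def)
        qed
        then show "\<bar>LBINT u. indicator {s..t} u * R N j u\<bar> \<le> B * K ^ N * ((t - s) ^ Suc N / fact (Suc N))"
          by (simp only: integral_mult_right_zero Peq)
      qed simp
      also have "\<dots> = (\<Sum>j\<le>m. \<bar>a i j\<bar>) * (B * K ^ N * ((t - s) ^ Suc N / fact (Suc N)))"
        by (rule sum_distrib_right[symmetric])
      also have "\<dots> \<le> K * (B * K ^ N * ((t - s) ^ Suc N / fact (Suc N)))"
        using t B0 K by (intro mult_right_mono rowK i mult_nonneg_nonneg divide_nonneg_nonneg) auto
      finally show "\<bar>R (Suc N) i t\<bar> \<le> B * K ^ Suc N * ((t - s) ^ Suc N / fact (Suc N))"
        by (simp only: power_Suc mult_ac)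
    qed
  qed
  then have bound: "norm (R N i T) \<le> B * ((K * (T - s)) ^ N / fact N)" for N
    using i sT by (simp add: power_mult_distrib mult_ac)
  have "(\<lambda>N. R N i T) \<longlonglongrightarrow> 0"
    by (rule Lim_null_comparison[OF always_eventually[OF allI[OF bound]]])
      (rule tendsto_mult_right_zero[OF power_over_fact_tendsto_0])
  then have "(\<lambda>N. \<phi> i T - R N i T) \<longlonglongrightarrow> \<phi> i T - 0" by (intro tendsto_intros)
  then show ?thesis by (simp add: R_def sums_def)
qed

text \<open>The power unfolds with the new factor on the right, whereas the recurrence for the
  Taylor coefficients multiplies from the left.\<close>

lemma pow_mat_Suc_left:
  fixes A :: "'a :: semiring_1 mat"
  assumes A: "A \<in> carrier_mat n n"
  shows "A ^\<^sub>m Suc k = A * A ^\<^sub>m k"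
proof (induction k)
  case 0
  then show ?case using A by simp
next
  case (Suc k)
  have "A ^\<^sub>m Suc (Suc k) = (A * A ^\<^sub>m k) * A" using Suc.IH by simp
  also have "\<dots> = A * (A ^\<^sub>m k * A)" using A by (intro assoc_mult_mat[of _ n n _ n _ n]) auto
  finally show ?case by simp
qed

lemma pow_mat_transpose:
  fixes A :: "'a :: comm_semiring_1 mat"
  assumes A: "A \<in> carrier_mat n n"
  shows "transpose_mat A ^\<^sub>m k = transpose_mat (A ^\<^sub>m k)"
proof (induction k)
  case 0
  then show ?case using A by simp
next
  case (Suc k)
  have "transpose_mat A ^\<^sub>m Suc k = transpose_mat (A ^\<^sub>m k) * transpose_mat A" using Suc.IH by simp
  also have "\<dots> = transpose_mat (A * A ^\<^sub>m k)" using A by (intro transpose_mult[symmetric]) auto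
  finally show ?case by (simp only: pow_mat_Suc_left[OF A])
qed

lemma pow_mat_smult:
  fixes A :: "'a :: comm_semiring_1 mat"
  assumes A: "A \<in> carrier_mat n n"
  shows "(c \<cdot>\<^sub>m A) ^\<^sub>m k = c ^ k \<cdot>\<^sub>m A ^\<^sub>m k"
proof (induction k)
  case 0
  then show ?case using A by (auto intro!: eq_matI)
next
  case (Suc k)
  then show ?case using A by (auto intro!: eq_matI simp: scalar_prod_def sum_distrib_left mult_ac)
qed

text \<open>With \<open>K\<close> the sum of all absolute entries, every column sum is at most
  \<open>K\<close>, so the entries of the powers grow at most geometrically and the factorials in
  the exponential series prevail.\<close>

lemma pow_mat_entry_bound:
  fixes A :: "real mat"
  assumes A: "A \<in> carrier_mat n n"
  obtains K where "\<And>k i j. i < n \<Longrightarrow> j < n \<Longrightarrow> \<bar>(A ^\<^sub>m k) $$ (i, j)\<bar> \<le> K ^ k"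
proof
  define K where "K = (\<Sum>j<n. \<Sum>l<n. \<bar>A $$ (l, j)\<bar>)"
  have K: "K \<ge> 0" unfolding K_def by (intro sum_nonneg) auto
  show "\<bar>(A ^\<^sub>m k) $$ (i, j)\<bar> \<le> K ^ k" if "i < n" "j < n" for k i j
    using that
  proof (induction k arbitrary: j)
    case 0
    then show ?case using A by simp
  next
    case (Suc k)
    have "(A ^\<^sub>m Suc k) $$ (i, j) = (\<Sum>l<n. (A ^\<^sub>m k) $$ (i, l) * A $$ (l, j))"
      using A Suc.prems by (simp add: scalar_prod_def atLeast0LessThan)
    also have "\<bar>\<dots>\<bar> \<le> (\<Sum>l<n. \<bar>(A ^\<^sub>m k) $$ (i, l)\<bar> * \<bar>A $$ (l, j)\<bar>)"
      by (rule order_trans[OF sum_abs]) (simp add: abs_mult)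
    also have "\<dots> \<le> (\<Sum>l<n. K ^ k * \<bar>A $$ (l, j)\<bar>)"
      using Suc by (intro sum_mono mult_right_mono) auto
    also have "\<dots> = K ^ k * (\<Sum>l<n. \<bar>A $$ (l, j)\<bar>)" by (simp add: sum_distrib_left)
    also have "\<dots> \<le> K ^ k * K"
      unfolding K_def using Suc.prems K
      by (intro mult_left_mono member_le_sum[of j "{..<n}" "\<lambda>j. \<Sum>l<n. \<bar>A $$ (l, j)\<bar>"])
        (auto intro!: sum_nonneg zero_le_power)
    finally show ?case by (simp add: mult.commute)
  qed
qed

lemma mat_exp_carrier:
  assumes "A \<in> carrier_mat n n" shows "mat_exp A \<in> carrier_mat n n"
  using assms by (simp add: mat_exp_def)

text \<open>\<open>mat_exp\<close> is an entrywise infinite sum, which carries information only if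
  the series converges; the comparison series is that of exp(K |c|).\<close>

lemma mat_exp_sums:
  assumes A: "A \<in> carrier_mat n n" and ij: "i < n" "j < n"
  shows "(\<lambda>k. (A ^\<^sub>m k) $$ (i, j) * (c ^ k / fact k)) sums (mat_exp (c \<cdot>\<^sub>m A) $$ (i, j))"
proof -
  obtain K where K: "\<And>k i j. i < n \<Longrightarrow> j < n \<Longrightarrow> \<bar>(A ^\<^sub>m k) $$ (i, j)\<bar> \<le> K ^ k"
    using pow_mat_entry_bound[OF A] by metis
  have "summable (\<lambda>k. (A ^\<^sub>m k) $$ (i, j) * (c ^ k / fact k))"
  proof (rule summable_comparison_test'[OF summable_exp[of "K * \<bar>c\<bar>"]])
    show "norm ((A ^\<^sub>m k) $$ (i, j) * (c ^ k / fact k)) \<le> inverse (fact k) * (K * \<bar>c\<bar>) ^ k" for k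
      using mult_right_mono[OF K[OF ij, of k], of "\<bar>c\<bar> ^ k / fact k"]
      by (simp add: abs_mult power_abs power_mult_distrib divide_inverse mult_ac)
  qed
  moreover have "mat_exp (c \<cdot>\<^sub>m A) $$ (i, j) = (\<Sum>k. (A ^\<^sub>m k) $$ (i, j) * (c ^ k / fact k))"
    using A ij by (simp add: mat_exp_def pow_mat_smult[OF A] mult_ac)
  ultimately show ?thesis by (simp add: summable_sums)
qed

lemma mat_exp_transpose:
  assumes A: "A \<in> carrier_mat n n"
  shows "mat_exp (c \<cdot>\<^sub>m transpose_mat A) = transpose_mat (mat_exp (c \<cdot>\<^sub>m A))"
proof -
  have At: "transpose_mat A \<in> carrier_mat n n" using A by simp
  show ?thesis
    using A by (intro eq_matI)
      (auto simp: mat_exp_def pow_mat_smult[OF A] pow_mat_smult[OF At] pow_mat_transpose[OF A])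
qed

section \<open>Conditional moments\<close>

context polynomial_jump_diffusion
begin

abbreviation gen_mat :: "nat \<Rightarrow> real mat" where
  "gen_mat m \<equiv> generator_matrix (generator b \<sigma> \<nu>) m"

text \<open>A definite description needs existence and uniqueness. Existence is the invariance of
  the polynomials of degree at most m; uniqueness holds because polynomials that agree everywhere
  have equal coefficients.\<close>

lemma gen_mat:
  shows gen_mat_carrier: "gen_mat m \<in> carrier_mat (m + 1) (m + 1)"
    and gen_mat_power: "i \<le> m \<Longrightarrow> generator b \<sigma> \<nu> (\<lambda>u. u ^ i) x = (\<Sum>j\<le>m. gen_mat m $$ (i, j) * x ^ j)"
proof -
  let ?Q = "\<lambda>A. A \<in> carrier_mat (m + 1) (m + 1) \<and>
     (\<forall>x. Matrix.vec (m + 1) (\<lambda>i. generator b \<sigma> \<nu> (\<lambda>u. mono_vec m u $ i) x) = A *\<^sub>v mono_vec m x)"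
  have Q: "?Q A \<longleftrightarrow> A \<in> carrier_mat (m + 1) (m + 1) \<and>
      (\<forall>i\<le>m. \<forall>x. generator b \<sigma> \<nu> (\<lambda>u. u ^ i) x = (\<Sum>j\<le>m. A $$ (i, j) * x ^ j))" for A
  proof (rule conj_cong[OF refl])
    assume A: "A \<in> carrier_mat (m + 1) (m + 1)"
    have "(A *\<^sub>v mono_vec m x) $ i = (\<Sum>j\<le>m. A $$ (i, j) * x ^ j)" if "i \<le> m" for i x
      using A that by (simp add: mono_vec_def scalar_prod_def atLeast0LessThan lessThan_Suc_atMost)
    then show "(\<forall>x. Matrix.vec (m + 1) (\<lambda>i. generator b \<sigma> \<nu> (\<lambda>u. mono_vec m u $ i) x) = A *\<^sub>v mono_vec m x) \<longleftrightarrow>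
      (\<forall>i\<le>m. \<forall>x. generator b \<sigma> \<nu> (\<lambda>u. u ^ i) x = (\<Sum>j\<le>m. A $$ (i, j) * x ^ j))"
      using A by (auto simp: vec_eq_iff mono_vec_def less_Suc_eq_le)
  qed
  have "\<exists>q. degree q \<le> m \<and> generator b \<sigma> \<nu> (\<lambda>u. u ^ i) = poly q" if "i \<le> m" for i
  proof -
    have "degree (monom 1 i :: real poly) \<le> m" using that degree_monom_le[of "1::real" i] by simp
    then show ?thesis unfolding power_eq_poly by (rule generator_poly)
  qed
  then obtain q where q: "\<And>i. i \<le> m \<Longrightarrow> degree (q i) \<le> m \<and> generator b \<sigma> \<nu> (\<lambda>u. u ^ i) = poly (q i)" by metis
  define A where "A = Matrix.mat (m + 1) (m + 1) (\<lambda>(i, j). coeff (q i) j)"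
  have QA: "?Q A" unfolding Q
  proof (intro conjI allI impI)
    show "A \<in> carrier_mat (m + 1) (m + 1)" by (simp add: A_def)
    fix i x assume i: "i \<le> m"
    have "poly (q i) x = (\<Sum>j\<le>m. coeff (q i) j * x ^ j)"
      unfolding poly_altdef using q[OF i] by (intro sum.mono_neutral_left) (auto simp: coeff_eq_0)
    then show "generator b \<sigma> \<nu> (\<lambda>u. u ^ i) x = (\<Sum>j\<le>m. A $$ (i, j) * x ^ j)"
      using q[OF i] i by (simp add: A_def)
  qed
  have uniq: "A' = A''" if "?Q A'" "?Q A''" for A' A''
  proof (rule eq_matI)
    fix i j assume "i < dim_row A''" "j < dim_col A''"
    then have ij: "i \<le> m" "j \<le> m" using that(2) by auto
    have "(\<Sum>j\<le>m. A' $$ (i, j) * x ^ j) = (\<Sum>j\<le>m. A'' $$ (i, j) * x ^ j)" for x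
      using that[unfolded Q] ij(1) by metis
    then show "A' $$ (i, j) = A'' $$ (i, j)"
      using polyfun_eq_coeffs[where n = m and c = "\<lambda>j. A' $$ (i, j)" and d = "\<lambda>j. A'' $$ (i, j)"] ij(2) by blast
  qed (use that in auto)
  have "?Q (gen_mat m)"
    unfolding generator_matrix_def by (rule theI[of ?Q, OF QA uniq[OF _ QA]])
  then show "gen_mat m \<in> carrier_mat (m + 1) (m + 1)"
    "i \<le> m \<Longrightarrow> generator b \<sigma> \<nu> (\<lambda>u. u ^ i) x = (\<Sum>j\<le>m. gen_mat m $$ (i, j) * x ^ j)"
    unfolding Q by auto
qed

lemma integrable_power: "t \<ge> 0 \<Longrightarrow> integrable (P y) (\<lambda>\<omega>. Y t \<omega> ^ i)"
  by (rule integrable_poly_growth[OF poly_growth_power[OF poly_growth_ident]]) auto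

text \<open>Dynkin's formula for the monomials of degree at most m is a closed linear system, since
  the generator sends each of them to a combination of the others. Picard iteration and the
  entrywise exponential are two sums of the same series.\<close>

lemma local_moment:
  assumes st: "0 \<le> s" "s \<le> t" and A: "A \<in> sets (F s)" and i: "i \<le> m"
  shows "local_expectation y A (\<lambda>u. u ^ i) t =
    (\<Sum>j\<le>m. mat_exp ((t - s) \<cdot>\<^sub>m gen_mat m) $$ (i, j) * local_expectation y A (\<lambda>u. u ^ j) s)"
proof -
  interpret prob_space "P y" by (rule prob_space_P)
  have AM [measurable]: "A \<in> sets (P y)" using A F_subalgebra by (auto simp: subalgebra_def)
  note G = gen_mat_carrier[of m]
  define \<phi> where "\<phi> j r = local_expectation y A (\<lambda>u. u ^ j) r" for j r
  define v where "v j k = (\<Sum>l\<le>m. (gen_mat m ^\<^sub>m k) $$ (j, l) * \<phi> l s)" for j k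
  have sup: "integrable lborel (\<lambda>u. indicator {0..r} u * \<phi> j u)" for r j
    unfolding \<phi>_def by (intro time_space_Fubini(3) AM poly_growth_intros) auto
  have "(\<lambda>k. v i k * ((t - s) ^ k / fact k)) sums \<phi> i t"
  proof -
    \<comment> \<open>One weight bounds all monomials of degree at most m, which yields the bound,
      uniform in time and component, that the Picard iteration requires.\<close>
    obtain K where K: "\<And>r. 0 \<le> r \<Longrightarrow> r \<le> t \<Longrightarrow> (\<integral>\<^sup>+\<omega>. ennreal \<bar>(1 + (Y r \<omega>)\<^sup>2) ^ m\<bar> \<partial>P y) \<le> ennreal K"
      by (erule poly_growth_moment_bound[rotated]) (intro poly_growth_intros)
    \<comment> \<open>\<open>K\<close> is known only through \<open>ennreal K\<close>, which is 0
      for negative \<open>K\<close>; hence \<open>max K 0\<close> as the real bound.\<close>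
    show ?thesis
    proof (rule linear_integral_equation_sums[where m = m and s = s and T = t and a = "\<lambda>i j. gen_mat m $$ (i, j)" and B = "max K 0"])
      fix i r assume i: "i \<le> m" and r: "s \<le> r" "r \<le> t"
      obtain q where q: "generator b \<sigma> \<nu> (poly (monom 1 i)) = poly q" using generator_poly[OF order_refl] by blast
      have qx: "poly q x = (\<Sum>j\<le>m. gen_mat m $$ (i, j) * x ^ j)" for x
        using gen_mat_power[OF i, of x] unfolding power_eq_poly q .
      have "local_expectation y A (poly q) u = (\<Sum>j\<le>m. gen_mat m $$ (i, j) * \<phi> j u)" for u
      proof -
        have "local_expectation y A (poly q) u = (\<integral>\<omega>. (\<Sum>j\<le>m. gen_mat m $$ (i, j) * (indicator A \<omega> * Y (max 0 u) \<omega> ^ j)) \<partial>P y)"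
          unfolding local_expectation_def qx by (simp add: sum_distrib_left mult_ac)
        also have "\<dots> = (\<Sum>j\<le>m. gen_mat m $$ (i, j) * \<phi> j u)"
          unfolding \<phi>_def local_expectation_def
          using integrable_mult_indicator[OF AM integrable_power[of "max 0 u"]]
          by (subst Bochner_Integration.integral_sum) auto
        finally show ?thesis .
      qed
      then show "\<phi> i r = \<phi> i s + (LBINT u. indicator {s..r} u * (\<Sum>j\<le>m. gen_mat m $$ (i, j) * \<phi> j u))"
        using Dynkin_poly[OF st(1) r(1) A q, of y] unfolding \<phi>_def power_eq_poly by simp
      show "\<bar>\<phi> i r\<bar> \<le> max K 0"
      proof -
        have "ennreal \<bar>\<phi> i r\<bar> \<le> (\<integral>\<^sup>+\<omega>. ennreal \<bar>indicator A \<omega> * Y (max 0 r) \<omega> ^ i\<bar> \<partial>P y)"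
          unfolding \<phi>_def local_expectation_def
          using integral_norm_bound_ennreal[OF integrable_mult_indicator[OF AM integrable_power[of "max 0 r" y i]]] by simp
        also have "\<dots> \<le> (\<integral>\<^sup>+\<omega>. ennreal \<bar>(1 + (Y r \<omega>)\<^sup>2) ^ m\<bar> \<partial>P y)"
        proof (intro nn_integral_mono ennreal_leI)
          fix \<omega>
          have "\<bar>Y r \<omega>\<bar> ^ i \<le> (1 + (Y r \<omega>)\<^sup>2) ^ m" using i by (intro abs_power_le_weight) simp
          then show "\<bar>indicator A \<omega> * Y (max 0 r) \<omega> ^ i\<bar> \<le> \<bar>(1 + (Y r \<omega>)\<^sup>2) ^ m\<bar>"
            using st r by (auto simp: indicator_def power_abs max_absorb2)
        qed
        also have "\<dots> \<le> ennreal K" using st r by (intro K) auto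
        also have "\<dots> \<le> ennreal (max K 0)" by (intro ennreal_leI) simp
        finally show ?thesis by (subst (asm) ennreal_le_iff) simp_all
      qed
    next
      fix j r
      have "integrable lborel (\<lambda>u. indicator {s..r} u *\<^sub>R (indicator {0..r} u * \<phi> j u))"
        by (intro integrable_mult_indicator sup) simp
      also have "(\<lambda>u. indicator {s..r} u *\<^sub>R (indicator {0..r} u * \<phi> j u)) = (\<lambda>u. indicator {s..r} u * \<phi> j u)"
        using st by (auto simp: indicator_def fun_eq_iff)
      finally show "integrable lborel (\<lambda>u. indicator {s..r} u * \<phi> j u)" .
    next
      fix i assume i: "i \<le> m"
      have "v i 0 = (\<Sum>l\<le>m. if i = l then \<phi> l s else 0)"
        unfolding v_def using G i by (intro sum.cong) auto
      then show "v i 0 = \<phi> i s" using i by simp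
      fix k
      have "(gen_mat m ^\<^sub>m Suc k) $$ (i, l) = (\<Sum>j\<le>m. gen_mat m $$ (i, j) * (gen_mat m ^\<^sub>m k) $$ (j, l))" if "l \<le> m" for l
        unfolding pow_mat_Suc_left[OF G] using G i that
        by (simp add: scalar_prod_def atLeast0LessThan lessThan_Suc_atMost)
      then have "v i (Suc k) = (\<Sum>l\<le>m. (\<Sum>j\<le>m. gen_mat m $$ (i, j) * (gen_mat m ^\<^sub>m k) $$ (j, l)) * \<phi> l s)"
        unfolding v_def by (intro sum.cong) auto
      also have "\<dots> = (\<Sum>j\<le>m. gen_mat m $$ (i, j) * v j k)"
        unfolding v_def sum_distrib_left sum_distrib_right mult.assoc by (rule sum.swap)
      finally show "v i (Suc k) = (\<Sum>j\<le>m. gen_mat m $$ (i, j) * v j k)" .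
    qed (use i st in auto)
  qed
  moreover have "(\<lambda>k. v i k * ((t - s) ^ k / fact k)) sums (\<Sum>l\<le>m. mat_exp ((t - s) \<cdot>\<^sub>m gen_mat m) $$ (i, l) * \<phi> l s)"
  proof -
    have "(\<lambda>k. \<Sum>l\<le>m. (gen_mat m ^\<^sub>m k) $$ (i, l) * ((t - s) ^ k / fact k) * \<phi> l s) sums
        (\<Sum>l\<le>m. mat_exp ((t - s) \<cdot>\<^sub>m gen_mat m) $$ (i, l) * \<phi> l s)"
      using i by (intro sums_sum sums_mult2 mat_exp_sums[OF G]) auto
    then show ?thesis by (simp add: v_def sum_distrib_left sum_distrib_right mult_ac)
  qed
  ultimately show ?thesis unfolding \<phi>_def by (rule sums_unique2)
qed

text \<open>A conditional expectation is characterized by its integrals over the events of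
  \<open>F s\<close>, and these integrals are the local moments.\<close>

lemma conditional_moment:
  assumes st: "0 \<le> s" "s \<le> t" and i: "i \<le> m"
  shows "AE \<omega> in P y. real_cond_exp (P y) (F s) (\<lambda>\<omega>. Y t \<omega> ^ i) \<omega> =
    (\<Sum>j\<le>m. mat_exp ((t - s) \<cdot>\<^sub>m gen_mat m) $$ (i, j) * Y s \<omega> ^ j)"
proof -
  interpret prob_space "P y" by (rule prob_space_P)
  interpret finite_measure_subalgebra "P y" "F s" by unfold_locales (rule F_subalgebra)
  let ?e = "\<lambda>j. mat_exp ((t - s) \<cdot>\<^sub>m gen_mat m) $$ (i, j)"
  note [measurable] = adapted[OF st(1)]
  show ?thesis
  proof (rule real_cond_exp_charact)
    fix A assume A: "A \<in> sets (F s)"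
    have AM: "A \<in> sets (P y)" using A F_subalgebra by (auto simp: subalgebra_def)
    have "(\<integral>\<omega>\<in>A. Y t \<omega> ^ i \<partial>(P y)) = local_expectation y A (\<lambda>u. u ^ i) t"
      using st by (simp add: local_expectation_def set_lebesgue_integral_def max_absorb2)
    also have "\<dots> = (\<Sum>j\<le>m. ?e j * local_expectation y A (\<lambda>u. u ^ j) s)"
      by (rule local_moment[OF st A i])
    also have "\<dots> = (\<integral>\<omega>. (\<Sum>j\<le>m. ?e j * (indicator A \<omega> * Y s \<omega> ^ j)) \<partial>P y)"
      using integrable_mult_indicator[OF AM integrable_power[OF st(1)]] st
      by (subst Bochner_Integration.integral_sum) (auto simp: local_expectation_def max_absorb2)
    also have "\<dots> = (\<integral>\<omega>\<in>A. (\<Sum>j\<le>m. ?e j * Y s \<omega> ^ j) \<partial>(P y))"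
      by (simp add: set_lebesgue_integral_def sum_distrib_left mult_ac)
    finally show "(\<integral>\<omega>\<in>A. Y t \<omega> ^ i \<partial>(P y)) = (\<integral>\<omega>\<in>A. (\<Sum>j\<le>m. ?e j * Y s \<omega> ^ j) \<partial>(P y))" .
  qed (use st in \<open>auto intro!: integrable_power\<close>)
qed

text \<open>The index set and the exponents are left free for two uses: single indices with
  exponents up to n at the later time, and pairs (a, j) with exponent a + j up to 2n at the earlier
  one.\<close>

lemma conditional_power_sum:
  assumes st: "0 \<le> s" "s \<le> t" and I: "finite I" "\<And>i. i \<in> I \<Longrightarrow> k i \<le> m"
  shows "AE \<omega> in P y. real_cond_exp (P y) (F s) (\<lambda>\<omega>. \<Sum>i\<in>I. c i * Y t \<omega> ^ k i) \<omega> =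
    (\<Sum>i\<in>I. c i * (\<Sum>j\<le>m. mat_exp ((t - s) \<cdot>\<^sub>m gen_mat m) $$ (k i, j) * Y s \<omega> ^ j))"
proof -
  interpret prob_space "P y" by (rule prob_space_P)
  interpret finite_measure_subalgebra "P y" "F s" by unfold_locales (rule F_subalgebra)
  have int: "integrable (P y) (\<lambda>\<omega>. c i * Y t \<omega> ^ k i)" for i
    using st by (intro integrable_mult_right integrable_power) auto
  have "AE \<omega> in P y. \<forall>i\<in>I. real_cond_exp (P y) (F s) (\<lambda>\<omega>. c i * Y t \<omega> ^ k i) \<omega> =
      c i * (\<Sum>j\<le>m. mat_exp ((t - s) \<cdot>\<^sub>m gen_mat m) $$ (k i, j) * Y s \<omega> ^ j)"
  proof (rule AE_finite_allI[OF I(1)])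
    fix i assume "i \<in> I"
    have "AE \<omega> in P y. real_cond_exp (P y) (F s) (\<lambda>\<omega>. c i * Y t \<omega> ^ k i) \<omega> =
        c i * real_cond_exp (P y) (F s) (\<lambda>\<omega>. Y t \<omega> ^ k i) \<omega>"
      using st by (intro real_cond_exp_cmult integrable_power) auto
    then show "AE \<omega> in P y. real_cond_exp (P y) (F s) (\<lambda>\<omega>. c i * Y t \<omega> ^ k i) \<omega> =
        c i * (\<Sum>j\<le>m. mat_exp ((t - s) \<cdot>\<^sub>m gen_mat m) $$ (k i, j) * Y s \<omega> ^ j)"
      using conditional_moment[OF st I(2)[OF \<open>i \<in> I\<close>]] by eventually_elim simp
  qed
  then show ?thesis
    using real_cond_exp_sum[of "\<lambda>i \<omega>. c i * Y t \<omega> ^ k i" I, OF int]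
    by eventually_elim simp
qed

end

section \<open>The matrices \<open>D\<close> and \<open>E\<close>\<close>

lemma basis_col_carrier: "basis_col k j \<in> carrier_mat k 1"
  by (rule carrier_matI) (simp_all add: basis_col_def col_mat_def)

lemma basis_col_index: "r < k \<Longrightarrow> basis_col k j $$ (r, 0) = (if r = j - 1 then 1 else 0)"
  by (auto simp: basis_col_def col_mat_def mat_of_cols_index unit_vec_def)

lemma basis_col_dim [simp]: "dim_row (basis_col k j) = k" "dim_col (basis_col k j) = 1"
  using basis_col_carrier[of k j] by auto

lemma kronecker_dim [simp]:
  "dim_row (A \<otimes>\<^sub>K B) = dim_row A * dim_row B" "dim_col (A \<otimes>\<^sub>K B) = dim_col A * dim_col B"
  by (auto simp: kronecker_def)

lemma kronecker_index:
  "i < dim_row A * dim_row B \<Longrightarrow> j < dim_col A * dim_col B \<Longrightarrow>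
    (A \<otimes>\<^sub>K B) $$ (i, j) = A $$ (i div dim_row B, j div dim_col B) * B $$ (i mod dim_row B, j mod dim_col B)"
  by (simp add: kronecker_def)

lemma div_less_of_less_mult: "k < a * c \<Longrightarrow> k div a < (c::nat)"
  by (metis less_mult_imp_div_less mult.commute)

lemma mod_less_of_less_mult: "k < a * c \<Longrightarrow> k mod a < (a::nat)"
  by (cases "a = 0") auto

text \<open>As vec stacks columns, position k of a matrix with a rows stands for row
  \<open>k mod a\<close> and column \<open>k div a\<close>; the Kronecker factors test these
  separately. The subtractions translate basis indices counted from 1 into matrix indices counted
  from 0.\<close>

lemma E_mat_term_index:
  assumes "r < p" "k < a * c"
  shows "(basis_col p u \<otimes>\<^sub>K transpose_mat (basis_col c j) \<otimes>\<^sub>K transpose_mat (basis_col a i)) $$ (r, k) =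
    (if r = u - 1 \<and> k div a = j - 1 \<and> k mod a = i - 1 then 1 else 0)"
  using assms div_less_of_less_mult[OF assms(2)] mod_less_of_less_mult[OF assms(2)]
  by (simp add: kronecker_index basis_col_index mult.commute)

lemma D_mat_term_index:
  assumes "r < p" "k < a * c"
  shows "(transpose_mat (basis_col p u) \<otimes>\<^sub>K basis_col c j \<otimes>\<^sub>K basis_col a i) $$ (k, r) =
    (if r = u - 1 \<and> k div a = j - 1 \<and> k mod a = i - 1 then 1 else 0)"
  using assms div_less_of_less_mult[OF assms(2)] mod_less_of_less_mult[OF assms(2)]
  by (simp add: kronecker_index basis_col_index mult.commute)

lemma E_mat_carrier: "E_mat a c \<in> carrier_mat (a + c - 1) (a * c)"
  by (simp add: E_mat_def sum_mat_def)

lemma D_mat_carrier: "D_mat a c \<in> carrier_mat (a * c) (a + c - 1)"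
  by (simp add: D_mat_def sum_mat_def)

text \<open>Each row of E contains a single 1. It selects an entry of the first column while r < a
  and afterwards an entry of the last row, so that exactly one entry is taken from each
  antidiagonal.\<close>

lemma E_mat_index:
  assumes r: "r < a + c - 1" and k: "k < a * c" and c: "c \<ge> 1"
  shows "E_mat a c $$ (r, k) = (if k = (if r < a then r else (r - a + 1) * a + (a - 1)) then 1 else 0)"
proof -
  note km = mod_less_of_less_mult[OF k] and kd = div_less_of_less_mult[OF k]
  have "E_mat a c $$ (r, k) =
     (\<Sum>i\<in>{1..a}. if r = i - 1 \<and> k div a = 1 - 1 \<and> k mod a = i - 1 then 1 else 0) +
     (\<Sum>i\<in>{2..c}. if r = a + i - 1 - 1 \<and> k div a = i - 1 \<and> k mod a = a - 1 then 1 else 0)"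
    unfolding E_mat_def sum_mat_def using r k by (simp add: E_mat_term_index)
  also have "(\<Sum>i\<in>{1..a}. if r = i - 1 \<and> k div a = 1 - 1 \<and> k mod a = i - 1 then 1 else 0 :: real) =
      (\<Sum>i\<in>{1..a}. if i = Suc r then (if k = r then 1 else 0) else 0)"
    by (intro sum.cong) (auto simp: div_eq_0_iff)
  also have "\<dots> = (if r < a \<and> k = r then 1 else 0)" by (auto simp: sum.delta')
  also have "(\<Sum>i\<in>{2..c}. if r = a + i - 1 - 1 \<and> k div a = i - 1 \<and> k mod a = a - 1 then 1 else 0 :: real) =
      (\<Sum>i\<in>{2..c}. if i = r + 2 - a then (if r \<ge> a \<and> k div a = r - a + 1 \<and> k mod a = a - 1 then 1 else 0) else 0)"
  proof (rule sum.cong[OF refl])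
    fix i assume "i \<in> {2..c}"
    \<comment> \<open>Here i \<ge> 2 keeps the truncated subtractions honest: the second sum
      contributes only to rows r \<ge> a.\<close>
    then have "(r = a + i - 1 - 1 \<and> k div a = i - 1) = (i = r + 2 - a \<and> r \<ge> a \<and> k div a = r - a + 1)"
      by (simp only: atLeastAtMost_iff) linarith
    then have *: "(r = a + i - 1 - 1 \<and> k div a = i - 1 \<and> k mod a = a - 1) =
        (i = r + 2 - a \<and> (r \<ge> a \<and> k div a = r - a + 1 \<and> k mod a = a - 1))" by blast
    have if_conj: "(if p \<and> q then 1 else 0 :: real) = (if p then (if q then 1 else 0) else 0)" for p q by simp
    show "(if r = a + i - 1 - 1 \<and> k div a = i - 1 \<and> k mod a = a - 1 then 1 else 0 :: real) =
      (if i = r + 2 - a then (if r \<ge> a \<and> k div a = r - a + 1 \<and> k mod a = a - 1 then 1 else 0) else 0)"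
      unfolding * by (rule if_conj)
  qed
  also have "\<dots> = (if r \<ge> a \<and> k div a = r - a + 1 \<and> k mod a = a - 1 then 1 else 0)"
    using r by (auto simp: sum.delta')
  also have "(k div a = r - a + 1 \<and> k mod a = a - 1) = (k = (r - a + 1) * a + (a - 1))"
  proof
    assume "k div a = r - a + 1 \<and> k mod a = a - 1"
    then show "k = (r - a + 1) * a + (a - 1)" using div_mult_mod_eq[of k a] by simp
  next
    assume *: "k = (r - a + 1) * a + (a - 1)"
    have a: "0 < a" using km by simp
    have "k div a = r - a + 1" unfolding * using a by (subst div_mult_self3) auto
    moreover have "k mod a = a - 1" unfolding * using a by (subst mod_mult_self3) auto
    ultimately show "k div a = r - a + 1 \<and> k mod a = a - 1" ..
  qed
  finally show ?thesis by auto
qed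

text \<open>D copies the coordinate with number row plus column into each matrix position, which
  fills every antidiagonal with one value.\<close>

lemma D_mat_index:
  assumes r: "r < a + c - 1" and k: "k < a * c"
  shows "D_mat a c $$ (k, r) = (if r = k mod a + k div a then 1 else 0)"
proof -
  note km = mod_less_of_less_mult[OF k] and kd = div_less_of_less_mult[OF k]
  have "D_mat a c $$ (k, r) =
     (\<Sum>p\<in>{1..a} \<times> {1..c}. if r = fst p + snd p - 1 - 1 \<and> k div a = snd p - 1 \<and> k mod a = fst p - 1 then 1 else 0)"
    unfolding D_mat_def sum_mat_def using r k by (simp add: D_mat_term_index split_beta')
  also have "\<dots> = (\<Sum>p\<in>{1..a} \<times> {1..c}. if p = (Suc (k mod a), Suc (k div a)) then (if r = k mod a + k div a then 1 else 0) else 0)"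
    by (intro sum.cong) auto
  also have "\<dots> = (if r = k mod a + k div a then 1 else 0)"
    using km kd by (simp add: sum.delta')
  finally show ?thesis .
qed

lemma mono_mat_carrier: "mono_mat n x \<in> carrier_mat (n + 1) (n + 1)"
  by (rule carrier_matI) (simp_all add: mono_mat_def mono_vec_def col_mat_def)

lemma mono_mat_index: "i \<le> n \<Longrightarrow> j \<le> n \<Longrightarrow> mono_mat n x $$ (i, j) = x ^ (i + j)"
  by (simp add: mono_mat_def mono_vec_def col_mat_def mat_of_cols_index scalar_prod_def power_add)

text \<open>The entries of X are the powers of x with exponent row plus column, so one entry from
  each antidiagonal already yields all powers up to 2n.\<close>

lemma E_mat_vectorize:
  "E_mat (n + 1) (n + 1) *\<^sub>v vectorize (mono_mat n x) = mono_vec (2 * n) x"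
proof (rule eq_vecI)
  have dimX: "dim_row (mono_mat n x) = n + 1" "dim_col (mono_mat n x) = n + 1"
    using mono_mat_carrier[of n x] by auto
  show dim: "dim_vec (E_mat (n + 1) (n + 1) *\<^sub>v vectorize (mono_mat n x)) = dim_vec (mono_vec (2 * n) x)"
    using E_mat_carrier[of "n + 1" "n + 1"] by (auto simp: mono_vec_def)
  fix r assume "r < dim_vec (mono_vec (2 * n) x)"
  then have r: "r < (n + 1) + (n + 1) - 1" by (simp add: mono_vec_def)
  define k where "k = (if r < n + 1 then r else (r - (n + 1) + 1) * (n + 1) + ((n + 1) - 1))"
  have kr: "k mod (n + 1) + k div (n + 1) = r" and k: "k < (n + 1) * (n + 1)"
  proof -
    have "k mod (n + 1) + k div (n + 1) = r \<and> k < (n + 1) * (n + 1)"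
    proof (cases "r < n + 1")
      case True
      then show ?thesis by (auto simp: k_def)
    next
      case False
      \<comment> \<open>Beyond the first column the selected entry is in the last row n and in
        column d, on the antidiagonal n + d = r.\<close>
      define d where "d = r - n"
      have "r - (n + 1) + 1 = d" using False by (simp add: d_def)
      then have d: "k = d * (n + 1) + n" unfolding k_def using False by simp
      have rd: "r = n + d" "d \<le> n" using False r by (auto simp: d_def)
      have "k div (n + 1) = d" unfolding d by (subst div_mult_self3) auto
      moreover have "k mod (n + 1) = n" unfolding d by (subst mod_mult_self3) auto
      moreover have "d * (n + 1) + n < (n + 1) * (n + 1)"
        using mult_le_mono1[OF rd(2), of "n + 1"] by simp
      ultimately show ?thesis using d rd(1) by simp
    qed
    then show "k mod (n + 1) + k div (n + 1) = r" "k < (n + 1) * (n + 1)" by auto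
  qed
  have "(E_mat (n + 1) (n + 1) *\<^sub>v vectorize (mono_mat n x)) $ r =
      (\<Sum>l\<in>{0..<(n + 1) * (n + 1)}. E_mat (n + 1) (n + 1) $$ (r, l) * vectorize (mono_mat n x) $ l)"
    using r E_mat_carrier[of "n + 1" "n + 1"] by (simp add: scalar_prod_def vectorize_def dimX)
  also have "\<dots> = (\<Sum>l\<in>{0..<(n + 1) * (n + 1)}. if l = k then vectorize (mono_mat n x) $ l else 0)"
    by (intro sum.cong refl) (subst E_mat_index, use r in \<open>auto simp: k_def\<close>)
  also have "\<dots> = vectorize (mono_mat n x) $ k" using k by (simp add: sum.delta)
  also have "\<dots> = mono_mat n x $$ (k mod (n + 1), k div (n + 1))" using k by (simp add: vectorize_def dimX)
  also have "\<dots> = x ^ r"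
    using mod_less_of_less_mult[OF k] div_less_of_less_mult[OF k] kr by (subst mono_mat_index) auto
  finally show "(E_mat (n + 1) (n + 1) *\<^sub>v vectorize (mono_mat n x)) $ r = mono_vec (2 * n) x $ r"
    using r by (simp add: mono_vec_def)
qed

text \<open>Injectivity is what makes the \<open>inv_into\<close> in \<open>unvectorize\<close> a
  genuine inverse on square matrices.\<close>

lemma vectorize_inj: "inj_on vectorize (carrier_mat m m)"
proof (rule inj_onI)
  fix A B :: "'a mat" assume A: "A \<in> carrier_mat m m" and B: "B \<in> carrier_mat m m" and eq: "vectorize A = vectorize B"
  show "A = B"
  proof (rule eq_matI)
    fix i j assume "i < dim_row B" "j < dim_col B"
    then have ij: "i < m" "j < m" using B by auto
    have "j * m + i < m * m"
    proof -
      have "j * m + i < j * m + m" using ij by simp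
      also have "\<dots> = Suc j * m" by simp
      also have "\<dots> \<le> m * m" using ij by (intro mult_le_mono1) simp
      finally show ?thesis .
    qed
    then have "vectorize C $ (j * m + i) = C $$ (i, j)" if "C \<in> carrier_mat m m" for C :: "'a mat"
      using that ij by (simp add: vectorize_def)
    then show "A $$ (i, j) = B $$ (i, j)" using A B eq by metis
  qed (use A B in auto)
qed

lemma unvectorize_D_mat:
  assumes z: "z \<in> carrier_vec (2 * n + 1)"
  shows "unvectorize (n + 1) (D_mat (n + 1) (n + 1) *\<^sub>v z) = Matrix.mat (n + 1) (n + 1) (\<lambda>(i, j). z $ (i + j))"
proof -
  let ?H = "Matrix.mat (n + 1) (n + 1) (\<lambda>(i, j). z $ (i + j))"
  have "D_mat (n + 1) (n + 1) *\<^sub>v z = vectorize ?H"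
  proof (rule eq_vecI)
    show "dim_vec (D_mat (n + 1) (n + 1) *\<^sub>v z) = dim_vec (vectorize ?H)"
      using D_mat_carrier[of "n + 1" "n + 1"] by (auto simp: vectorize_def)
    fix k assume "k < dim_vec (vectorize ?H)"
    then have k: "k < (n + 1) * (n + 1)" by (simp add: vectorize_def)
    note km = mod_less_of_less_mult[OF k] and kd = div_less_of_less_mult[OF k]
    have "(D_mat (n + 1) (n + 1) *\<^sub>v z) $ k = (\<Sum>r\<in>{0..<2 * n + 1}. D_mat (n + 1) (n + 1) $$ (k, r) * z $ r)"
      using k z D_mat_carrier[of "n + 1" "n + 1"] by (simp add: scalar_prod_def)
    also have "\<dots> = (\<Sum>r\<in>{0..<2 * n + 1}. if r = k mod (n + 1) + k div (n + 1) then z $ r else 0)"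
      by (intro sum.cong refl) (subst D_mat_index, use k in auto)
    also have "\<dots> = z $ (k mod (n + 1) + k div (n + 1))" proof -
      have "k mod (n + 1) + k div (n + 1) \<in> {0..<2 * n + 1}" unfolding atLeastLessThan_iff using km kd by linarith
      then show ?thesis by (simp only: sum.delta finite_atLeastLessThan if_True)
    qed
    also have "\<dots> = vectorize ?H $ k" using k km kd by (simp add: vectorize_def)
    finally show "(D_mat (n + 1) (n + 1) *\<^sub>v z) $ k = vectorize ?H $ k" .
  qed
  then show ?thesis unfolding unvectorize_def by (simp add: inv_into_f_f[OF vectorize_inj])
qed

text \<open>The algebraic bridge between the matrix formula and the double sum produced by
  conditioning twice. Multiplying p1 by the inner conditional expectation creates exponents a + j,
  and the Hankel matrix holds the propagated moment of order a + j at position (a, j).\<close>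

lemma correlator_matrix_form:
  assumes e: "e \<in> carrier_mat (n + 1) (n + 1)" and g: "g \<in> carrier_mat (2 * n + 1) (2 * n + 1)"
    and v: "v0 \<in> carrier_vec (n + 1)" "v1 \<in> carrier_vec (n + 1)"
  shows "scalar_prod v1 ((unvectorize (n + 1) ((D_mat (n + 1) (n + 1) * g * E_mat (n + 1) (n + 1)) *\<^sub>v vectorize (mono_mat n x))
      * transpose_mat e) *\<^sub>v v0) =
    (\<Sum>(a, j)\<in>{..n} \<times> {..n}. v1 $ a * (\<Sum>i\<le>n. v0 $ i * e $$ (i, j)) * (\<Sum>l\<le>2 * n. g $$ (a + j, l) * x ^ l))"
proof -
  define z where "z = g *\<^sub>v mono_vec (2 * n) x"
  have mv: "mono_vec (2 * n) x \<in> carrier_vec (2 * n + 1)" by (simp add: mono_vec_def)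
  have z: "z \<in> carrier_vec (2 * n + 1)" using g mv by (simp add: z_def)
  have zi: "z $ k = (\<Sum>l\<le>2 * n. g $$ (k, l) * x ^ l)" if "k \<le> 2 * n" for k
    using g that by (simp add: z_def mono_vec_def scalar_prod_def atLeast0LessThan lessThan_Suc_atMost)
  have D: "D_mat (n + 1) (n + 1) \<in> carrier_mat ((n + 1) * (n + 1)) (2 * n + 1)"
    and E: "E_mat (n + 1) (n + 1) \<in> carrier_mat (2 * n + 1) ((n + 1) * (n + 1))"
    using D_mat_carrier[of "n + 1" "n + 1"] E_mat_carrier[of "n + 1" "n + 1"] by (simp_all add: mult_2)
  have w: "vectorize (mono_mat n x) \<in> carrier_vec ((n + 1) * (n + 1))"
    unfolding vectorize_def carrier_matD[OF mono_mat_carrier[of n x]] by (rule vec_carrier)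
  have "(D_mat (n + 1) (n + 1) * g * E_mat (n + 1) (n + 1)) *\<^sub>v vectorize (mono_mat n x) =
      (D_mat (n + 1) (n + 1) * g) *\<^sub>v (E_mat (n + 1) (n + 1) *\<^sub>v vectorize (mono_mat n x))"
    by (rule assoc_mult_mat_vec[OF mult_carrier_mat[OF D g] E w])
  also have "\<dots> = D_mat (n + 1) (n + 1) *\<^sub>v z"
    unfolding z_def E_mat_vectorize by (rule assoc_mult_mat_vec[OF D g mv])
  finally have "(D_mat (n + 1) (n + 1) * g * E_mat (n + 1) (n + 1)) *\<^sub>v vectorize (mono_mat n x) = D_mat (n + 1) (n + 1) *\<^sub>v z" .
  then have H: "unvectorize (n + 1) ((D_mat (n + 1) (n + 1) * g * E_mat (n + 1) (n + 1)) *\<^sub>v vectorize (mono_mat n x)) =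
      Matrix.mat (n + 1) (n + 1) (\<lambda>(i, j). z $ (i + j))" (is "_ = ?H")
    by (simp only: unvectorize_D_mat[OF z])
  have Hc: "?H \<in> carrier_mat (n + 1) (n + 1)" by simp
  have et: "transpose_mat e \<in> carrier_mat (n + 1) (n + 1)" using e by simp
  \<comment> \<open>These are the coefficients of the polynomial obtained from p0 by the inner
    conditioning.\<close>
  have c: "(transpose_mat e *\<^sub>v v0) $ j = (\<Sum>i\<le>n. v0 $ i * e $$ (i, j))" if "j \<le> n" for j
    using e v that by (simp add: scalar_prod_def atLeast0LessThan lessThan_Suc_atMost mult.commute)
  define u where "u = transpose_mat e *\<^sub>v v0"
  have u: "u \<in> carrier_vec (n + 1)" using et v by (simp add: u_def)
  have Hu: "(?H *\<^sub>v u) $ a = (\<Sum>j\<le>n. z $ (a + j) * u $ j)" if "a \<le> n" for a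
    using that u by (simp add: scalar_prod_def atLeast0LessThan lessThan_Suc_atMost)
  have "scalar_prod v1 ((?H * transpose_mat e) *\<^sub>v v0) = scalar_prod v1 (?H *\<^sub>v u)"
    by (simp only: assoc_mult_mat_vec[OF Hc et v(1)] u_def)
  also have "\<dots> = (\<Sum>a\<le>n. v1 $ a * (?H *\<^sub>v u) $ a)"
    by (simp add: scalar_prod_def[of v1] atLeast0LessThan lessThan_Suc_atMost del: index_mult_mat_vec)
  also have "\<dots> = (\<Sum>a\<le>n. v1 $ a * (\<Sum>j\<le>n. z $ (a + j) * u $ j))"
    by (intro sum.cong refl) (simp only: Hu atMost_iff)
  also have "\<dots> = (\<Sum>a\<le>n. \<Sum>j\<le>n. v1 $ a * (\<Sum>i\<le>n. v0 $ i * e $$ (i, j)) * (\<Sum>l\<le>2 * n. g $$ (a + j, l) * x ^ l))"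
  proof (intro sum.cong refl)
    fix a assume "a \<in> {..n}"
    have "v1 $ a * (\<Sum>j\<le>n. z $ (a + j) * u $ j) = (\<Sum>j\<le>n. v1 $ a * (z $ (a + j) * u $ j))"
      by (rule sum_distrib_left)
    also have "\<dots> = (\<Sum>j\<le>n. v1 $ a * (\<Sum>i\<le>n. v0 $ i * e $$ (i, j)) * (\<Sum>l\<le>2 * n. g $$ (a + j, l) * x ^ l))"
      using \<open>a \<in> {..n}\<close> by (intro sum.cong refl) (simp add: zi c u_def del: index_mult_mat_vec)
    finally show "v1 $ a * (\<Sum>j\<le>n. z $ (a + j) * u $ j) =
        (\<Sum>j\<le>n. v1 $ a * (\<Sum>i\<le>n. v0 $ i * e $$ (i, j)) * (\<Sum>l\<le>2 * n. g $$ (a + j, l) * x ^ l))" .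
  qed
  finally show ?thesis unfolding H by (simp add: sum.cartesian_product)
qed

text \<open>Integrability belongs to the conclusion because \<open>real_cond_exp\<close> is a total
  function, so the equation by itself would not show that the conditional expectation
  exists.\<close>

theorem theorem3p8:
  fixes M :: "'a measure" and F :: "real \<Rightarrow> 'a measure" and P :: "real \<Rightarrow> 'a measure"
    and Y :: "real \<Rightarrow> 'a \<Rightarrow> real" and b \<sigma> :: "real \<Rightarrow> real" and \<nu> :: "real \<Rightarrow> real measure"
    and p0 p1 :: "real poly" and n0 n1 n :: nat and v0 v1 :: "real vec"
    and t s0 s1 y :: real
  assumes "polynomial_jump_diffusion M F P Y b \<sigma> \<nu>"
    and "degree p0 \<le> n0" and "degree p1 \<le> n1"
    and "n = max n0 n1" and "n \<ge> 1"
    and "v0 \<in> carrier_vec (n + 1)" and "\<And>x. poly p0 x = scalar_prod v0 (mono_vec n x)"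
    and "v1 \<in> carrier_vec (n + 1)" and "\<And>x. poly p1 x = scalar_prod v1 (mono_vec n x)"
    and "0 \<le> t" and "t < s0" and "s0 < s1"
  shows "integrable (P y) (\<lambda>\<omega>. poly p1 (Y s0 \<omega>) * poly p0 (Y s1 \<omega>)) \<and>
    (AE \<omega> in P y.
       real_cond_exp (P y) (F t) (\<lambda>\<omega>. poly p1 (Y s0 \<omega>) * poly p0 (Y s1 \<omega>)) \<omega> =
       scalar_prod v1
         ((unvectorize (n + 1)
             ((D_mat (n + 1) (n + 1)
                 * mat_exp ((s0 - t) \<cdot>\<^sub>m generator_matrix (generator b \<sigma> \<nu>) (2 * n))
                 * E_mat (n + 1) (n + 1))
               *\<^sub>v vectorize (mono_mat n (Y t \<omega>)))
           * mat_exp ((s1 - s0) \<cdot>\<^sub>m transpose_mat (generator_matrix (generator b \<sigma> \<nu>) n)))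
          *\<^sub>v v0))"
proof -
  interpret polynomial_jump_diffusion M F P Y b \<sigma> \<nu> by (rule assms(1))
  interpret prob_space "P y" by (rule prob_space_P)
  interpret A: finite_measure_subalgebra "P y" "F s0" by unfold_locales (rule F_subalgebra)
  interpret B: finite_measure_subalgebra "P y" "F t" by unfold_locales (rule F_subalgebra)
  have times: "0 \<le> s0" "0 \<le> s1" "t \<le> s0" "s0 \<le> s1" using assms(10-12) by auto
  have Ft: "F t \<in> {H. subalgebra (F s0) H}"
    using sets_F_mono[OF times(3)] by (simp add: subalgebra_def space_F)
  note [measurable] = Y_measurable[OF times(1), of y] Y_measurable[OF times(2), of y] adapted[OF times(1)]
  define e where "e = mat_exp ((s1 - s0) \<cdot>\<^sub>m gen_mat n)"
  define g where "g = mat_exp ((s0 - t) \<cdot>\<^sub>m gen_mat (2 * n))"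
  have e: "e \<in> carrier_mat (n + 1) (n + 1)" and g: "g \<in> carrier_mat (2 * n + 1) (2 * n + 1)"
    unfolding e_def g_def by (intro mat_exp_carrier smult_carrier_mat gen_mat_carrier)+
  have poly_eq: "scalar_prod v (mono_vec n x) = (\<Sum>i\<le>n. v $ i * x ^ i)" for v x
    by (simp add: mono_vec_def scalar_prod_def atLeast0LessThan lessThan_Suc_atMost)
  have p0: "poly p0 x = (\<Sum>i\<le>n. v0 $ i * x ^ i)" and p1: "poly p1 x = (\<Sum>i\<le>n. v1 $ i * x ^ i)" for x
    by (simp_all only: assms(7,9) poly_eq)
  have poly_measurable [measurable]: "poly p \<in> borel_measurable borel" for p :: "real poly"
    by (rule C2_derivs_measurable[OF C2_derivs_poly])
  have poly_integrable: "integrable (P y) (\<lambda>\<omega>. poly p (Y r \<omega>))" if "r \<ge> 0" for p r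
    by (rule integrable_poly_growth[OF poly_growth_poly poly_measurable that])
  define X where "X \<omega> = poly p1 (Y s0 \<omega>) * poly p0 (Y s1 \<omega>)" for \<omega>
  have X: "integrable (P y) X"
  proof (rule Bochner_Integration.integrable_bound)
    show "integrable (P y) (\<lambda>\<omega>. poly (p1 * p1) (Y s0 \<omega>) + poly (p0 * p0) (Y s1 \<omega>))"
      by (intro Bochner_Integration.integrable_add poly_integrable times)
    show "X \<in> borel_measurable (P y)" unfolding X_def by measurable
    \<comment> \<open>Bounding the product by a sum of squares separates the two times, and each
      square is again a polynomial evaluated at one time.\<close>
    have "\<bar>u * v\<bar> \<le> u * u + v * v" for u v :: real
      using sum_squares_bound[of "\<bar>u\<bar>" "\<bar>v\<bar>"] mult_nonneg_nonneg[OF abs_ge_zero[of u] abs_ge_zero[of v]]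
      unfolding power2_eq_square abs_mult abs_mult_self_eq by linarith
    then show "AE \<omega> in P y. norm (X \<omega>) \<le> norm (poly (p1 * p1) (Y s0 \<omega>) + poly (p0 * p0) (Y s1 \<omega>))"
      by (auto simp: X_def intro: order_trans[OF _ abs_ge_self])
  qed
  define c where "c j = (\<Sum>i\<le>n. v0 $ i * e $$ (i, j))" for j
  \<comment> \<open>The inner conditioning leaves a polynomial of degree at most 2n in
    \<open>Y s0\<close>; this is the origin of the generator matrix of order 2n in the outer
    step.\<close>
  define X' where "X' \<omega> = (\<Sum>(a, j)\<in>{..n} \<times> {..n}. v1 $ a * c j * Y s0 \<omega> ^ (a + j))" for \<omega>
  have X'm: "X' \<in> borel_measurable (P y)" unfolding X'_def by (simp add: split_beta')
  have "AE \<omega> in P y. real_cond_exp (P y) (F s0) X \<omega> = X' \<omega>"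
  proof -
    \<comment> \<open>The factor \<open>poly p1 (Y s0 \<omega>)\<close> is measurable with respect
      to \<open>F s0\<close> and can be taken out of the conditional expectation.\<close>
    have "AE \<omega> in P y. real_cond_exp (P y) (F s0) X \<omega> =
        poly p1 (Y s0 \<omega>) * real_cond_exp (P y) (F s0) (\<lambda>\<omega>. poly p0 (Y s1 \<omega>)) \<omega>"
      unfolding X_def by (rule A.real_cond_exp_mult) (use X in \<open>simp_all add: X_def[abs_def]\<close>)
    then show ?thesis
      using conditional_power_sum[OF times(1,4), of "{..n}" "\<lambda>i. i" n y "\<lambda>i. v0 $ i", simplified]
      unfolding p0
    proof eventually_elim
      case (elim \<omega>)
      have "(\<Sum>i\<le>n. v0 $ i * (\<Sum>j\<le>n. e $$ (i, j) * Y s0 \<omega> ^ j)) = (\<Sum>j\<le>n. c j * Y s0 \<omega> ^ j)"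
        unfolding c_def sum_distrib_left sum_distrib_right mult.assoc by (rule sum.swap)
      then have "real_cond_exp (P y) (F s0) X \<omega> = (\<Sum>a\<le>n. v1 $ a * Y s0 \<omega> ^ a) * (\<Sum>j\<le>n. c j * Y s0 \<omega> ^ j)"
        using elim by (simp add: e_def p1)
      also have "\<dots> = X' \<omega>"
        unfolding X'_def sum_product sum.cartesian_product by (intro sum.cong) (auto simp: power_add mult_ac)
      finally show ?case .
    qed
  qed
  \<comment> \<open>The inner result is known only almost surely, so it is transported through the
    outer conditioning by congruence before the tower property is applied.\<close>
  then have "AE \<omega> in P y. real_cond_exp (P y) (F t) (real_cond_exp (P y) (F s0) X) \<omega> = real_cond_exp (P y) (F t) X' \<omega>"
    by (rule B.real_cond_exp_cong[OF _ borel_measurable_cond_exp2 X'm])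
  moreover have "AE \<omega> in P y. real_cond_exp (P y) (F t) (real_cond_exp (P y) (F s0) X) \<omega> = real_cond_exp (P y) (F t) X \<omega>"
    using Ft by (intro B.real_cond_exp_nested_subalg F_subalgebra X) simp
  moreover have "AE \<omega> in P y. real_cond_exp (P y) (F t) X' \<omega> =
      (\<Sum>(a, j)\<in>{..n} \<times> {..n}. v1 $ a * c j * (\<Sum>l\<le>2 * n. g $$ (a + j, l) * Y t \<omega> ^ l))"
    using conditional_power_sum[OF assms(10) times(3), of "{..n} \<times> {..n}" "\<lambda>(a, j). a + j" "2 * n" y "\<lambda>(a, j). v1 $ a * c j"]
    unfolding X'_def[abs_def] g_def by (auto simp: split_beta')
  ultimately have "AE \<omega> in P y. real_cond_exp (P y) (F t) X \<omega> =
      (\<Sum>(a, j)\<in>{..n} \<times> {..n}. v1 $ a * c j * (\<Sum>l\<le>2 * n. g $$ (a + j, l) * Y t \<omega> ^ l))"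
    by eventually_elim simp
  then show ?thesis
    using X unfolding mat_exp_transpose[OF gen_mat_carrier] e_def[symmetric] g_def[symmetric]
      correlator_matrix_form[OF e g assms(6,8)] c_def X_def[abs_def] by blast
qed

end
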